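(* For every $p\in\mathcal I$ with $p\ne\bar p$, the value function $V_p$ defined in the context is the unique bounded and uniformly continuous viscosity solution $u:\mathbb R^d\times[0,T]\to\mathbb R$ of $$\begin{cases}\max\{u(x,t)-\psi_p(x,t),\ -u_t(x,t)+\lambda u(x,t)+H^p(x,t,D_xu(x,t))\}=0,&(x,t)\in\mathbb R^d\times[0,T[,\\ u(x,T)=\psi_p(x,T),&x\in\mathbb R^d,\end{cases}$$ where $$\psi_p(x,t)=\inf_{p'\in\mathcal I_p}\big(C(x,p,p')+V_{p'}(x,t)\big),\qquad H^p(x,t,\xi)=\sup_{a\in A}\{-f(x,a,p)\cdot\xi-\ell(x,a,p,t)\}.$$
   Context: Data. $N\ge1$ is an integer, $\mathcal I=\{0,1\}^N$, $\bar p=(1,\dots,1)\in\mathcal I$, $T>0$, $\lambda\ge0$, $A\subset\mathbb R^m$ is compact (nonempty), and $\mathcal A=\{\alpha:[0,+\infty[\to A \text{ measurable}\}$. For $p=(p^1,\dots,p^N)\in\mathcal I$, $$\mathcal I_p=\{\tilde p\in\mathcal I:\ p^i=1\Rightarrow\tilde p^i=1,\ \text{and there is } l \text{ with } p^l=0,\ \tilde p^l=1\},$$ so $\mathcal I_{\bar p}=\emptyset$. Assumptions. $f:\mathbb R^d\times A\times\mathcal I\to\mathbb R^d$ is continuous, bounded, and there is $L>0$ with $\|f(x,a,p)-f(y,a,p)\|\le L\|x-y\|$ for all $x,y\in\mathbb R^d$, $a\in A$, $p\in\mathcal I$. $\ell:\mathbb R^d\times A\times\mathcal I\times[0,T]\to[0,+\infty[$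 is bounded, continuous, and uniformly continuous with respect to $x$ uniformly with respect to $(a,p,t)$. $C:\mathbb R^d\times\mathcal I\times\mathcal I\to[0,+\infty[$ is uniformly continuous with respect to $x\in\mathbb R^d$, uniformly with respect to $p\in\mathcal I$, $p'\in\mathcal I_p$. Value functions. Set $V_{\bar p}\equiv0$. Proceeding backwardly (by induction on the number of zeros of $p$), for $p\ne\bar p$ and $(x,t)\in\mathbb R^d\times[0,T]$ define $$V_p(x,t)=\inf_{\alpha\in\mathcal A,\ \tau\in[t,T],\ p'\in\mathcal I_p}\left(\int_t^{\tau}e^{-\lambda(s-t)}\ell(y(s),\alpha(s),p,s)\,ds+e^{-\lambda(\tau-t)}\big(C(y(\tau),p,p')+V_{p'}(y(\tau),\tau)\big)\right),$$ where $y'(s)=f(y(s),\alpha(s),p)$ for a.e. $s\in\,]t,T]$, $y(t)=x$. Viscosity solutions. A continuous $u$ on $\mathbb R^d\times[0,T]$ is a viscosity solution of $\max\{u-\psi,\,-u_t+\lambda u+H(x,t,D_xu)\}=0$ in $\mathbb R^d\times[0,T[$ with $u(\cdot,T)=\psi(\cdot,T)$ if the terminal condition holds pointwise and, for every $\varphi\in C^1(\mathbb R^d\times[0,T])$: at every local maximum point $(x,t)\in\mathbb R^d\times[0,T[$ of $u-\varphi$ (relative to $\mathbb R^d\times[0,T[$), $\max\{u(x,t)-\psi(x,t),-\varphi_t(x,t)+\lambda u(x,t)+H(x,t,D_x\varphi(x,t))\}\le0$; and at every local minimum point of $u-\varphi$ the same expression is $\ge0$.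
   Formalization: The switching cost C is additionally assumed bounded over x, p and p' in I_p; without this the claim fails (N=1, f=0, ℓ=0, C(x,0,1)=|x| gives V_p(x,T)=|x|, which is unbounded). *)

theory Defs
  imports "HOL-Analysis.Analysis"
begin

text \<open>
  States live in \<open>real ^ 'd\<close>, controls in \<open>real ^ 'm\<close>, and a switching mode, an element of
  \<open>{0,1}^N\<close> with \<open>N = CARD('n)\<close>, is a vector \<open>p :: bool ^ 'n\<close> (\<open>p $ i\<close> meaning \<open>p^i = 1\<close>).
  The topology on \<open>bool ^ 'n\<close> is the discrete one.
\<close>

definition all_ones :: "bool ^ 'n" where
  "all_ones = (\<chi> i. True)"

definition successors :: "bool ^ 'n \<Rightarrow> (bool ^ 'n) set" where
  "successors p = {p'. (\<forall>i. p $ i \<longrightarrow> p' $ i) \<and> (\<exists>l. \<not> p $ l \<and> p' $ l)}"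

definition controls :: "(real ^ 'm) set \<Rightarrow> (real \<Rightarrow> real ^ 'm) set" where
  "controls A = {\<alpha>. \<alpha> \<in> borel_measurable (lebesgue_on {0..}) \<and> (\<forall>s\<ge>0. \<alpha> s \<in> A)}"

definition abs_continuous_on_interval ::
    "real \<Rightarrow> real \<Rightarrow> (real \<Rightarrow> 'a::real_normed_vector) \<Rightarrow> bool" where
  "abs_continuous_on_interval a b g \<longleftrightarrow>
    (\<forall>\<epsilon>>0. \<exists>\<delta>>0. \<forall>D::(real \<times> real) set.
       finite D \<and> (\<forall>(u, v)\<in>D. a \<le> u \<and> u \<le> v \<and> v \<le> b) \<and>
       disjoint_family_on (\<lambda>(u, v). {u<..<v}) D \<and> (\<Sum>(u, v)\<in>D. v - u) < \<delta>
       \<longrightarrow> (\<Sum>(u, v)\<in>D. norm (g v - g u)) < \<epsilon>)"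

text \<open>
  Caratheodory solutions of \<open>y'(s) = f(y(s), \<alpha>(s), p)\<close> for a.e. \<open>s\<close> in \<open>]t,T]\<close>, \<open>y(t) = x\<close>.
  Only the restriction of \<open>y\<close> to \<open>[t,T]\<close> is relevant.
\<close>

definition is_trajectory ::
    "(real ^ 'd \<Rightarrow> real ^ 'm \<Rightarrow> bool ^ 'n \<Rightarrow> real ^ 'd) \<Rightarrow> real \<Rightarrow> bool ^ 'n \<Rightarrow> (real \<Rightarrow> real ^ 'm) \<Rightarrow>
     real ^ 'd \<Rightarrow> real \<Rightarrow> (real \<Rightarrow> real ^ 'd) \<Rightarrow> bool" where
  "is_trajectory f T p \<alpha> x t y \<longleftrightarrow>
     abs_continuous_on_interval t T y \<and> y t = x \<and>
     (AE s in lebesgue. s \<in> {t<..T} \<longrightarrow>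
        (y has_vector_derivative f (y s) (\<alpha> s) p) (at s within {t..T}))"

text \<open>
  The trajectory is uniquely determined on \<open>[t,T]\<close> by the control when \<open>f\<close> is Lipschitz in the
  state, so letting it range over all solutions adds nothing to the infimum over
  \<open>\<alpha>\<close>, \<open>\<tau>\<close> and \<open>p'\<close>.
\<close>

function value_fun ::
    "(real ^ 'm) set \<Rightarrow> (real ^ 'd \<Rightarrow> real ^ 'm \<Rightarrow> bool ^ 'n \<Rightarrow> real ^ 'd) \<Rightarrow>
     (real ^ 'd \<Rightarrow> real ^ 'm \<Rightarrow> bool ^ 'n \<Rightarrow> real \<Rightarrow> real) \<Rightarrow>
     (real ^ 'd \<Rightarrow> bool ^ 'n \<Rightarrow> bool ^ 'n \<Rightarrow> real) \<Rightarrow> real \<Rightarrow> real \<Rightarrow>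
     bool ^ 'n \<Rightarrow> real ^ 'd \<Rightarrow> real \<Rightarrow> real" where
  "value_fun A f ell C lam T p x t =
    (if p = all_ones then 0
     else INF (\<alpha>, y, \<tau>, p') \<in> {(\<alpha>, y, \<tau>, p'). \<alpha> \<in> controls A \<and> is_trajectory f T p \<alpha> x t y \<and>
                                   \<tau> \<in> {t..T} \<and> p' \<in> successors p}.
            (LINT s:{t..\<tau>}|lebesgue. exp (- lam * (s - t)) * ell (y s) (\<alpha> s) p s) +
            exp (- lam * (\<tau> - t)) * (C (y \<tau>) p p' + value_fun A f ell C lam T p' (y \<tau>) \<tau>))"
  by pat_completeness auto
termination
proof (relation "Wellfounded.measure (\<lambda>(A, f, ell, C, lam, T, p, x, t). card {i. \<not> p $ i})", goal_cases)
  case 1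
  then show ?case by simp
next
  case (2 A f ell C lam T p x t z \<alpha> q y q' \<tau> p')
  then have "p' \<in> successors p" by auto
  then have "{i. \<not> p' $ i} \<subset> {i. \<not> p $ i}"
    unfolding successors_def by auto
  then show ?case by (auto intro: psubset_card_mono)
qed

declare value_fun.simps [simp del]

definition obstacle ::
    "(real ^ 'm) set \<Rightarrow> (real ^ 'd \<Rightarrow> real ^ 'm \<Rightarrow> bool ^ 'n \<Rightarrow> real ^ 'd) \<Rightarrow>
     (real ^ 'd \<Rightarrow> real ^ 'm \<Rightarrow> bool ^ 'n \<Rightarrow> real \<Rightarrow> real) \<Rightarrow>
     (real ^ 'd \<Rightarrow> bool ^ 'n \<Rightarrow> bool ^ 'n \<Rightarrow> real) \<Rightarrow> real \<Rightarrow> real \<Rightarrow>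
     bool ^ 'n \<Rightarrow> real ^ 'd \<Rightarrow> real \<Rightarrow> real" where
  "obstacle A f ell C lam T p x t =
     (INF p' \<in> successors p. C x p p' + value_fun A f ell C lam T p' x t)"

definition hamiltonian ::
    "(real ^ 'm) set \<Rightarrow> (real ^ 'd \<Rightarrow> real ^ 'm \<Rightarrow> bool ^ 'n \<Rightarrow> real ^ 'd) \<Rightarrow>
     (real ^ 'd \<Rightarrow> real ^ 'm \<Rightarrow> bool ^ 'n \<Rightarrow> real \<Rightarrow> real) \<Rightarrow>
     bool ^ 'n \<Rightarrow> real ^ 'd \<Rightarrow> real \<Rightarrow> real ^ 'd \<Rightarrow> real" where
  "hamiltonian A f ell p x t \<xi> = (SUP a \<in> A. - (f x a p \<bullet> \<xi>) - ell x a p t)"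

text \<open>
  \<open>\<phi>\<close> is of class \<open>C^1\<close> on the closed strip \<open>real ^ 'd \<times> [0,T]\<close> (one-sided in time at \<open>t = 0\<close> and
  \<open>t = T\<close>), with spatial gradient \<open>Dx\<close> and time derivative \<open>Dt\<close>.
\<close>

definition C1_on_strip ::
    "real \<Rightarrow> (real ^ 'd \<Rightarrow> real \<Rightarrow> real) \<Rightarrow> (real ^ 'd \<Rightarrow> real \<Rightarrow> real ^ 'd) \<Rightarrow>
     (real ^ 'd \<Rightarrow> real \<Rightarrow> real) \<Rightarrow> bool" where
  "C1_on_strip T \<phi> Dx Dt \<longleftrightarrow>
     continuous_on (UNIV \<times> {0..T}) (\<lambda>(x, t). Dx x t) \<and>
     continuous_on (UNIV \<times> {0..T}) (\<lambda>(x, t). Dt x t) \<and>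
     (\<forall>x. \<forall>t\<in>{0..T}.
        ((\<lambda>(x, t). \<phi> x t) has_derivative (\<lambda>(h, k). Dx x t \<bullet> h + Dt x t * k))
          (at (x, t) within UNIV \<times> {0..T}))"

definition local_max_at :: "real \<Rightarrow> (real ^ 'd \<Rightarrow> real \<Rightarrow> real) \<Rightarrow> real ^ 'd \<Rightarrow> real \<Rightarrow> bool" where
  "local_max_at T w x t \<longleftrightarrow>
     (\<exists>r>0. \<forall>(x', t') \<in> ball (x, t) r \<inter> (UNIV \<times> {0..<T}). w x' t' \<le> w x t)"

definition local_min_at :: "real \<Rightarrow> (real ^ 'd \<Rightarrow> real \<Rightarrow> real) \<Rightarrow> real ^ 'd \<Rightarrow> real \<Rightarrow> bool" where
  "local_min_at T w x t \<longleftrightarrow>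
     (\<exists>r>0. \<forall>(x', t') \<in> ball (x, t) r \<inter> (UNIV \<times> {0..<T}). w x t \<le> w x' t')"

definition viscosity_solution ::
    "real \<Rightarrow> real \<Rightarrow> (real ^ 'd \<Rightarrow> real \<Rightarrow> real) \<Rightarrow> (real ^ 'd \<Rightarrow> real \<Rightarrow> real ^ 'd \<Rightarrow> real) \<Rightarrow>
     (real ^ 'd \<Rightarrow> real \<Rightarrow> real) \<Rightarrow> bool" where
  "viscosity_solution lam T \<psi> H u \<longleftrightarrow>
     continuous_on (UNIV \<times> {0..T}) (\<lambda>(x, t). u x t) \<and>
     (\<forall>x. u x T = \<psi> x T) \<and>
     (\<forall>\<phi> Dx Dt. C1_on_strip T \<phi> Dx Dt \<longrightarrow>
        (\<forall>x. \<forall>t\<in>{0..<T}.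
           (local_max_at T (\<lambda>x t. u x t - \<phi> x t) x t \<longrightarrow>
              max (u x t - \<psi> x t) (- Dt x t + lam * u x t + H x t (Dx x t)) \<le> 0) \<and>
           (local_min_at T (\<lambda>x t. u x t - \<phi> x t) x t \<longrightarrow>
              max (u x t - \<psi> x t) (- Dt x t + lam * u x t + H x t (Dx x t)) \<ge> 0)))"

definition buc_viscosity_solution ::
    "real \<Rightarrow> real \<Rightarrow> (real ^ 'd \<Rightarrow> real \<Rightarrow> real) \<Rightarrow> (real ^ 'd \<Rightarrow> real \<Rightarrow> real ^ 'd \<Rightarrow> real) \<Rightarrow>
     (real ^ 'd \<Rightarrow> real \<Rightarrow> real) \<Rightarrow> bool" where
  "buc_viscosity_solution lam T \<psi> H u \<longleftrightarrow>
     bounded ((\<lambda>(x, t). u x t) ` (UNIV \<times> {0..T})) \<and>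
     uniformly_continuous_on (UNIV \<times> {0..T}) (\<lambda>(x, t). u x t) \<and>
     viscosity_solution lam T \<psi> H u"

end

theory Submission
  imports Defs
begin

text \<open>
  The recursion over the modes makes each \<open>V_p\<close> the value of an optimal stopping problem: run the
  controlled system of mode \<open>p\<close>, pay the running cost, and stop at a time of one's choice at the
  price \<open>\<psi>_p\<close>. Only the successors of \<open>p\<close> enter \<open>\<psi>_p\<close>, so once they are known to be bounded and
  uniformly continuous, so is \<open>\<psi>_p\<close>, and everything reduces to a single statement about optimal
  stopping with a bounded uniformly continuous stopping cost \<open>\<psi>\<close>: its value \<open>W\<close> is bounded and
  uniformly continuous, and it is the only viscosity solution of the obstacle problem with that
  regularity. Induction on the number of zeros of \<open>p\<close> then gives the theorem
  (\<open>value_fun_buc\<close>, \<open>value_fun_viscosity_solution\<close>).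

  \<^emph>\<open>Regularity and dynamic programming.\<close> Trajectories driven by the same control stay within a fixed
  multiple of their initial distance (\<open>trajectory_dist\<close>), so using one near-optimal strategy from two
  starting points gives a modulus in space. Restricting and concatenating strategies gives
  the two halves of the dynamic programming principle (\<open>running_plus_value_le_cost\<close>,
  \<open>stopping_value_le_running_plus_value\<close>). Together with the bound \<open>M\<close> on the speed they turn the
  modulus in space into one in time.

  \<^emph>\<open>The equation.\<close> If \<open>\<phi>\<close> touches \<open>W\<close> at \<open>(x, t)\<close>, then along any trajectory from \<open>(x, t)\<close> the
  running cost on \<open>[t, t + k]\<close> plus the discounted value of \<open>W(x, t) + \<phi>(y(t + k), t + k) - \<phi>(x, t)\<close>
  exceeds \<open>W(x, t)\<close>, up to \<open>o(k)\<close> uniformly in the control, by the integral over \<open>[t, t + k]\<close> of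
  \<open>l(x, \<alpha>(r), t) + f(x, \<alpha>(r)) \<bullet> D\<phi> + \<phi>_t - \<lambda> W\<close>, with everything but the control frozen at \<open>(x, t)\<close>
  (\<open>dynamic_expansion\<close>). Freezing the coefficients avoids a chain rule along curves that are merely
  absolutely continuous. For a maximum of \<open>W - \<phi>\<close>, constant controls
  yield the subsolution inequality. For a minimum, a violated supersolution inequality makes every
  strategy, whether it stops early or not, cost more than \<open>W(x, t)\<close> by a fixed margin, which is
  impossible for an infimum.

  \<^emph>\<open>Uniqueness.\<close> Two solutions \<open>u, v\<close> are compared by maximizing
  \<open>u(x, t) - v(y, s) - \<kappa>/2 (|x - y|^2 + (t - s)^2) - \<delta> |x|^2 - \<eta> (T - t)\<close>. The term in \<open>\<delta>\<close> produces a
  maximum on the unbounded state space, the term in \<open>\<eta>\<close> makes \<open>u\<close> a strict subsolution, which is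
  what replaces a positive discount rate. For large \<open>\<kappa>\<close> the maximum point is close to the diagonal.
  At the terminal time, or where \<open>v\<close> reaches the obstacle, \<open>u - v\<close> would be almost nonpositive there,
  so both Hamiltonian inequalities hold, and their difference contradicts \<open>\<eta> > 0\<close>
  (\<open>viscosity_comparison\<close>).

  Trajectories are given as absolutely continuous curves solving the equation almost everywhere.
  All estimates use the integral equation. It follows from the differential form by a gauge argument
  (\<open>abs_continuous_has_integral\<close>) and implies it by Lebesgue's differentiation theorem
  (\<open>indefinite_integral_has_vector_derivative_AE\<close>).
\<close>

section \<open>Absolutely continuous functions as indefinite integrals\<close>

text \<open>
  The derivative is known only off a null set \<open>N\<close>, where straddling gives no control. A gauge that
  keeps intervals tagged in \<open>N\<close> inside an open set of small measure makes their total length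
  small, and absolute continuity then bounds the increments of \<open>y\<close> over them.
\<close>
lemma abs_continuous_has_integral:
  fixes y g :: "real \<Rightarrow> 'a::euclidean_space"
  assumes "a \<le> b" and ac: "abs_continuous_on_interval a b y"
    and der: "AE s in lebesgue. s \<in> {a<..b} \<longrightarrow> (y has_vector_derivative g s) (at s within {a..b})"
  shows "(g has_integral (y b - y a)) {a..b}"
proof (cases "a = b")
  case True then show ?thesis by (auto intro!: has_integral_refl(2) simp: cbox_interval[symmetric] simp del: cbox_interval)
next
  case False
  with \<open>a \<le> b\<close> have ab: "a < b" by simp
  from der obtain N0 where N0: "N0 \<in> null_sets lebesgue"
    "{s. \<not> (s \<in> {a<..b} \<longrightarrow> (y has_vector_derivative g s) (at s within {a..b}))} \<subseteq> N0"
    by (auto elim!: AE_E3 simp: eventually_ae_filter)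
  \<comment> \<open>The hypothesis says nothing at the left end point, so it joins the exceptional set.\<close>
  define N where "N = insert a N0"
  have negN: "negligible N"
    unfolding N_def using N0(1) by (simp add: negligible_iff_null_sets)
  have derN: "(y has_vector_derivative g s) (at s within {a..b})" if "s \<in> {a..b}" "s \<notin> N" for s
    using that N0(2) unfolding N_def by force
  define g' where "g' s = (if s \<in> N then 0 else g s)" for s
  have "(g' has_integral (y b - y a)) (cbox a b)"
    unfolding has_integral
  proof (intro allI impI)
    fix e :: real assume e: "e > 0"
    define e1 where "e1 = e / (2 * (b - a))"
    have e1: "e1 > 0" using e ab by (simp add: e1_def)
    from ac[unfolded abs_continuous_on_interval_def, rule_format, OF half_gt_zero[OF e]] obtain \<delta> where \<delta>: "\<delta> > 0"
      "\<And>D. finite D \<Longrightarrow> (\<forall>(u, v)\<in>D. a \<le> u \<and> u \<le> v \<and> v \<le> b) \<Longrightarrow>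
       disjoint_family_on (\<lambda>(u, v). {u<..<v}) D \<Longrightarrow> (\<Sum>(u, v)\<in>D. v - u) < \<delta>
       \<Longrightarrow> (\<Sum>(u, v)\<in>D. norm (y v - y u)) < e / 2"
      by (auto simp: imp_conjL)
    obtain U where U: "open U" "N \<subseteq> U" "U \<in> lmeasurable" "measure lebesgue U < \<delta>"
    proof -
      have "N \<in> sets lebesgue" using negN by (simp add: negligible_imp_sets)
      then obtain U where U: "open U" "N \<subseteq> U" "U - N \<in> lmeasurable" "emeasure lebesgue (U - N) < ennreal \<delta>"
        using sets_lebesgue_outer_open \<delta>(1) by blast
      have "U = (U - N) \<union> N" using U by auto
      moreover have "N \<in> lmeasurable" "measure lebesgue N = 0"
        using negN by (auto simp: negligible_iff_measure)
      ultimately have m: "U \<in> lmeasurable"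
        using fmeasurable.Un[OF U(3)] by metis
      have "N \<in> null_sets lebesgue" using negN by (simp add: negligible_iff_null_sets)
      then have m2: "measure lebesgue U = measure lebesgue (U - N)"
        using m by (simp add: measure_Diff_null_set fmeasurableD)
      have "measure lebesgue (U - N) < \<delta>"
        using U(3,4) \<delta>(1) by (simp add: emeasure_eq_measure2 ennreal_less_iff)
      then show ?thesis using that U m m2 by simp
    qed
    have "\<exists>d>0. \<forall>z\<in>{a..b}. \<bar>z - x\<bar> < d \<longrightarrow> norm (y z - y x - (z - x) *\<^sub>R g x) \<le> e1 * \<bar>z - x\<bar>"
      if "x \<in> {a..b}" "x \<notin> N" for x
      using derN[OF that] e1 unfolding has_vector_derivative_def has_derivative_within_alt by auto
    then obtain d where d: "\<And>x. x \<in> {a..b} \<Longrightarrow> x \<notin> N \<Longrightarrow> d x > 0"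
      "\<And>x z. x \<in> {a..b} \<Longrightarrow> x \<notin> N \<Longrightarrow> z \<in> {a..b} \<Longrightarrow> \<bar>z - x\<bar> < d x \<Longrightarrow> norm (y z - y x - (z - x) *\<^sub>R g x) \<le> e1 * \<bar>z - x\<bar>"
      by metis
    define \<gamma> where "\<gamma> x = (if x \<in> N then U else if x \<in> {a..b} then ball x (d x) else ball x 1)" for x
    have "gauge \<gamma>" unfolding gauge_def \<gamma>_def using U d by auto
    moreover have "norm ((\<Sum>(x, k)\<in>D. measure lborel k *\<^sub>R g' x) - (y b - y a)) < e"
      if D: "D tagged_division_of cbox a b" and fine: "\<gamma> fine D" for D
    proof -
      have finD: "finite D" using D by blast
      have K: "\<exists>u v. k = {u..v} \<and> u \<le> v \<and> a \<le> u \<and> v \<le> b \<and> u \<le> x \<and> x \<le> v \<and> k \<subseteq> \<gamma> x" if xk: "(x, k) \<in> D" for x k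
      proof -
        obtain u v where "k = cbox u v" using tagged_division_ofD(4)[OF D xk] by blast
        moreover have "x \<in> k" "k \<subseteq> cbox a b" using tagged_division_ofD(2,3)[OF D xk] by auto
        moreover have "k \<subseteq> \<gamma> x" using fine xk by (auto simp: fine_def)
        ultimately show ?thesis by - (rule exI[of _ u], rule exI[of _ v], auto)
      qed
      let ?h = "\<lambda>(x, k). y (Sup k) - y (Inf k)"
      let ?q = "\<lambda>(x, k). measure lborel k *\<^sub>R g' x"
      let ?D1 = "{z \<in> D. fst z \<in> N}" and ?D2 = "{z \<in> D. fst z \<notin> N}"
      have tel: "(\<Sum>z\<in>D. ?h z) = y b - y a"
        using additive_tagged_division_1[of a b D y] D ab by (simp add: case_prod_unfold)
      have "(\<Sum>z\<in>D. ?q z) - (y b - y a) = (\<Sum>z\<in>D. ?q z - ?h z)"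
        by (simp only: tel sum_subtractf)
      also have "norm \<dots> \<le> (\<Sum>z\<in>D. norm (?q z - ?h z))" by (rule norm_sum)
      also have "\<dots> = (\<Sum>z\<in>?D1. norm (?q z - ?h z)) + (\<Sum>z\<in>?D2. norm (?q z - ?h z))"
        using finD by (subst sum.union_disjoint[symmetric]) (auto intro!: sum.cong)
      also have "(\<Sum>z\<in>?D2. norm (?q z - ?h z)) \<le> (\<Sum>z\<in>?D2. e1 * measure lborel (snd z))"
      proof (rule sum_mono)
        fix z assume z: "z \<in> ?D2"
        obtain x k where zk: "z = (x, k)" by (cases z)
        with z have xk: "(x, k) \<in> D" "x \<notin> N" by auto
        from K[OF xk(1)] obtain u v where uv: "k = {u..v}" "u \<le> v" "a \<le> u" "v \<le> b" "u \<le> x" "x \<le> v" "k \<subseteq> \<gamma> x" by blast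
        have xab: "x \<in> {a..b}" using uv by auto
        have "u \<in> ball x (d x)" "v \<in> ball x (d x)" using uv xk xab by (auto simp: \<gamma>_def subset_eq)
        then have 1: "norm (y u - y x - (u - x) *\<^sub>R g x) \<le> e1 * \<bar>u - x\<bar>" "norm (y v - y x - (v - x) *\<^sub>R g x) \<le> e1 * \<bar>v - x\<bar>"
          using d(2)[OF xab xk(2), of u] d(2)[OF xab xk(2), of v] uv by (auto simp: dist_real_def)
        have "norm (?q z - ?h z) = norm ((y u - y x - (u - x) *\<^sub>R g x) - (y v - y x - (v - x) *\<^sub>R g x))"
          using uv xk by (simp add: zk g'_def algebra_simps)
        also have "\<dots> \<le> e1 * \<bar>u - x\<bar> + e1 * \<bar>v - x\<bar>"
          using 1 norm_triangle_ineq4[of "y u - y x - (u - x) *\<^sub>R g x" "y v - y x - (v - x) *\<^sub>R g x"] by linarith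
        also have "\<dots> = e1 * measure lborel (snd z)" using uv by (simp add: zk algebra_simps)
        finally show "norm (?q z - ?h z) \<le> e1 * measure lborel (snd z)" .
      qed
      also have "\<dots> \<le> (\<Sum>z\<in>D. e1 * measure lborel (snd z))"
        using finD e1 by (intro sum_mono2) auto
      also have "\<dots> = e1 * (b - a)"
        using additive_content_tagged_division[OF D] ab by (simp add: sum_distrib_left[symmetric] case_prod_unfold)
      also have "\<dots> = e / 2" using ab by (simp add: e1_def field_simps)
      finally have main: "norm ((\<Sum>z\<in>D. ?q z) - (y b - y a)) \<le> (\<Sum>z\<in>?D1. norm (?q z - ?h z)) + e / 2"
        by simp
      define E where "E = snd ` ?D1"
      define P where "P = (\<lambda>k. (Inf k, Sup k)) ` E"
      have D1p: "?D1 tagged_partial_division_of cbox a b"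
        by (rule tagged_partial_division_subset[OF tagged_division_of_def[THEN iffD1, OF D, THEN conjunct1]]) auto
      have divE: "E division_of \<Union>E"
        unfolding E_def by (rule partial_division_of_tagged_division[OF D1p])
      have EK: "\<exists>u v. k = {u..v} \<and> u \<le> v \<and> a \<le> u \<and> v \<le> b \<and> k \<subseteq> U" if "k \<in> E" for k
        using that K unfolding E_def \<gamma>_def by fastforce
      have finE: "finite E" using finD by (simp add: E_def)
      have injE: "inj_on (\<lambda>k. (Inf k, Sup k)) E"
      proof (rule inj_onI)
        fix k k' assume kk: "k \<in> E" "k' \<in> E" and "(Inf k, Sup k) = (Inf k', Sup k')"
        then show "k = k'" using EK[OF kk(1)] EK[OF kk(2)] by auto
      qed
      \<comment> \<open>Degenerate intervals do not spoil injectivity: their only possible tag is their only point.\<close>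
      have inj1: "inj_on snd ?D1"
      proof (rule inj_onI, clarsimp)
        fix x x' k assume xk: "(x, k) \<in> D" "(x', k) \<in> D"
        show "x = x'"
        proof (rule ccontr)
          assume "x \<noteq> x'"
          then have "interior k \<inter> interior k = {}" using tagged_division_ofD(5)[OF D xk] by blast
          then show False using K[OF xk(1)] K[OF xk(2)] \<open>x \<noteq> x'\<close> by (auto simp: interior_atLeastAtMost_real)
        qed
      qed
      have "(\<Sum>z\<in>?D1. norm (?q z - ?h z)) = (\<Sum>(x, k)\<in>?D1. norm (y (Sup k) - y (Inf k)))"
        by (auto intro!: sum.cong simp: g'_def norm_minus_commute)
      also have "\<dots> = (\<Sum>k\<in>E. norm (y (Sup k) - y (Inf k)))"
        unfolding E_def by (subst sum.reindex[OF inj1]) (simp add: case_prod_unfold)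
      also have "\<dots> = (\<Sum>(u, v)\<in>P. norm (y v - y u))"
        unfolding P_def by (subst sum.reindex[OF injE]) auto
      also have "\<dots> < e / 2"
      proof (rule \<delta>(2))
        show "finite P" using finE by (simp add: P_def)
        show "\<forall>(u, v)\<in>P. a \<le> u \<and> u \<le> v \<and> v \<le> b"
          unfolding P_def using EK by fastforce
        show "disjoint_family_on (\<lambda>(u, v). {u<..<v}) P"
          unfolding disjoint_family_on_def
        proof (intro ballI impI)
          fix w w' assume "w \<in> P" "w' \<in> P" and ne: "w \<noteq> w'"
          then obtain k k' where kk: "k \<in> E" "k' \<in> E" and w: "w = (Inf k, Sup k)" "w' = (Inf k', Sup k')"
            unfolding P_def by blast
          have "k \<noteq> k'" using ne w by auto
          then have "interior k \<inter> interior k' = {}" using division_ofD(5)[OF divE] kk by metis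
          then show "(case w of (u, v) \<Rightarrow> {u<..<v}) \<inter> (case w' of (u, v) \<Rightarrow> {u<..<v}) = {}"
            using EK[OF kk(1)] EK[OF kk(2)] w by (auto simp: interior_atLeastAtMost_real)
        qed
        have "(\<Sum>(u, v)\<in>P. v - u) = (\<Sum>k\<in>E. measure lborel k)"
          unfolding P_def by (subst sum.reindex[OF injE]) (use EK in \<open>fastforce intro!: sum.cong\<close>)
        also have "\<dots> = measure lebesgue (\<Union>E)"
        proof -
          have "measure lborel k = measure lebesgue k" if "k \<in> E" for k
            using EK[OF that] by (auto simp: measure_completion)
          then show ?thesis using content_division[OF divE] by simp
        qed
        also have "\<dots> \<le> measure lebesgue U"
          using EK divE U(3) by (intro measure_mono_fmeasurable) (blast, auto intro: fmeasurableD lmeasurable_division)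
        also have "\<dots> < \<delta>" by fact
        finally show "(\<Sum>(u, v)\<in>P. v - u) < \<delta>" .
      qed
      finally show ?thesis using main by (simp add: case_prod_unfold)
    qed
    ultimately show "\<exists>\<gamma>. gauge \<gamma> \<and> (\<forall>\<D>. \<D> tagged_division_of cbox a b \<and> \<gamma> fine \<D> \<longrightarrow>
        norm ((\<Sum>(x, k)\<in>\<D>. measure lborel k *\<^sub>R g' x) - (y b - y a)) < e)"
      by (intro exI[of _ \<gamma>] conjI allI impI) auto
  qed
  then have "(g has_integral (y b - y a)) (cbox a b)"
    by (rule has_integral_spike[OF negN, rotated]) (simp add: g'_def)
  then show ?thesis by simp
qed

text \<open>
  Lebesgue's differentiation theorem for the averages over \<open>[s, s + h]\<close> gives the derivative from
  the right. Applied to the reflected function it gives the derivative from the left.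
\<close>
lemma indefinite_integral_has_vector_derivative_AE:
  fixes g :: "real \<Rightarrow> 'a::euclidean_space"
  assumes int: "g integrable_on {a..b}"
  shows "AE s in lebesgue. s \<in> {a..b} \<longrightarrow>
           ((\<lambda>s. integral {a..s} g) has_vector_derivative g s) (at s within {a..b})"
proof -
  define g0 where "g0 s = (if s \<in> {a..b} then g s else 0)" for s
  have "g0 integrable_on UNIV"
    using int unfolding g0_def by (simp only: integrable_restrict_UNIV)
  then have g0: "g0 integrable_on cbox c d" for c d
    using integrable_on_subcbox by blast
  have "(\<lambda>s. g0 (- s)) integrable_on cbox c d" for c d
    using g0[of "- d" "- c"] Henstock_Kurzweil_Integration.integrable_reflect_real[where f = g0 and a = "-d" and b = "-c"] by simp
  then obtain N2 where N2: "negligible N2"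
    "\<And>x e. \<lbrakk>x \<notin> N2; 0 < e\<rbrakk> \<Longrightarrow> \<exists>d>0. \<forall>h. 0 < h \<and> h < d \<longrightarrow>
       norm (integral (cbox x (x + h *\<^sub>R One)) (\<lambda>s. g0 (- s)) /\<^sub>R h ^ DIM(real) - g0 (- x)) < e"
    by (rule integrable_ccontinuous_explicit) blast
  from g0 obtain N1 where N1: "negligible N1"
    "\<And>x e. \<lbrakk>x \<notin> N1; 0 < e\<rbrakk> \<Longrightarrow> \<exists>d>0. \<forall>h. 0 < h \<and> h < d \<longrightarrow>
       norm (integral (cbox x (x + h *\<^sub>R One)) g0 /\<^sub>R h ^ DIM(real) - g0 x) < e"
    by (rule integrable_ccontinuous_explicit) blast
  have sub: "g integrable_on {u..v}" if "a \<le> u" "v \<le> b" for u v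
    using int that by (meson atLeastatMost_subset_iff integrable_subinterval_real)
  have g0_int: "integral {u..v} g0 = integral {u..v} g" if "a \<le> u" "v \<le> b" for u v
    using that by (intro integral_cong) (auto simp: g0_def)
  have quot: "norm (I - h *\<^sub>R c) \<le> e * h" if "norm (I /\<^sub>R h - c) < e" "h > 0" for I c :: 'a and h e :: real
  proof -
    have "I - h *\<^sub>R c = h *\<^sub>R (I /\<^sub>R h - c)" using that(2) by (simp add: algebra_simps)
    then have "norm (I - h *\<^sub>R c) = h * norm (I /\<^sub>R h - c)" using that(2) by simp
    then show ?thesis using that by (simp add: mult.commute)
  qed
  have "((\<lambda>s. integral {a..s} g) has_vector_derivative g s) (at s within {a..b})"
    if s: "s \<in> {a..b}" and "s \<notin> N1 \<union> uminus ` N2" for s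
    unfolding has_vector_derivative_def has_derivative_within_alt
  proof (intro conjI allI impI)
    have notin: "s \<notin> N1" "- s \<notin> N2" using that by (auto intro: rev_image_eqI)
    show "bounded_linear (\<lambda>x. x *\<^sub>R g s)" by (rule bounded_linear_scaleR_left)
    fix e :: real assume e: "e > 0"
    from N1(2)[OF notin(1) e] obtain d1 where d1: "d1 > 0"
      "\<And>h. 0 < h \<Longrightarrow> h < d1 \<Longrightarrow> norm (integral {s..s + h} g0 /\<^sub>R h - g0 s) < e" by auto
    from N2(2)[OF notin(2) e] obtain d2 where d2: "d2 > 0"
      "\<And>h. 0 < h \<Longrightarrow> h < d2 \<Longrightarrow> norm (integral {- s..- s + h} (\<lambda>s. g0 (- s)) /\<^sub>R h - g0 s) < e" by auto
    show "\<exists>d>0. \<forall>z\<in>{a..b}. norm (z - s) < d \<longrightarrow>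
        norm (integral {a..z} g - integral {a..s} g - (z - s) *\<^sub>R g s) \<le> e * norm (z - s)"
    proof (intro exI[of _ "min d1 d2"] conjI ballI impI)
      show "min d1 d2 > 0" using d1 d2 by simp
      fix z assume z: "z \<in> {a..b}" and zs: "norm (z - s) < min d1 d2"
      consider "z = s" | "z > s" | "z < s" by linarith
      then show "norm (integral {a..z} g - integral {a..s} g - (z - s) *\<^sub>R g s) \<le> e * norm (z - s)"
      proof cases
        case 1 then show ?thesis by simp
      next
        case 2
        have 4: "integral {a..s} g + integral {s..z} g = integral {a..z} g"
          using 2 s z by (intro Henstock_Kurzweil_Integration.integral_combine sub) auto
        have "norm (integral {s..z} g - (z - s) *\<^sub>R g s) \<le> e * (z - s)"
          using quot[OF d1(2)[of "z - s"]] 2 zs s z by (simp add: g0_int) (simp add: g0_def)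
        moreover have "integral {a..z} g - integral {a..s} g = integral {s..z} g"
          by (simp flip: 4)
        ultimately show ?thesis using 2 by simp
      next
        case 3
        have 4: "integral {a..z} g + integral {z..s} g = integral {a..s} g"
          using 3 s z by (intro Henstock_Kurzweil_Integration.integral_combine sub) auto
        have "integral {- s..- z} (\<lambda>s. g0 (- s)) = integral {z..s} g"
          using s z by (simp add: g0_int)
        then have "norm (integral {z..s} g - (s - z) *\<^sub>R g s) \<le> e * (s - z)"
          using quot[OF d2(2)[of "s - z"]] 3 zs s z by (simp add: g0_def)
        moreover have "integral {a..z} g - integral {a..s} g - (z - s) *\<^sub>R g s = - (integral {z..s} g - (s - z) *\<^sub>R g s)"
          unfolding 4[symmetric] by (simp add: algebra_simps)
        ultimately have "norm (integral {a..z} g - integral {a..s} g - (z - s) *\<^sub>R g s) \<le> e * (s - z)"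
          by (metis norm_minus_cancel)
        then show ?thesis using 3 by (simp add: abs_if)
      qed
    qed
  qed
  moreover have "N1 \<union> uminus ` N2 \<in> null_sets lebesgue"
    using N1(1) N2(1) negligible_differentiable_image_negligible[of N2 uminus]
    by (simp add: negligible_iff_null_sets[symmetric] differentiable_on_def)
  ultimately show ?thesis by (intro AE_I') auto
qed

lemma abs_continuous_on_interval_Lipschitz:
  assumes "\<And>u v. a \<le> u \<Longrightarrow> u \<le> v \<Longrightarrow> v \<le> b \<Longrightarrow> norm (g v - g u) \<le> K * (v - u)"
  shows "abs_continuous_on_interval a b g"
  unfolding abs_continuous_on_interval_def
proof (intro allI impI)
  fix e :: real assume e: "e > 0"
  define K' where "K' = \<bar>K\<bar> + 1"
  have K': "K' > 0" "K \<le> K'" by (auto simp: K'_def)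
  show "\<exists>\<delta>>0. \<forall>D::(real \<times> real) set.
       finite D \<and> (\<forall>(u, v)\<in>D. a \<le> u \<and> u \<le> v \<and> v \<le> b) \<and>
       disjoint_family_on (\<lambda>(u, v). {u<..<v}) D \<and> (\<Sum>(u, v)\<in>D. v - u) < \<delta>
       \<longrightarrow> (\<Sum>(u, v)\<in>D. norm (g v - g u)) < e"
  proof (intro exI[of _ "e / K'"] conjI allI impI)
    show "e / K' > 0" using e K' by simp
    fix D :: "(real \<times> real) set"
    assume D: "finite D \<and> (\<forall>(u, v)\<in>D. a \<le> u \<and> u \<le> v \<and> v \<le> b) \<and>
       disjoint_family_on (\<lambda>(u, v). {u<..<v}) D \<and> (\<Sum>(u, v)\<in>D. v - u) < e / K'"
    have "(\<Sum>(u, v)\<in>D. norm (g v - g u)) \<le> (\<Sum>(u, v)\<in>D. K' * (v - u))"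
    proof (rule sum_mono, clarify)
      fix u v assume "(u, v) \<in> D"
      then have uv: "a \<le> u" "u \<le> v" "v \<le> b" using D by auto
      then have "norm (g v - g u) \<le> K * (v - u)" by (rule assms)
      also have "\<dots> \<le> K' * (v - u)" using uv K' by (intro mult_right_mono) auto
      finally show "norm (g v - g u) \<le> K' * (v - u)" .
    qed
    also have "\<dots> = K' * (\<Sum>(u, v)\<in>D. v - u)" by (simp add: sum_distrib_left case_prod_unfold)
    also have "\<dots> < e" using D K' by (simp add: field_simps)
    finally show "(\<Sum>(u, v)\<in>D. norm (g v - g u)) < e" .
  qed
qed

lemma abs_continuous_on_interval_subinterval:
  assumes "abs_continuous_on_interval a b g" "b' \<le> b"
  shows "abs_continuous_on_interval a b' g"
  unfolding abs_continuous_on_interval_def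
proof (intro allI impI)
  fix e :: real assume "e > 0"
  from assms(1)[unfolded abs_continuous_on_interval_def, rule_format, OF this] obtain \<delta> where \<delta>: "\<delta> > 0"
    "\<And>D. finite D \<Longrightarrow> (\<forall>(u, v)\<in>D. a \<le> u \<and> u \<le> v \<and> v \<le> b) \<Longrightarrow>
       disjoint_family_on (\<lambda>(u, v). {u<..<v}) D \<Longrightarrow> (\<Sum>(u, v)\<in>D. v - u) < \<delta>
       \<Longrightarrow> (\<Sum>(u, v)\<in>D. norm (g v - g u)) < e"
    by (auto simp: imp_conjL)
  show "\<exists>\<delta>>0. \<forall>D. finite D \<and> (\<forall>(u, v)\<in>D. a \<le> u \<and> u \<le> v \<and> v \<le> b') \<and>
       disjoint_family_on (\<lambda>(u, v). {u<..<v}) D \<and> (\<Sum>(u, v)\<in>D. v - u) < \<delta>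
       \<longrightarrow> (\<Sum>(u, v)\<in>D. norm (g v - g u)) < e"
  proof (intro exI[of _ \<delta>] conjI allI impI)
    fix D :: "(real \<times> real) set"
    assume D: "finite D \<and> (\<forall>(u, v)\<in>D. a \<le> u \<and> u \<le> v \<and> v \<le> b') \<and>
       disjoint_family_on (\<lambda>(u, v). {u<..<v}) D \<and> (\<Sum>(u, v)\<in>D. v - u) < \<delta>"
    then have "\<forall>(u, v)\<in>D. a \<le> u \<and> u \<le> v \<and> v \<le> b" using assms(2) by fastforce
    with D show "(\<Sum>(u, v)\<in>D. norm (g v - g u)) < e" by (intro \<delta>(2)) auto
  qed (fact \<delta>(1))
qed

lemma is_trajectory_has_integral:
  assumes "is_trajectory f T p \<alpha> x t y" and s: "t \<le> s" "s \<le> T"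
  shows "((\<lambda>r. f (y r) (\<alpha> r) p) has_integral (y s - x)) {t..s}"
proof -
  from assms have ac: "abs_continuous_on_interval t T y" and yt: "y t = x"
    and ae: "AE r in lebesgue. r \<in> {t<..T} \<longrightarrow> (y has_vector_derivative f (y r) (\<alpha> r) p) (at r within {t..T})"
    unfolding is_trajectory_def by auto
  from ae have "AE r in lebesgue. r \<in> {t<..s} \<longrightarrow> (y has_vector_derivative f (y r) (\<alpha> r) p) (at r within {t..s})"
    by (rule AE_mp) (use s in \<open>auto intro!: AE_I2 elim: has_vector_derivative_within_subset\<close>)
  from abs_continuous_has_integral[OF s(1) abs_continuous_on_interval_subinterval[OF ac s(2)] this]
  show ?thesis unfolding yt .
qed

lemma is_trajectoryI:
  assumes "t \<le> T"
    and bd: "\<And>r. r \<in> {t..T} \<Longrightarrow> norm (f (y r) (\<alpha> r) p) \<le> M"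
    and int: "\<And>s. t \<le> s \<Longrightarrow> s \<le> T \<Longrightarrow> ((\<lambda>r. f (y r) (\<alpha> r) p) has_integral (y s - x)) {t..s}"
  shows "is_trajectory f T p \<alpha> x t y"
proof -
  let ?g = "\<lambda>r. f (y r) (\<alpha> r) p"
  have yt: "y t = x" using has_integral_unique[OF int[of t]] has_integral_refl(2)[of ?g t] \<open>t \<le> T\<close> by force
  have ig: "?g integrable_on {t..T}" using int[of T] \<open>t \<le> T\<close> by auto
  have y: "y s = x + integral {t..s} ?g" if "s \<in> {t..T}" for s
    using int[of s] that by (auto simp: integral_unique)
  have lip: "norm (y v - y u) \<le> M * (v - u)" if "t \<le> u" "u \<le> v" "v \<le> T" for u v
  proof -
    have sub: "?g integrable_on {u..v}" 
      using ig that by (meson atLeastatMost_subset_iff integrable_subinterval_real)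
    have "integral {t..u} ?g + integral {u..v} ?g = integral {t..v} ?g"
      using that ig by (intro Henstock_Kurzweil_Integration.integral_combine) (auto intro: integrable_subinterval_real)
    then have "y v - y u = integral {u..v} ?g" using y[of u] y[of v] that by (simp add: algebra_simps)
    also have "norm \<dots> \<le> integral {u..v} (\<lambda>_. M)"
      using sub that bd by (intro integral_norm_bound_integral) auto
    also have "\<dots> = M * (v - u)" using that by simp
    finally show ?thesis .
  qed
  have "AE s in lebesgue. s \<in> {t<..T} \<longrightarrow> (y has_vector_derivative ?g s) (at s within {t..T})"
    using indefinite_integral_has_vector_derivative_AE[OF ig]
  proof (rule AE_mp, intro AE_I2 impI)
    fix s assume "s \<in> {t..T} \<longrightarrow> ((\<lambda>s. integral {t..s} ?g) has_vector_derivative ?g s) (at s within {t..T})"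
      and s: "s \<in> {t<..T}"
    then have "((\<lambda>s. x + integral {t..s} ?g) has_vector_derivative ?g s) (at s within {t..T})"
      by (auto intro!: derivative_eq_intros)
    then show "(y has_vector_derivative ?g s) (at s within {t..T})"
      by (rule has_vector_derivative_transform[rotated 2]) (use s y in auto)
  qed
  then show ?thesis
    unfolding is_trajectory_def using yt abs_continuous_on_interval_Lipschitz[OF lip] by auto
qed

section \<open>Controlled trajectories\<close>

locale control_system =
  fixes A :: "(real ^ 'm) set" and F :: "real ^ 'd \<Rightarrow> real ^ 'm \<Rightarrow> real ^ 'd" and M L T :: real
  assumes A: "compact A" "A \<noteq> {}"
    and F_cont: "continuous_on (UNIV \<times> A) (\<lambda>(x, a). F x a)"
    and F_bound: "\<And>x a. a \<in> A \<Longrightarrow> norm (F x a) \<le> M"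
    and L: "L > 0"
    and F_Lipschitz: "\<And>x y a. a \<in> A \<Longrightarrow> norm (F x a - F y a) \<le> L * norm (x - y)"
    and T: "T > 0"
begin

lemma M_nonneg: "M \<ge> 0"
  using F_bound A(2) norm_ge_zero order_trans by blast

lemma control_values: "\<alpha> \<in> controls A \<Longrightarrow> 0 \<le> s \<Longrightarrow> \<alpha> s \<in> A"
  by (simp add: controls_def)

text \<open>
  The integrand is continuous only on the closed set \<open>UNIV \<times> A \<times> {0..T}\<close>. Extended by zero it is a
  Borel function on the whole space, and the values of \<open>(y, \<alpha>, r)\<close> never leave that set.
\<close>
lemma measurable_along:
  fixes G :: "real ^ 'd \<Rightarrow> real ^ 'm \<Rightarrow> real \<Rightarrow> 'c::euclidean_space"
  assumes \<alpha>: "\<alpha> \<in> controls A" and uv: "0 \<le> u" "v \<le> T" and y: "continuous_on {u..v} y"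
    and G: "continuous_on (UNIV \<times> A \<times> {0..T}) (\<lambda>(x, a, s). G x a s)"
  shows "(\<lambda>r. G (y r) (\<alpha> r) r) \<in> borel_measurable (lebesgue_on {u..v})"
proof -
  let ?D = "UNIV \<times> A \<times> {0..T} :: ((real ^ 'd) \<times> (real ^ 'm) \<times> real) set"
  have "closed ?D" using A(1) by (intro closed_Times) (auto simp: compact_imp_closed)
  then have G': "(\<lambda>z. if z \<in> ?D then (\<lambda>(x, a, s). G x a s) z else 0) \<in> borel_measurable borel"
    using G by (intro borel_measurable_continuous_on_if) auto
  have "\<alpha> \<in> borel_measurable (lebesgue_on {0..})" using \<alpha> by (simp add: controls_def)
  then have 1: "\<alpha> \<in> borel_measurable (lebesgue_on {u..v})"
    by (rule measurable_restrict_mono) (use uv in auto)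
  have 2: "y \<in> borel_measurable (lebesgue_on {u..v})"
    using y by (intro continuous_imp_measurable_on_sets_lebesgue) auto
  have 3: "(\<lambda>r. r) \<in> borel_measurable (lebesgue_on {u..v})"
    by (intro continuous_imp_measurable_on_sets_lebesgue) auto
  have "(\<lambda>r. (y r, \<alpha> r, r)) \<in> borel_measurable (lebesgue_on {u..v})"
    using 1 2 3 by (intro borel_measurable_Pair)
  from measurable_compose[OF this G']
  show ?thesis
    by (rule measurable_cong[THEN iffD1, rotated]) (use uv control_values[OF \<alpha>] in auto)
qed

lemma absolutely_integrable_along:
  fixes G :: "real ^ 'd \<Rightarrow> real ^ 'm \<Rightarrow> real \<Rightarrow> 'c::euclidean_space"
  assumes \<alpha>: "\<alpha> \<in> controls A" and uv: "0 \<le> u" "v \<le> T" and y: "continuous_on {u..v} y"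
    and G: "continuous_on (UNIV \<times> A \<times> {0..T}) (\<lambda>(x, a, s). G x a s)"
    and bd: "\<And>x a s. a \<in> A \<Longrightarrow> s \<in> {0..T} \<Longrightarrow> norm (G x a s) \<le> K"
  shows "(\<lambda>r. G (y r) (\<alpha> r) r) absolutely_integrable_on {u..v}"
  by (rule measurable_bounded_by_integrable_imp_absolutely_integrable[OF measurable_along[OF \<alpha> uv y G], of "\<lambda>_. K"])
     (use bd control_values[OF \<alpha>] uv in auto)

text \<open>The integral form of the state equation, equivalent to the almost-everywhere form.\<close>
definition trajectory :: "(real \<Rightarrow> real ^ 'm) \<Rightarrow> real ^ 'd \<Rightarrow> real \<Rightarrow> (real \<Rightarrow> real ^ 'd) \<Rightarrow> bool" where
  "trajectory \<alpha> x t y \<longleftrightarrow> (\<forall>s\<in>{t..T}. ((\<lambda>r. F (y r) (\<alpha> r)) has_integral (y s - x)) {t..s})"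

lemma trajectory_start: "trajectory \<alpha> x t y \<Longrightarrow> t \<le> T \<Longrightarrow> y t = x"
  unfolding trajectory_def using has_integral_unique[OF _ has_integral_refl(2)[of _ t]]
  by (metis atLeastAtMost_iff atLeastAtMost_singleton eq_iff_diff_eq_0 order_refl)

lemma trajectory_has_integral:
  assumes y: "trajectory \<alpha> x t y" and "t \<le> u" "u \<le> v" "v \<le> T"
  shows "((\<lambda>r. F (y r) (\<alpha> r)) has_integral (y v - y u)) {u..v}"
proof -
  let ?g = "\<lambda>r. F (y r) (\<alpha> r)"
  have u: "(?g has_integral (y u - x)) {t..u}" and v: "(?g has_integral (y v - x)) {t..v}"
    using assms unfolding trajectory_def by auto
  have i: "?g integrable_on {u..v}"
    using has_integral_integrable[OF v] assms by (meson atLeastatMost_subset_iff integrable_subinterval_real order_refl)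
  have "(?g has_integral (y u - x + integral {u..v} ?g)) {t..v}"
    using assms by (intro has_integral_combine[OF _ _ u integrable_integral[OF i]]) auto
  from has_integral_unique[OF this v] have "integral {u..v} ?g = y v - y u" by (simp add: algebra_simps)
  with i show ?thesis by (metis integrable_integral)
qed

lemma trajectory_Lipschitz:
  assumes "\<alpha> \<in> controls A" "trajectory \<alpha> x t y" "0 \<le> t" "t \<le> u" "u \<le> v" "v \<le> T"
  shows "norm (y v - y u) \<le> M * (v - u)"
  using has_integral_bound_real[OF M_nonneg finite.emptyI trajectory_has_integral[OF assms(2,4-6)]]
    assms F_bound control_values by auto

lemma trajectory_continuous:
  assumes "\<alpha> \<in> controls A" "trajectory \<alpha> x t y" "0 \<le> t"
  shows "continuous_on {t..T} y"
proof (rule lipschitz_on_continuous_on[OF lipschitz_onI])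
  fix u v assume uv: "u \<in> {t..T}" "v \<in> {t..T}"
  show "dist (y u) (y v) \<le> M * dist u v"
    using trajectory_Lipschitz[OF assms, of u v] trajectory_Lipschitz[OF assms, of v u] uv
    by (cases "u \<le> v") (auto simp: dist_norm norm_minus_commute)
qed (rule M_nonneg)

lemma is_trajectory_iff_trajectory:
  assumes F: "\<And>x a. f x a p = F x a" and "\<alpha> \<in> controls A" "0 \<le> t" "t \<le> T"
  shows "is_trajectory f T p \<alpha> x t y \<longleftrightarrow> trajectory \<alpha> x t y"
proof
  assume "is_trajectory f T p \<alpha> x t y"
  then show "trajectory \<alpha> x t y"
    unfolding trajectory_def using is_trajectory_has_integral[of f T p \<alpha> x t y] by (auto simp: F)
next
  assume "trajectory \<alpha> x t y"
  then show "is_trajectory f T p \<alpha> x t y"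
    using assms F_bound control_values unfolding trajectory_def
    by (intro is_trajectoryI[where M = M]) auto
qed

lemma integral_exp_weight:
  assumes "t \<le> s"
  shows "((\<lambda>r. L * (K * exp (2 * L * (r - t)))) has_integral (K / 2 * (exp (2 * L * (s - t)) - 1))) {t..s}"
proof -
  have "((\<lambda>r. L * (K * exp (2 * L * (r - t)))) has_integral
      (K / 2 * exp (2 * L * (s - t)) - K / 2 * exp (2 * L * (t - t)))) {t..s}"
    by (rule fundamental_theorem_of_calculus[OF assms])
       (auto intro!: derivative_eq_intros simp: has_real_derivative_iff_has_vector_derivative[symmetric])
  then show ?thesis by (simp add: algebra_simps)
qed

lemma field_integrable:
  assumes "\<alpha> \<in> controls A" "0 \<le> t" "s \<le> T" "continuous_on {t..s} w"
  shows "(\<lambda>r. F (w r) (\<alpha> r)) integrable_on {t..s}"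
proof -
  have "continuous_on (UNIV \<times> A \<times> {0..T}) (\<lambda>(x, a, s). F x a)"
    using continuous_on_compose2[OF F_cont, of "UNIV \<times> A \<times> {0..T}" "\<lambda>z. (fst z, fst (snd z))"]
    by (force simp: case_prod_unfold intro!: continuous_intros)
  from absolutely_integrable_along[OF assms this, of M] F_bound
  show ?thesis by (auto dest: set_lebesgue_integral_eq_integral(1))
qed

text \<open>
  With the weight \<open>exp (2 L (r - t))\<close> the map \<open>y \<mapsto> x + \<integral> F(y, \<alpha>)\<close> is a contraction with factor
  \<open>1/2\<close> on the whole interval \<open>[t, T]\<close>. This one estimate serves both existence by Picard
  iteration and continuous dependence on the initial state.
\<close>
lemma integrated_field_diff:
  assumes \<alpha>: "\<alpha> \<in> controls A" and ts: "0 \<le> t" "t \<le> s" "s \<le> T"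
    and y: "continuous_on {t..s} y" and z: "continuous_on {t..s} z"
    and K: "\<And>r. r \<in> {t..s} \<Longrightarrow> norm (y r - z r) \<le> K * exp (2 * L * (r - t))" and "K \<ge> 0"
  shows "norm (integral {t..s} (\<lambda>r. F (y r) (\<alpha> r)) - integral {t..s} (\<lambda>r. F (z r) (\<alpha> r)))
     \<le> K / 2 * (exp (2 * L * (s - t)) - 1)"
proof -
  note int = field_integrable[OF \<alpha> ts(1,3)]
  have "integral {t..s} (\<lambda>r. F (y r) (\<alpha> r)) - integral {t..s} (\<lambda>r. F (z r) (\<alpha> r))
     = integral {t..s} (\<lambda>r. F (y r) (\<alpha> r) - F (z r) (\<alpha> r))"
    using int[OF y] int[OF z] by (simp add: Henstock_Kurzweil_Integration.integral_diff)
  also have "norm \<dots> \<le> integral {t..s} (\<lambda>r. L * (K * exp (2 * L * (r - t))))"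
  proof (rule integral_norm_bound_integral)
    show "(\<lambda>r. F (y r) (\<alpha> r) - F (z r) (\<alpha> r)) integrable_on {t..s}"
      using int[OF y] int[OF z] by (rule integrable_diff)
    show "(\<lambda>r. L * (K * exp (2 * L * (r - t)))) integrable_on {t..s}"
      using integral_exp_weight[OF ts(2)] by blast
    fix r assume r: "r \<in> {t..s}"
    have "norm (F (y r) (\<alpha> r) - F (z r) (\<alpha> r)) \<le> L * norm (y r - z r)"
      using F_Lipschitz control_values[OF \<alpha>, of r] r ts by auto
    also have "\<dots> \<le> L * (K * exp (2 * L * (r - t)))"
      using K[OF r] L by (intro mult_left_mono) auto
    finally show "norm (F (y r) (\<alpha> r) - F (z r) (\<alpha> r)) \<le> L * (K * exp (2 * L * (r - t)))" .
  qed
  also have "\<dots> = K / 2 * (exp (2 * L * (s - t)) - 1)"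
    using integral_exp_weight[OF ts(2)] by (rule integral_unique)
  finally show ?thesis .
qed

text \<open>
  Gronwall's inequality in the weighted norm: the weighted distance \<open>K\<close> of two solutions is at most
  the initial distance plus \<open>K / 2\<close>, hence at most twice the initial distance.
\<close>
lemma trajectory_dist:
  assumes \<alpha>: "\<alpha> \<in> controls A" and t: "0 \<le> t"
    and y: "trajectory \<alpha> x t y" and z: "trajectory \<alpha> x' t z" and s: "s \<in> {t..T}"
  shows "norm (y s - z s) \<le> 2 * exp (2 * L * T) * norm (x - x')"
proof -
  have cy: "continuous_on {t..T} y" and cz: "continuous_on {t..T} z"
    using trajectory_continuous[OF \<alpha> _ t] y z by auto
  have "\<exists>q\<in>{t..T}. \<forall>r\<in>{t..T}. norm (y r - z r) / exp (2 * L * (r - t)) \<le> norm (y q - z q) / exp (2 * L * (q - t))"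
    using s by (intro continuous_attains_sup continuous_intros cy cz) auto
  then obtain q where q: "q \<in> {t..T}" and
    qmax: "\<And>r. r \<in> {t..T} \<Longrightarrow> norm (y r - z r) / exp (2 * L * (r - t)) \<le> norm (y q - z q) / exp (2 * L * (q - t))"
    by blast
  define K where "K = norm (y q - z q) / exp (2 * L * (q - t))"
  have K0: "K \<ge> 0" by (simp add: K_def)
  have K: "norm (y r - z r) \<le> K * exp (2 * L * (r - t))" if "r \<in> {t..T}" for r
    using qmax[OF that] by (simp add: K_def pos_divide_le_eq)
  have yq: "y q - x = integral {t..q} (\<lambda>r. F (y r) (\<alpha> r))" and zq: "z q - x' = integral {t..q} (\<lambda>r. F (z r) (\<alpha> r))"
    using y z q by (auto simp: trajectory_def intro!: integral_unique[symmetric])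
  have "y q - z q = (x - x') + (integral {t..q} (\<lambda>r. F (y r) (\<alpha> r)) - integral {t..q} (\<lambda>r. F (z r) (\<alpha> r)))"
    unfolding yq[symmetric] zq[symmetric] by simp
  then have "norm (y q - z q) \<le> norm (x - x') + norm (integral {t..q} (\<lambda>r. F (y r) (\<alpha> r)) - integral {t..q} (\<lambda>r. F (z r) (\<alpha> r)))"
    by (metis norm_triangle_ineq)
  also have "norm (integral {t..q} (\<lambda>r. F (y r) (\<alpha> r)) - integral {t..q} (\<lambda>r. F (z r) (\<alpha> r))) \<le> K / 2 * (exp (2 * L * (q - t)) - 1)"
    using q t K K0 by (intro integrated_field_diff[OF \<alpha>]) (auto intro: continuous_on_subset[OF cy] continuous_on_subset[OF cz])
  also have "\<dots> \<le> K / 2 * exp (2 * L * (q - t))" using K0 by (intro mult_left_mono) auto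
  also have "\<dots> = norm (y q - z q) / 2" by (simp add: K_def)
  finally have 1: "norm (y q - z q) \<le> 2 * norm (x - x')" by simp
  have "exp (2 * L * (q - t)) \<ge> 1" using q L by simp
  then have "K \<le> norm (y q - z q) / 1" unfolding K_def by (intro divide_left_mono) auto
  with 1 have 2: "K \<le> 2 * norm (x - x')" by simp
  have "exp (2 * L * (s - t)) \<le> exp (2 * L * T)" using s t L by simp
  with 2 K0 have "K * exp (2 * L * (s - t)) \<le> 2 * norm (x - x') * exp (2 * L * T)"
    by (intro mult_mono) auto
  with K[OF s] show ?thesis by (simp add: mult_ac)
qed

text \<open>
  Picard iteration. By the contraction in the weighted norm consecutive iterates differ by at most
  \<open>B / 2 ^ k\<close>, so they converge uniformly, and the Lipschitz continuity of \<open>F\<close> lets the integral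
  equation pass to the limit for an arbitrary measurable control.
\<close>
lemma trajectory_exists:
  assumes \<alpha>: "\<alpha> \<in> controls A" and t: "0 \<le> t" "t \<le> T"
  obtains y where "trajectory \<alpha> x t y"
proof -
  define Y where "Y = rec_nat (\<lambda>_. x) (\<lambda>_ y s. x + integral {t..s} (\<lambda>r. F (y r) (\<alpha> r)))"
  have Y0: "Y 0 s = x" for s by (simp add: Y_def)
  have YS: "Y (Suc k) s = x + integral {t..s} (\<lambda>r. F (Y k r) (\<alpha> r))" for k s by (simp add: Y_def)
  have cont: "continuous_on {t..T} (Y k)" for k
  proof (induction k)
    case 0
    show ?case unfolding Y_def by simp
  next
    case (Suc k)
    from field_integrable[OF \<alpha> t(1) order_refl Suc]
    have "continuous_on {t..T} (\<lambda>s. x + integral {t..s} (\<lambda>r. F (Y k r) (\<alpha> r)))"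
      by (intro continuous_intros indefinite_integral_continuous_1)
    then show ?case by (subst continuous_on_cong[OF refl YS]) 
  qed
  have bound: "norm (Y (Suc k) s - Y k s) \<le> (M * T / 2 ^ k) * exp (2 * L * (s - t))" if "s \<in> {t..T}" for k s
    using that
  proof (induction k arbitrary: s)
    case 0
    have "norm (integral {t..s} (\<lambda>r. F x (\<alpha> r))) \<le> integral {t..s} (\<lambda>_. M)"
      using 0 t F_bound control_values[OF \<alpha>]
      by (intro integral_norm_bound_integral field_integrable[OF \<alpha>]) auto
    also have "\<dots> = M * (s - t)" using 0 by simp
    also have "\<dots> \<le> M * T" using 0 t M_nonneg by (intro mult_left_mono) auto
    also have "\<dots> \<le> M * T * exp (2 * L * (s - t))"
    proof -
      have "exp (2 * L * (s - t)) \<ge> 1" using 0 L by simp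
      then have "M * T * 1 \<le> M * T * exp (2 * L * (s - t))"
        using M_nonneg T by (intro mult_left_mono) auto
      then show ?thesis by simp
    qed
    finally show ?case by (simp add: YS Y0)
  next
    case (Suc k)
    have "norm (Y (Suc (Suc k)) s - Y (Suc k) s) \<le> (M * T / 2 ^ k) / 2 * (exp (2 * L * (s - t)) - 1)"
      unfolding YS[of "Suc k" s] YS[of k s] add_diff_cancel_left
      using Suc.prems Suc.IH t M_nonneg T
      by (intro integrated_field_diff[OF \<alpha>]) (auto intro: continuous_on_subset[OF cont])
    also have "\<dots> \<le> (M * T / 2 ^ k) / 2 * exp (2 * L * (s - t))"
      using M_nonneg T by (intro mult_left_mono) auto
    finally show ?case by (simp add: field_simps)
  qed
  define B where "B = M * T * exp (2 * L * T)"
  have B0: "B \<ge> 0" using M_nonneg T by (simp add: B_def)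
  have bound': "norm (Y (Suc k) s - Y k s) \<le> B / 2 ^ k" if "s \<in> {t..T}" for k s
  proof -
    have "exp (2 * L * (s - t)) \<le> exp (2 * L * T)" using that t L by simp
    then have "(M * T / 2 ^ k) * exp (2 * L * (s - t)) \<le> (M * T / 2 ^ k) * exp (2 * L * T)"
      using M_nonneg T by (intro mult_left_mono) auto
    with bound[OF that, of k] show ?thesis by (simp add: B_def)
  qed
  have tail: "norm (Y (k + j) s - Y k s) \<le> 2 * B / 2 ^ k - 2 * B / 2 ^ (k + j)" if "s \<in> {t..T}" for k j s
  proof (induction j)
    case (Suc j)
    have "norm (Y (k + Suc j) s - Y k s) \<le> norm (Y (Suc (k + j)) s - Y (k + j) s) + norm (Y (k + j) s - Y k s)"
      using norm_triangle_ineq[of "Y (Suc (k + j)) s - Y (k + j) s" "Y (k + j) s - Y k s"] by simp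
    also have "\<dots> \<le> B / 2 ^ (k + j) + (2 * B / 2 ^ k - 2 * B / 2 ^ (k + j))"
      using Suc bound'[OF that, of "k + j"] by linarith
    also have "\<dots> = 2 * B / 2 ^ k - 2 * B / 2 ^ (k + Suc j)" by (simp add: field_simps)
    finally show ?case .
  qed simp
  have tail': "norm (Y j s - Y k s) \<le> 2 * B / 2 ^ k" if "s \<in> {t..T}" "k \<le> j" for k j s
    using tail[OF that(1), of k "j - k"] that(2) B0 by (smt (verit) divide_nonneg_nonneg le_add_diff_inverse zero_le_power)
  have pow: "(\<lambda>k. 2 * B / 2 ^ k) \<longlonglongrightarrow> 0"
    using tendsto_mult_right_zero[OF LIMSEQ_power_zero[of "1 / 2 :: real"], of "2 * B"] by (simp add: power_divide)
  have Cau: "uniformly_Cauchy_on {t..T} Y"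
  proof (rule uniformly_Cauchy_onI)
    fix e :: real assume "e > 0"
    with pow have "\<forall>\<^sub>F k in sequentially. 2 * B / 2 ^ k < e / 2" by (intro order_tendstoD(2)) auto
    then obtain N where N: "2 * B / 2 ^ N < e / 2" by (auto simp: eventually_sequentially)
    show "\<exists>N. \<forall>s\<in>{t..T}. \<forall>m\<ge>N. \<forall>n\<ge>N. dist (Y m s) (Y n s) < e"
    proof (intro exI ballI allI impI)
      fix s m n assume s: "s \<in> {t..T}" and "N \<le> m" "N \<le> n"
      then have "dist (Y m s) (Y N s) < e / 2" "dist (Y n s) (Y N s) < e / 2"
        using tail'[OF s, of N m] tail'[OF s, of N n] N by (auto simp: dist_norm)
      then show "dist (Y m s) (Y n s) < e" by (rule dist_triangle_half_l)
    qed
  qed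
  obtain y where y: "uniform_limit {t..T} Y y sequentially"
    using Cauchy_uniformly_convergent[OF Cau] unfolding uniformly_convergent_on_def by blast
  have cy: "continuous_on {t..T} y"
    by (rule uniform_limit_theorem[OF _ y]) (use cont in auto)
  have lim: "(\<lambda>k. Y k s) \<longlonglongrightarrow> y s" if "s \<in> {t..T}" for s
    using tendsto_uniform_limitI[OF y that] .
  have close: "norm (y s - Y k s) \<le> 2 * B / 2 ^ k" if s: "s \<in> {t..T}" for s k
  proof (rule tendsto_upperbound)
    show "(\<lambda>j. norm (Y j s - Y k s)) \<longlonglongrightarrow> norm (y s - Y k s)"
      by (intro tendsto_intros lim s)
    show "\<forall>\<^sub>F j in sequentially. norm (Y j s - Y k s) \<le> 2 * B / 2 ^ k"
      using tail'[OF s, of k] by (auto simp: eventually_sequentially)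
  qed simp
  have eq: "y s - x = integral {t..s} (\<lambda>r. F (y r) (\<alpha> r))" if s: "s \<in> {t..T}" for s
  proof -
    have d: "norm (integral {t..s} (\<lambda>r. F (Y k r) (\<alpha> r)) - integral {t..s} (\<lambda>r. F (y r) (\<alpha> r))) \<le> 2 * B / 2 ^ k * exp (2 * L * T)" for k
    proof -
      have "norm (Y k r - y r) \<le> 2 * B / 2 ^ k * exp (2 * L * (r - t))" if r: "r \<in> {t..s}" for r
      proof -
        have "2 * B / 2 ^ k * 1 \<le> 2 * B / 2 ^ k * exp (2 * L * (r - t))"
          using r B0 L by (intro mult_left_mono) auto
        moreover have "norm (Y k r - y r) \<le> 2 * B / 2 ^ k"
          using close[of r k] r s by (auto simp: norm_minus_commute)
        ultimately show ?thesis by linarith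
      qed
      then have "norm (integral {t..s} (\<lambda>r. F (Y k r) (\<alpha> r)) - integral {t..s} (\<lambda>r. F (y r) (\<alpha> r)))
         \<le> (2 * B / 2 ^ k) / 2 * (exp (2 * L * (s - t)) - 1)"
        using s t B0 by (intro integrated_field_diff[OF \<alpha>]) (auto intro: continuous_on_subset[OF cont] continuous_on_subset[OF cy])
      also have "\<dots> \<le> 2 * B / 2 ^ k * exp (2 * L * T)"
      proof (rule mult_mono)
        have "exp (2 * L * (s - t)) \<le> exp (2 * L * T)" using s t L by simp
        then show "exp (2 * L * (s - t)) - 1 \<le> exp (2 * L * T)" by linarith
        show "2 * B / 2 ^ k / 2 \<le> 2 * B / 2 ^ k" using B0 by (simp add: divide_right_mono)
      qed (use B0 s L in auto)
      finally show ?thesis .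
    qed
    have "(\<lambda>k. integral {t..s} (\<lambda>r. F (Y k r) (\<alpha> r)) - integral {t..s} (\<lambda>r. F (y r) (\<alpha> r))) \<longlonglongrightarrow> 0"
      by (rule Lim_null_comparison[OF _ tendsto_mult_left_zero[OF pow, of "exp (2 * L * T)"]]) (use d in auto)
    then have "(\<lambda>k. Y (Suc k) s - x) \<longlonglongrightarrow> integral {t..s} (\<lambda>r. F (y r) (\<alpha> r))"
      unfolding YS by (simp add: LIM_zero_iff)
    moreover have "(\<lambda>k. Y (Suc k) s - x) \<longlonglongrightarrow> y s - x"
      by (intro tendsto_intros LIMSEQ_Suc lim s)
    ultimately show ?thesis by (rule LIMSEQ_unique[symmetric])
  qed
  have "trajectory \<alpha> x t y"
    unfolding trajectory_def
  proof
    fix s assume s: "s \<in> {t..T}"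
    show "((\<lambda>r. F (y r) (\<alpha> r)) has_integral y s - x) {t..s}"
      unfolding eq[OF s] using s t
      by (intro integrable_integral field_integrable[OF \<alpha>]) (auto intro: continuous_on_subset[OF cy])
  qed
  then show ?thesis using that by blast
qed

lemma trajectory_restrict:
  assumes "trajectory \<alpha> x t y" "t \<le> s"
  shows "trajectory \<alpha> (y s) s y"
  unfolding trajectory_def using trajectory_has_integral[OF assms] by auto

text \<open>The same operation concatenates controls and, applied to curves, trajectories.\<close>
definition switch_control :: "real \<Rightarrow> (real \<Rightarrow> 'c) \<Rightarrow> (real \<Rightarrow> 'c) \<Rightarrow> real \<Rightarrow> 'c" where
  "switch_control s \<alpha> \<beta> r = (if r \<le> s then \<alpha> r else \<beta> r)"

lemma switch_control_in_controls:
  assumes "\<alpha> \<in> controls A" "\<beta> \<in> controls A"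
  shows "switch_control s \<alpha> \<beta> \<in> controls A"
proof -
  have "(\<lambda>r. if r \<le> s then \<alpha> r else \<beta> r) \<in> borel_measurable (lebesgue_on {0..})"
  proof (intro measurable_If)
    have "{r. 0 \<le> r \<and> r \<le> s} = {0..s}" by auto
    then show "{r \<in> space (lebesgue_on {0..}). r \<le> s} \<in> sets (lebesgue_on {0..})"
      by (auto simp: sets_restrict_space_iff)
  qed (use assms in \<open>auto simp: controls_def\<close>)
  then show ?thesis using assms by (auto simp: controls_def switch_control_def[abs_def])
qed

lemma trajectory_switch:
  assumes y: "trajectory \<alpha> x t y" and ts: "t \<le> s" "s \<le> T" and z: "trajectory \<beta> (y s) s z"
  shows "trajectory (switch_control s \<alpha> \<beta>) x t (switch_control s y z)"
  unfolding trajectory_def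
proof
  fix r assume r: "r \<in> {t..T}"
  let ?g = "\<lambda>r. F (switch_control s y z r) (switch_control s \<alpha> \<beta> r)"
  have 1: "(?g has_integral (y q - x)) {t..q}" if "t \<le> q" "q \<le> s" for q
  proof (rule has_integral_eq)
    show "((\<lambda>r. F (y r) (\<alpha> r)) has_integral y q - x) {t..q}"
      using y ts that by (auto simp: trajectory_def)
  qed (use that in \<open>auto simp: switch_control_def\<close>)
  show "(?g has_integral switch_control s y z r - x) {t..r}"
  proof (cases "r \<le> s")
    case True then show ?thesis using 1[of r] r by (simp add: switch_control_def)
  next
    case False
    have "(?g has_integral (z r - y s)) {s..r}"
    proof (rule has_integral_spike_finite)
      show "((\<lambda>r. F (z r) (\<beta> r)) has_integral z r - y s) {s..r}"
        using z False r by (auto simp: trajectory_def)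
      show "finite {s}" by simp
    qed (auto simp: switch_control_def)
    from has_integral_combine[OF _ _ 1[OF ts(1) order_refl] this] False ts r
    show ?thesis by (simp add: switch_control_def)
  qed
qed

end

section \<open>Optimal stopping: dynamic programming and moduli of continuity\<close>

lemma uniformly_continuous_on_strip_iff:
  fixes u :: "real ^ 'd \<Rightarrow> real \<Rightarrow> real"
  shows "uniformly_continuous_on (UNIV \<times> {0..T}) (\<lambda>(x, t). u x t) \<longleftrightarrow>
    (\<forall>e>0. \<exists>d>0. \<forall>x y. \<forall>s\<in>{0..T}. \<forall>t\<in>{0..T}. norm (x - y) < d \<longrightarrow> \<bar>s - t\<bar> < d \<longrightarrow> \<bar>u x s - u y t\<bar> < e)"
  (is "?l \<longleftrightarrow> ?r")
proof
  assume l: ?l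
  show ?r
  proof (intro allI impI)
    fix e :: real assume "e > 0"
    with l obtain d where d: "d > 0" "\<And>z w. z \<in> UNIV \<times> {0..T} \<Longrightarrow> w \<in> UNIV \<times> {0..T} \<Longrightarrow> dist w z < d \<Longrightarrow>
        dist ((\<lambda>(x, t). u x t) w) ((\<lambda>(x, t). u x t) z) < e"
      unfolding uniformly_continuous_on_def by meson
    show "\<exists>d>0. \<forall>x y. \<forall>s\<in>{0..T}. \<forall>t\<in>{0..T}. norm (x - y) < d \<longrightarrow> \<bar>s - t\<bar> < d \<longrightarrow> \<bar>u x s - u y t\<bar> < e"
    proof (intro exI[of _ "d / 2"] conjI allI ballI impI)
      fix x y :: "real ^ 'd" and s t assume "s \<in> {0..T}" "t \<in> {0..T}" "norm (x - y) < d / 2" "\<bar>s - t\<bar> < d / 2"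
      then have "dist (x, s) (y, t) < d"
        using norm_Pair_le[of "x - y" "s - t"] by (simp add: dist_norm)
      then show "\<bar>u x s - u y t\<bar> < e"
        using d(2)[of "(y, t)" "(x, s)"] \<open>s \<in> {0..T}\<close> \<open>t \<in> {0..T}\<close> by (simp add: dist_real_def)
    qed (use d in auto)
  qed
next
  assume r: ?r
  show ?l
    unfolding uniformly_continuous_on_def
  proof (intro allI impI)
    fix e :: real assume "e > 0"
    with r obtain d where d: "d > 0" "\<And>x y s t. s \<in> {0..T} \<Longrightarrow> t \<in> {0..T} \<Longrightarrow> norm (x - y) < d \<Longrightarrow> \<bar>s - t\<bar> < d \<Longrightarrow> \<bar>u x s - u y t\<bar> < e"
      by meson
    show "\<exists>d>0. \<forall>z\<in>UNIV \<times> {0..T}. \<forall>w\<in>UNIV \<times> {0..T}. dist w z < d \<longrightarrow>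
        dist ((\<lambda>(x, t). u x t) w) ((\<lambda>(x, t). u x t) z) < e"
    proof (intro exI[of _ d] conjI ballI impI d(1))
      fix z w :: "(real ^ 'd) \<times> real"
      assume zw: "z \<in> UNIV \<times> {0..T}" "w \<in> UNIV \<times> {0..T}" "dist w z < d"
      have "norm (fst w - fst z) < d" "\<bar>snd w - snd z\<bar> < d"
        using dist_fst_le[of w z] dist_snd_le[of w z] zw(3) by (auto simp: dist_norm dist_real_def)
      then show "dist ((\<lambda>(x, t). u x t) w) ((\<lambda>(x, t). u x t) z) < e"
        using d(2)[of "snd w" "snd z" "fst w" "fst z"] zw by (auto simp: dist_real_def)
    qed
  qed
qed

lemma Pair_in_ballI:
  assumes "norm (z - x) < r / 2" "\<bar>s - t\<bar> < r / 2"
  shows "(z, s) \<in> ball (x, t) r"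
  using norm_Pair_le[of "x - z" "t - s"] assms by (simp add: dist_norm norm_minus_commute[of x] abs_minus_commute[of t])

lemma discount_error:
  fixes c h lam B :: real
  assumes "0 \<le> lam" "0 \<le> h" "\<bar>c\<bar> \<le> B"
  shows "\<bar>exp (- lam * h) * c - c\<bar> \<le> lam * h * B"
proof -
  have "\<bar>exp (- lam * h) * c - c\<bar> = (1 - exp (- lam * h)) * \<bar>c\<bar>"
  proof -
    have "exp (- lam * h) * c - c = - ((1 - exp (- lam * h)) * c)" by (simp add: algebra_simps)
    moreover have "exp (- lam * h) \<le> 1" using assms by simp
    ultimately show ?thesis by (simp add: abs_mult)
  qed
  also have "\<dots> \<le> lam * h * B"
    using exp_ge_add_one_self[of "- lam * h"] assms by (intro mult_mono) auto
  finally show ?thesis .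
qed

text \<open>
  Stop the system at a time of one's choice and pay \<open>\<psi>\<close> there. One constant \<open>K\<close> bounds both costs.
\<close>
locale stopping_problem = control_system A F M L T
  for A :: "(real ^ 'm) set" and F :: "real ^ 'd \<Rightarrow> real ^ 'm \<Rightarrow> real ^ 'd" and M L T :: real +
  fixes l :: "real ^ 'd \<Rightarrow> real ^ 'm \<Rightarrow> real \<Rightarrow> real" and \<psi> :: "real ^ 'd \<Rightarrow> real \<Rightarrow> real" and lam K :: real
  assumes lam: "lam \<ge> 0"
    and l_cont: "continuous_on (UNIV \<times> A \<times> {0..T}) (\<lambda>(x, a, t). l x a t)"
    and l_bound: "\<And>x a t. a \<in> A \<Longrightarrow> t \<in> {0..T} \<Longrightarrow> \<bar>l x a t\<bar> \<le> K"
    and l_unif_cont: "\<forall>e>0. \<exists>d>0. \<forall>x y. norm (x - y) < d \<longrightarrow> (\<forall>a\<in>A. \<forall>t\<in>{0..T}. \<bar>l x a t - l y a t\<bar> < e)"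
    and \<psi>_bound: "\<And>x t. t \<in> {0..T} \<Longrightarrow> \<bar>\<psi> x t\<bar> \<le> K"
    and \<psi>_unif_cont: "uniformly_continuous_on (UNIV \<times> {0..T}) (\<lambda>(x, t). \<psi> x t)"
begin

lemma K_nonneg: "K \<ge> 0"
  using \<psi>_bound[of 0 0] T by auto

definition running_cost :: "(real \<Rightarrow> real ^ 'm) \<Rightarrow> (real \<Rightarrow> real ^ 'd) \<Rightarrow> real \<Rightarrow> real \<Rightarrow> real" where
  "running_cost \<alpha> y t s = integral {t..s} (\<lambda>r. exp (- lam * (r - t)) * l (y r) (\<alpha> r) r)"

definition cost :: "(real \<Rightarrow> real ^ 'm) \<Rightarrow> (real \<Rightarrow> real ^ 'd) \<Rightarrow> real \<Rightarrow> real \<Rightarrow> real" where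
  "cost \<alpha> y t \<tau> = running_cost \<alpha> y t \<tau> + exp (- lam * (\<tau> - t)) * \<psi> (y \<tau>) \<tau>"

definition strategies :: "real ^ 'd \<Rightarrow> real \<Rightarrow> ((real \<Rightarrow> real ^ 'm) \<times> (real \<Rightarrow> real ^ 'd) \<times> real) set" where
  "strategies x t = {(\<alpha>, y, \<tau>). \<alpha> \<in> controls A \<and> trajectory \<alpha> x t y \<and> \<tau> \<in> {t..T}}"

definition stopping_value :: "real ^ 'd \<Rightarrow> real \<Rightarrow> real" where
  "stopping_value x t = (INF (\<alpha>, y, \<tau>) \<in> strategies x t. cost \<alpha> y t \<tau>)"

lemma running_absolutely_integrable:
  assumes "\<alpha> \<in> controls A" "continuous_on {u..v} y" "0 \<le> u" "v \<le> T"
  shows "(\<lambda>r. exp (- lam * (r - t)) * l (y r) (\<alpha> r) r) absolutely_integrable_on {u..v}"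
proof -
  have "continuous_on (UNIV \<times> A \<times> {0..T}) (\<lambda>(x, a, s). exp (- lam * (s - t)) * l x a s)"
    using l_cont by (auto simp: case_prod_unfold intro!: continuous_intros)
  moreover have "norm (exp (- lam * (s - t)) * l x a s) \<le> exp (lam * \<bar>t\<bar>) * K" if "a \<in> A" "s \<in> {0..T}" for x a s
  proof -
    have "- lam * (s - t) \<le> lam * \<bar>t\<bar>" using mult_left_mono[OF _ lam, of "t - s" "\<bar>t\<bar>"] that abs_ge_self[of t] by (auto simp: algebra_simps)
    then show ?thesis using l_bound[OF that, of x] K_nonneg by (auto simp: abs_mult intro!: mult_mono)
  qed
  ultimately show ?thesis
    by (rule absolutely_integrable_along[OF assms(1,3,4,2)])
qed

lemmas running_integrable = set_lebesgue_integral_eq_integral(1)[OF running_absolutely_integrable]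

lemma running_cost_bound:
  assumes "\<alpha> \<in> controls A" "continuous_on {t..s} y" "0 \<le> t" "t \<le> s" "s \<le> T"
  shows "\<bar>running_cost \<alpha> y t s\<bar> \<le> K * (s - t)"
proof -
  have "norm (running_cost \<alpha> y t s) \<le> integral {t..s} (\<lambda>_. K)"
    unfolding running_cost_def
  proof (rule integral_norm_bound_integral)
    fix r assume r: "r \<in> {t..s}"
    have "exp (- lam * (r - t)) \<le> 1" using r lam by simp
    moreover have "\<bar>l (y r) (\<alpha> r) r\<bar> \<le> K" using r assms control_values[OF assms(1)] by (intro l_bound) auto
    ultimately have "exp (- lam * (r - t)) * \<bar>l (y r) (\<alpha> r) r\<bar> \<le> 1 * K" using K_nonneg by (intro mult_mono) auto
    then show "norm (exp (- lam * (r - t)) * l (y r) (\<alpha> r) r) \<le> K" by (simp add: abs_mult)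
  qed (use running_integrable assms in auto)
  then show ?thesis using assms by (simp add: mult.commute)
qed

lemma running_cost_split:
  assumes "\<alpha> \<in> controls A" "continuous_on {t..s} y" "0 \<le> t" "t \<le> r" "r \<le> s" "s \<le> T"
  shows "running_cost \<alpha> y t s = running_cost \<alpha> y t r + exp (- lam * (r - t)) * running_cost \<alpha> y r s"
proof -
  have "exp (- lam * (r - t)) * running_cost \<alpha> y r s = integral {r..s} (\<lambda>q. exp (- lam * (q - t)) * l (y q) (\<alpha> q) q)"
    unfolding running_cost_def integral_mult_right[symmetric]
    by (intro integral_cong) (simp add: algebra_simps mult_exp_exp flip: mult.assoc)
  then show ?thesis
    unfolding running_cost_def
    using Henstock_Kurzweil_Integration.integral_combine[OF assms(4,5) running_integrable[OF assms(1-3,6)], of t] by simp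
qed

lemma cost_split:
  assumes "\<alpha> \<in> controls A" "continuous_on {t..\<tau>} y" "0 \<le> t" "t \<le> s" "s \<le> \<tau>" "\<tau> \<le> T"
  shows "cost \<alpha> y t \<tau> = running_cost \<alpha> y t s + exp (- lam * (s - t)) * cost \<alpha> y s \<tau>"
  unfolding cost_def using running_cost_split[OF assms]
  by (simp add: algebra_simps mult_exp_exp)

lemma discount_abs_le:
  assumes "t \<le> s" "\<bar>c\<bar> \<le> B"
  shows "\<bar>exp (- lam * (s - t)) * c\<bar> \<le> B"
proof -
  have "exp (- lam * (s - t)) \<le> 1" using assms lam by simp
  then have "exp (- lam * (s - t)) * \<bar>c\<bar> \<le> 1 * B" using assms by (intro mult_mono) auto
  then show ?thesis by (simp add: abs_mult)
qed

lemma cost_bound: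
  assumes "(\<alpha>, y, \<tau>) \<in> strategies x t" "0 \<le> t"
  shows "\<bar>cost \<alpha> y t \<tau>\<bar> \<le> K * T + K"
proof -
  have a: "\<alpha> \<in> controls A" "trajectory \<alpha> x t y" "t \<le> \<tau>" "\<tau> \<le> T" using assms by (auto simp: strategies_def)
  have "continuous_on {t..\<tau>} y"
    using continuous_on_subset[OF trajectory_continuous[OF a(1,2) assms(2)]] a by auto
  from running_cost_bound[OF a(1) this assms(2) a(3,4)]
  have "\<bar>running_cost \<alpha> y t \<tau>\<bar> \<le> K * (\<tau> - t)" .
  also have "\<dots> \<le> K * T" using a assms K_nonneg by (intro mult_left_mono) auto
  finally show ?thesis
    unfolding cost_def using discount_abs_le[OF a(3) \<psi>_bound, of \<tau> "y \<tau>"] a assms by auto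
qed

lemma stopping_value_le_cost:
  assumes "(\<alpha>, y, \<tau>) \<in> strategies x t" "0 \<le> t"
  shows "stopping_value x t \<le> cost \<alpha> y t \<tau>"
proof -
  have "bdd_below ((\<lambda>(\<alpha>, y, \<tau>). cost \<alpha> y t \<tau>) ` strategies x t)"
    using cost_bound[OF _ assms(2), of _ _ _ x] by (intro bdd_belowI2[of _ "- (K * T + K)"]) (auto, smt (verit))
  from cINF_lower[OF this assms(1)] show ?thesis unfolding stopping_value_def by simp
qed

lemma constant_control: "a \<in> A \<Longrightarrow> (\<lambda>_. a) \<in> controls A"
  by (simp add: controls_def)

lemma strategies_nonempty:
  assumes "0 \<le> t" "t \<le> T"
  shows "strategies x t \<noteq> {}"
proof -
  obtain a where "a \<in> A" using A(2) by blast
  then have "(\<lambda>_. a) \<in> controls A" by (rule constant_control)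
  moreover from trajectory_exists[OF this assms] obtain y where "trajectory (\<lambda>_. a) x t y" .
  ultimately have "((\<lambda>_. a), y, t) \<in> strategies x t" using assms by (auto simp: strategies_def)
  then show ?thesis by blast
qed

lemma le_stopping_value:
  assumes "0 \<le> t" "t \<le> T" "\<And>\<alpha> y \<tau>. (\<alpha>, y, \<tau>) \<in> strategies x t \<Longrightarrow> c \<le> cost \<alpha> y t \<tau>"
  shows "c \<le> stopping_value x t"
  unfolding stopping_value_def using strategies_nonempty[OF assms(1,2)] assms(3)
  by (intro cINF_greatest) auto

lemma stopping_value_le_obstacle:
  assumes "0 \<le> t" "t \<le> T"
  shows "stopping_value x t \<le> \<psi> x t"
proof -
  obtain \<alpha> y \<tau> where "(\<alpha>, y, \<tau>) \<in> strategies x t" using strategies_nonempty[OF assms] by (metis all_not_in_conv prod_cases3)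
  then have "(\<alpha>, y, t) \<in> strategies x t" "y t = x" using assms trajectory_start by (auto simp: strategies_def)
  from stopping_value_le_cost[OF this(1) assms(1)] this(2) show ?thesis by (simp add: cost_def running_cost_def)
qed

lemma stopping_value_bound:
  assumes "t \<in> {0..T}"
  shows "\<bar>stopping_value x t\<bar> \<le> K * T + K"
proof -
  have "- (K * T + K) \<le> stopping_value x t"
    using assms cost_bound by (intro le_stopping_value) (auto, smt (verit))
  moreover have "stopping_value x t \<le> K" using stopping_value_le_obstacle[of t x] \<psi>_bound[of t x] assms by auto
  moreover have "K * T \<ge> 0" using K_nonneg T by simp
  ultimately show ?thesis by linarith
qed

lemma stopping_value_terminal: "stopping_value x T = \<psi> x T"
proof (rule antisym)
  show "\<psi> x T \<le> stopping_value x T"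
  proof (rule le_stopping_value)
    fix \<alpha> y \<tau> assume "(\<alpha>, y, \<tau>) \<in> strategies x T"
    then have "\<tau> = T" "y T = x" using trajectory_start by (auto simp: strategies_def)
    then show "\<psi> x T \<le> cost \<alpha> y T \<tau>" by (simp add: cost_def running_cost_def)
  qed (use T in auto)
qed (use T stopping_value_le_obstacle in auto)

text \<open>
  First half of dynamic programming: what remains of a strategy after time \<open>s\<close> is a strategy from
  \<open>(y(s), s)\<close>, whose cost is at least the value there.
\<close>
lemma running_plus_value_le_cost:
  assumes st: "(\<alpha>, y, \<tau>) \<in> strategies x t" and "0 \<le> t" "t \<le> s" "s \<le> \<tau>"
  shows "running_cost \<alpha> y t s + exp (- lam * (s - t)) * stopping_value (y s) s \<le> cost \<alpha> y t \<tau>"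
proof -
  have a: "\<alpha> \<in> controls A" "trajectory \<alpha> x t y" "t \<le> \<tau>" "\<tau> \<le> T" using assms by (auto simp: strategies_def)
  have cont: "continuous_on {t..\<tau>} y"
    using continuous_on_subset[OF trajectory_continuous[OF a(1,2) assms(2)]] a by auto
  have "(\<alpha>, y, \<tau>) \<in> strategies (y s) s"
    using a assms trajectory_restrict[OF a(2) assms(3)] by (auto simp: strategies_def)
  from stopping_value_le_cost[OF this] assms
  have "exp (- lam * (s - t)) * stopping_value (y s) s \<le> exp (- lam * (s - t)) * cost \<alpha> y s \<tau>"
    by (intro mult_left_mono) auto
  then show ?thesis using cost_split[OF a(1) cont assms(2-4) a(4)] by simp
qed

text \<open>
  Second half: following \<open>\<alpha>\<close> up to \<open>s\<close> and any strategy from \<open>(y(s), s)\<close> afterwards is again a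
  strategy, so the value is at most the infimum of these costs.
\<close>
lemma stopping_value_le_running_plus_value:
  assumes \<alpha>: "\<alpha> \<in> controls A" and y: "trajectory \<alpha> x t y" and t: "0 \<le> t" "t \<le> s" "s \<le> T"
  shows "stopping_value x t \<le> running_cost \<alpha> y t s + exp (- lam * (s - t)) * stopping_value (y s) s"
proof -
  define e where "e = exp (- lam * (s - t))"
  have e0: "e > 0" by (simp add: e_def)
  have "(stopping_value x t - running_cost \<alpha> y t s) / e \<le> stopping_value (y s) s"
  proof (rule le_stopping_value)
    fix \<beta> z \<tau> assume "(\<beta>, z, \<tau>) \<in> strategies (y s) s"
    then have b: "\<beta> \<in> controls A" "trajectory \<beta> (y s) s z" "s \<le> \<tau>" "\<tau> \<le> T" by (auto simp: strategies_def)
    let ?\<gamma> = "switch_control s \<alpha> \<beta>" and ?w = "switch_control s y z"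
    have g: "?\<gamma> \<in> controls A" "trajectory ?\<gamma> x t ?w"
      using switch_control_in_controls[OF \<alpha> b(1)] trajectory_switch[OF y t(2,3) b(2)] by auto
    have zs: "z s = y s" using trajectory_start[OF b(2)] t by auto
    have cont: "continuous_on {t..\<tau>} ?w"
      using continuous_on_subset[OF trajectory_continuous[OF g t(1)]] b by auto
    have "(?\<gamma>, ?w, \<tau>) \<in> strategies x t" using g b t by (auto simp: strategies_def)
    from stopping_value_le_cost[OF this t(1)]
    have "stopping_value x t \<le> running_cost ?\<gamma> ?w t s + e * cost ?\<gamma> ?w s \<tau>"
      using cost_split[OF g(1) cont t(1,2) b(3,4)] by (simp add: e_def)
    also have "running_cost ?\<gamma> ?w t s = running_cost \<alpha> y t s"
      unfolding running_cost_def by (intro integral_cong) (simp add: switch_control_def)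
    \<comment> \<open>The concatenation still uses \<open>\<alpha>\<close> at the single instant \<open>s\<close>.\<close>
    also have "running_cost ?\<gamma> ?w s \<tau> = running_cost \<beta> z s \<tau>"
      unfolding running_cost_def
      by (rule integral_spike[of "{s}"]) (auto simp: switch_control_def)
    then have "cost ?\<gamma> ?w s \<tau> = cost \<beta> z s \<tau>"
      unfolding cost_def using b zs by (auto simp: switch_control_def)
    finally show "(stopping_value x t - running_cost \<alpha> y t s) / e \<le> cost \<beta> z s \<tau>"
      using e0 by (simp add: field_simps)
  qed (use t in auto)
  then show ?thesis using e0 unfolding e_def[symmetric] by (simp add: field_simps)
qed

lemma running_cost_diff:
  assumes "\<alpha> \<in> controls A" "0 \<le> t" "t \<le> s" "s \<le> T"
    and "continuous_on {t..s} y" "continuous_on {t..s} z"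
    and d: "\<And>a r. a \<in> A \<Longrightarrow> r \<in> {t..s} \<Longrightarrow> \<bar>l (y r) a r - l (z r) a r\<bar> \<le> e"
  shows "\<bar>running_cost \<alpha> y t s - running_cost \<alpha> z t s\<bar> \<le> e * (s - t)"
proof -
  let ?h = "\<lambda>y r. exp (- lam * (r - t)) * l (y r) (\<alpha> r) r"
  have i: "?h y integrable_on {t..s}" "?h z integrable_on {t..s}"
    using running_integrable assms by auto
  have "running_cost \<alpha> y t s - running_cost \<alpha> z t s = integral {t..s} (\<lambda>r. ?h y r - ?h z r)"
    unfolding running_cost_def using i by (simp add: Henstock_Kurzweil_Integration.integral_diff)
  also have "norm \<dots> \<le> integral {t..s} (\<lambda>_. e)"
  proof (rule integral_norm_bound_integral)
    show "(\<lambda>r. ?h y r - ?h z r) integrable_on {t..s}" using i by (rule integrable_diff)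
    fix r assume r: "r \<in> {t..s}"
    then have "\<bar>l (y r) (\<alpha> r) r - l (z r) (\<alpha> r) r\<bar> \<le> e"
      using assms control_values[OF assms(1)] by auto
    from discount_abs_le[OF _ this, of t r] r
    show "norm (?h y r - ?h z r) \<le> e" by (simp add: right_diff_distrib)
  qed auto
  finally show ?thesis using assms by (simp add: mult.commute)
qed

text \<open>
  A strategy for \<open>x'\<close> is copied for \<open>x\<close>: same control, same stopping time. The two trajectories stay
  close by \<open>trajectory_dist\<close>, so the costs are close as well.
\<close>
lemma stopping_value_space_modulus:
  assumes e: "e > 0"
  obtains d where "d > 0"
    "\<And>x x' t. t \<in> {0..T} \<Longrightarrow> norm (x - x') < d \<Longrightarrow> \<bar>stopping_value x t - stopping_value x' t\<bar> \<le> e"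
proof -
  \<comment> \<open>The running cost contributes \<open>e1 * T\<close> to the error and the stopping cost \<open>e1\<close>.\<close>
  define e1 where "e1 = e / (2 * (T + 1))"
  have e1: "e1 > 0" using e T by (auto simp: e1_def)
  have "e1 * T + e1 = e1 * (T + 1)" by (simp add: algebra_simps)
  also have "\<dots> = e / 2" using T by (simp add: e1_def field_simps)
  finally have e1T: "e1 * T + e1 \<le> e" using e by simp
  from l_unif_cont e1 obtain d1 where d1: "d1 > 0"
    "\<And>x y a t. norm (x - y) < d1 \<Longrightarrow> a \<in> A \<Longrightarrow> t \<in> {0..T} \<Longrightarrow> \<bar>l x a t - l y a t\<bar> < e1" by meson
  from \<psi>_unif_cont[unfolded uniformly_continuous_on_strip_iff] e1 obtain d2 where d2: "d2 > 0"
    "\<And>x y s t. s \<in> {0..T} \<Longrightarrow> t \<in> {0..T} \<Longrightarrow> norm (x - y) < d2 \<Longrightarrow> \<bar>s - t\<bar> < d2 \<Longrightarrow> \<bar>\<psi> x s - \<psi> y t\<bar> < e1" by meson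
  define C where "C = 2 * exp (2 * L * T)"
  have C: "C > 0" by (simp add: C_def)
  define d where "d = min d1 d2 / C"
  have d: "d > 0" using C d1 d2 by (simp add: d_def)
  have one: "stopping_value x t \<le> stopping_value x' t + e" if t: "t \<in> {0..T}" and xx: "norm (x - x') < d" for x x' t
  proof -
    have "stopping_value x t - e \<le> stopping_value x' t"
    proof (rule le_stopping_value)
      fix \<alpha> z \<tau> assume "(\<alpha>, z, \<tau>) \<in> strategies x' t"
      then have a: "\<alpha> \<in> controls A" "trajectory \<alpha> x' t z" "t \<le> \<tau>" "\<tau> \<le> T" by (auto simp: strategies_def)
      obtain y where y: "trajectory \<alpha> x t y" using trajectory_exists[OF a(1)] t by auto
      have close: "norm (y r - z r) < min d1 d2" if "r \<in> {t..T}" for r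
      proof -
        have "norm (y r - z r) \<le> C * norm (x - x')"
          unfolding C_def using trajectory_dist[OF a(1) _ y a(2) that] t by simp
        also have "\<dots> < min d1 d2" using xx C by (simp add: d_def field_simps)
        finally show ?thesis .
      qed
      have cont: "continuous_on {t..\<tau>} y" "continuous_on {t..\<tau>} z"
        using trajectory_continuous[OF a(1) y] trajectory_continuous[OF a(1,2)] t a
        by (auto intro: continuous_on_subset)
      have "\<bar>running_cost \<alpha> y t \<tau> - running_cost \<alpha> z t \<tau>\<bar> \<le> e1 * (\<tau> - t)"
        using a t cont close d1(2) by (intro running_cost_diff) (auto intro!: less_imp_le)
      also have "\<dots> \<le> e1 * T" using a t e1 by (intro mult_left_mono) auto
      finally have 1: "\<bar>running_cost \<alpha> y t \<tau> - running_cost \<alpha> z t \<tau>\<bar> \<le> e1 * T" .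
      have "\<bar>\<psi> (y \<tau>) \<tau> - \<psi> (z \<tau>) \<tau>\<bar> \<le> e1"
        using d2(2)[of \<tau> \<tau> "y \<tau>" "z \<tau>"] close[of \<tau>] d2(1) a t by auto
      from discount_abs_le[OF a(3) this]
      have 2: "\<bar>exp (- lam * (\<tau> - t)) * \<psi> (y \<tau>) \<tau> - exp (- lam * (\<tau> - t)) * \<psi> (z \<tau>) \<tau>\<bar> \<le> e1"
        by (simp add: right_diff_distrib)
      have "(\<alpha>, y, \<tau>) \<in> strategies x t" using a y by (auto simp: strategies_def)
      from stopping_value_le_cost[OF this] t have "stopping_value x t \<le> cost \<alpha> y t \<tau>" by simp
      also have "\<dots> \<le> cost \<alpha> z t \<tau> + e" using 1 2 e1T unfolding cost_def by linarith
      finally show "stopping_value x t - e \<le> cost \<alpha> z t \<tau>" by simp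
    qed (use t in auto)
    then show ?thesis by simp
  qed
  have "\<bar>stopping_value x t - stopping_value x' t\<bar> \<le> e" if "t \<in> {0..T}" "norm (x - x') < d" for x x' t
    using one[OF that] one[of t x' x] that by (auto simp: norm_minus_commute)
  with d that show ?thesis by blast
qed

text \<open>
  By dynamic programming \<open>W(x, t)\<close> is compared with \<open>W(y(t'), t')\<close>, where \<open>y(t')\<close> is within
  \<open>M (t' - t)\<close> of \<open>x\<close>, so the modulus in space applies. A strategy that stops before \<open>t'\<close>
  pays \<open>\<psi>\<close> near \<open>(x, t')\<close>, and \<open>\<psi> \<ge> W\<close>.
\<close>
lemma stopping_value_time_modulus:
  assumes e: "e > 0"
  obtains d where "d > 0"
    "\<And>x t t'. 0 \<le> t \<Longrightarrow> t \<le> t' \<Longrightarrow> t' \<le> T \<Longrightarrow> t' - t < d \<Longrightarrow> \<bar>stopping_value x t - stopping_value x t'\<bar> \<le> e"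
proof -
  obtain d1 where d1: "d1 > 0"
    "\<And>x x' t. t \<in> {0..T} \<Longrightarrow> norm (x - x') < d1 \<Longrightarrow> \<bar>stopping_value x t - stopping_value x' t\<bar> \<le> e / 2"
    using stopping_value_space_modulus[of "e / 2"] e by auto
  from \<psi>_unif_cont[unfolded uniformly_continuous_on_strip_iff, rule_format, of "e / 2"] e obtain d2 where d2: "d2 > 0"
    "\<And>x y s t. s \<in> {0..T} \<Longrightarrow> t \<in> {0..T} \<Longrightarrow> norm (x - y) < d2 \<Longrightarrow> \<bar>s - t\<bar> < d2 \<Longrightarrow> \<bar>\<psi> x s - \<psi> y t\<bar> < e / 2" by auto
  define B where "B = K * T + K"
  have B: "B \<ge> 0" "K \<le> B" using K_nonneg T by (auto simp: B_def)
  define D where "D = K + lam * B + 1"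
  have D: "D > 0" using K_nonneg lam B by (simp add: D_def add_nonneg_pos)
  \<comment> \<open>Dividing by \<open>M + 1\<close> keeps both the time step and the displacement below \<open>d1\<close> and \<open>d2\<close>,
     also when \<open>M = 0\<close>.\<close>
  define d where "d = min (min d1 d2 / (M + 1)) (e / (2 * D))"
  have M1: "M + 1 > 0" using M_nonneg by simp
  have d: "d > 0" using d1 d2 e D M1 by (simp add: d_def)
  have "\<bar>stopping_value x t - stopping_value x t'\<bar> \<le> e" if t: "0 \<le> t" "t \<le> t'" "t' \<le> T" "t' - t < d" for x t t'
  proof -
    have h1: "(t' - t) * (M + 1) < min d1 d2" and h2: "D * (t' - t) \<le> e / 2"
      using t(4) D M1 unfolding d_def by (auto simp: field_simps)
    have small: "K * (s - t) + lam * (s - t) * B \<le> e / 2" if "t \<le> s" "s \<le> t'" for s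
    proof -
      have "K * (s - t) + lam * (s - t) * B = (K + lam * B) * (s - t)" by (simp add: algebra_simps)
      also have "\<dots> \<le> D * (t' - t)" using that lam B K_nonneg unfolding D_def by (intro mult_mono) auto
      finally show ?thesis using h2 by simp
    qed
    have near: "norm (y s - x) < min d1 d2" if "\<alpha> \<in> controls A" "trajectory \<alpha> x t y" "t \<le> s" "s \<le> t'" for \<alpha> y s
    proof -
      have "norm (y s - y t) \<le> M * (s - t)" using trajectory_Lipschitz[OF that(1,2) t(1)] that t by auto
      also have "\<dots> \<le> (M + 1) * (t' - t)" using that M_nonneg by (intro mult_mono) auto
      also have "\<dots> < min d1 d2" using h1 by (simp add: mult.commute)
      finally show ?thesis using trajectory_start[OF that(2)] t by simp
    qed
    have first: "\<bar>running_cost \<alpha> y t s\<bar> \<le> K * (s - t)" if "\<alpha> \<in> controls A" "trajectory \<alpha> x t y" "t \<le> s" "s \<le> t'" for \<alpha> y s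
      using that t trajectory_continuous[OF that(1,2) t(1)] by (intro running_cost_bound) (auto intro: continuous_on_subset)
    have V: "\<bar>running_cost \<alpha> y t t' + exp (- lam * (t' - t)) * stopping_value (y t') t' - stopping_value x t'\<bar> \<le> e"
      if "\<alpha> \<in> controls A" "trajectory \<alpha> x t y" for \<alpha> y
    proof -
      have "\<bar>stopping_value (y t') t' - stopping_value x t'\<bar> \<le> e / 2"
        using near[OF that t(2) order_refl] t by (intro d1(2)) auto
      moreover have "\<bar>exp (- lam * (t' - t)) * stopping_value (y t') t' - stopping_value (y t') t'\<bar> \<le> lam * (t' - t) * B"
        unfolding B_def using t lam by (intro discount_error stopping_value_bound) auto
      ultimately show ?thesis using first[OF that t(2) order_refl] small[OF t(2) order_refl] by linarith
    qed
    obtain a where "a \<in> A" using A(2) by blast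
    then have ca: "(\<lambda>_. a) \<in> controls A" by (rule constant_control)
    obtain y where y: "trajectory (\<lambda>_. a) x t y" by (rule trajectory_exists[OF ca, of t]) (use t in auto)
    have "stopping_value x t \<le> stopping_value x t' + e"
      using stopping_value_le_running_plus_value[OF ca y t(1-3)] V[OF ca y] by linarith
    moreover have "stopping_value x t' - e \<le> stopping_value x t"
    proof (rule le_stopping_value)
      fix \<alpha> y \<tau> assume st: "(\<alpha>, y, \<tau>) \<in> strategies x t"
      then have a: "\<alpha> \<in> controls A" "trajectory \<alpha> x t y" "t \<le> \<tau>" "\<tau> \<le> T" by (auto simp: strategies_def)
      show "stopping_value x t' - e \<le> cost \<alpha> y t \<tau>"
      proof (cases "t' \<le> \<tau>")
        case True
        from running_plus_value_le_cost[OF st t(1,2) True] V[OF a(1,2)] show ?thesis by linarith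
      next
        case False
        then have \<tau>: "\<tau> \<le> t'" by simp
        have "\<bar>\<psi> (y \<tau>) \<tau> - \<psi> x t'\<bar> \<le> e / 2"
        proof (rule less_imp_le, rule d2(2))
          have "\<bar>\<tau> - t'\<bar> \<le> (t' - t) * 1" using a \<tau> by simp
          also have "\<dots> \<le> (t' - t) * (M + 1)" using t M_nonneg by (intro mult_left_mono) auto
          finally show "\<bar>\<tau> - t'\<bar> < d2" using h1 by simp
        qed (use near[OF a(1-3) \<tau>] a t in auto)
        moreover have "\<bar>exp (- lam * (\<tau> - t)) * \<psi> (y \<tau>) \<tau> - \<psi> (y \<tau>) \<tau>\<bar> \<le> lam * (\<tau> - t) * B"
          using a t lam \<psi>_bound[of \<tau> "y \<tau>"] B by (intro discount_error) auto
        moreover have "stopping_value x t' \<le> \<psi> x t'" using t by (intro stopping_value_le_obstacle) auto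
        ultimately show ?thesis
          using first[OF a(1-3) \<tau>] small[OF a(3) \<tau>] unfolding cost_def by linarith
      qed
    qed (use t in auto)
    ultimately show ?thesis by linarith
  qed
  with d that show ?thesis by blast
qed

lemma stopping_value_uniformly_continuous:
  "uniformly_continuous_on (UNIV \<times> {0..T}) (\<lambda>(x, t). stopping_value x t)"
  unfolding uniformly_continuous_on_strip_iff
proof (intro allI impI)
  fix e :: real assume e: "e > 0"
  obtain d1 where d1: "d1 > 0"
    "\<And>x x' t. t \<in> {0..T} \<Longrightarrow> norm (x - x') < d1 \<Longrightarrow> \<bar>stopping_value x t - stopping_value x' t\<bar> \<le> e / 3"
    using stopping_value_space_modulus[of "e / 3"] e by auto
  obtain d2 where d2: "d2 > 0"
    "\<And>x t t'. 0 \<le> t \<Longrightarrow> t \<le> t' \<Longrightarrow> t' \<le> T \<Longrightarrow> t' - t < d2 \<Longrightarrow> \<bar>stopping_value x t - stopping_value x t'\<bar> \<le> e / 3"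
    using stopping_value_time_modulus[of "e / 3"] e by auto
  show "\<exists>d>0. \<forall>x y. \<forall>s\<in>{0..T}. \<forall>t\<in>{0..T}. norm (x - y) < d \<longrightarrow> \<bar>s - t\<bar> < d \<longrightarrow>
      \<bar>stopping_value x s - stopping_value y t\<bar> < e"
  proof (intro exI[of _ "min d1 d2"] conjI allI ballI impI)
    fix x y :: "real ^ 'd" and s t assume st: "s \<in> {0..T}" "t \<in> {0..T}" and near: "norm (x - y) < min d1 d2" "\<bar>s - t\<bar> < min d1 d2"
    have "\<bar>stopping_value x s - stopping_value y s\<bar> \<le> e / 3" using d1(2)[OF st(1)] near by simp
    moreover have "\<bar>stopping_value y s - stopping_value y t\<bar> \<le> e / 3"
      using d2(2)[of s t y] d2(2)[of t s y] st near
      by (cases "s \<le> t") (auto simp: abs_minus_commute[of "stopping_value y t"])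
    ultimately show "\<bar>stopping_value x s - stopping_value y t\<bar> < e" using e by linarith
  qed (use d1 d2 in auto)
qed

end

section \<open>Optimal stopping: the value solves the obstacle problem\<close>

lemma exp_neg_upper_quadratic:
  fixes u :: real
  assumes "u \<ge> 0"
  shows "exp (- u) \<le> 1 - u + u\<^sup>2"
proof -
  have "1 \<le> (1 - u + u\<^sup>2) * (1 + u)" using assms by (simp add: algebra_simps power2_eq_square)
  also have "\<dots> \<le> (1 - u + u\<^sup>2) * exp u"
  proof (rule mult_left_mono)
    have "0 \<le> (1 - u / 2)\<^sup>2 + 3 / 4 * u\<^sup>2" by simp
    also have "\<dots> = 1 - u + u\<^sup>2" by (simp add: power2_eq_square algebra_simps)
    finally show "0 \<le> 1 - u + u\<^sup>2" .
  qed (rule exp_ge_add_one_self)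
  finally show ?thesis by (simp add: exp_minus field_simps)
qed

lemma discount_expansion:
  fixes lam k c \<Delta> B :: real
  assumes "lam \<ge> 0" "k \<ge> 0" "\<bar>\<Delta>\<bar> \<le> B * k"
  shows "\<bar>exp (- lam * k) * (c + \<Delta>) - c - \<Delta> + lam * k * c\<bar> \<le> (lam\<^sup>2 * \<bar>c\<bar> + lam * B) * k * k"
proof -
  have u: "lam * k \<ge> 0" using assms by simp
  have "\<bar>exp (- (lam * k)) - 1 + lam * k\<bar> \<le> (lam * k)\<^sup>2"
    using exp_neg_upper_quadratic[OF u] exp_ge_add_one_self[of "- (lam * k)"] by simp
  then have 1: "\<bar>(exp (- (lam * k)) - 1 + lam * k) * c\<bar> \<le> (lam * k)\<^sup>2 * \<bar>c\<bar>"
    unfolding abs_mult by (intro mult_right_mono) auto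
  have 2: "\<bar>exp (- lam * k) * \<Delta> - \<Delta>\<bar> \<le> lam * k * (B * k)"
    using assms by (intro discount_error)
  have "exp (- lam * k) * (c + \<Delta>) - c - \<Delta> + lam * k * c
      = (exp (- (lam * k)) - 1 + lam * k) * c + (exp (- lam * k) * \<Delta> - \<Delta>)"
    by (simp add: algebra_simps)
  also have "\<bar>\<dots>\<bar> \<le> (lam * k)\<^sup>2 * \<bar>c\<bar> + lam * k * (B * k)" using 1 2 by linarith
  also have "\<dots> = (lam\<^sup>2 * \<bar>c\<bar> + lam * B) * k * k" by (simp add: power2_eq_square algebra_simps)
  finally show ?thesis .
qed

context stopping_problem
begin

lemma l_equicontinuous_on_compact:
  assumes "compact S" "e > 0"
  obtains d where "d > 0"
    "\<And>x y a s t. x \<in> S \<Longrightarrow> y \<in> S \<Longrightarrow> a \<in> A \<Longrightarrow> s \<in> {0..T} \<Longrightarrow> t \<in> {0..T} \<Longrightarrow>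
       norm (x - y) < d \<Longrightarrow> \<bar>s - t\<bar> < d \<Longrightarrow> \<bar>l x a s - l y a t\<bar> < e"
proof -
  have "uniformly_continuous_on (S \<times> A \<times> {0..T}) (\<lambda>(x, a, t). l x a t)"
    using assms A(1) by (intro compact_uniformly_continuous continuous_on_subset[OF l_cont] compact_Times) auto
  then obtain d where d: "d > 0" "\<And>z w. z \<in> S \<times> A \<times> {0..T} \<Longrightarrow> w \<in> S \<times> A \<times> {0..T} \<Longrightarrow> dist w z < d \<Longrightarrow>
      dist ((\<lambda>(x, a, t). l x a t) w) ((\<lambda>(x, a, t). l x a t) z) < e"
    using assms(2) unfolding uniformly_continuous_on_def by meson
  have "\<bar>l x a s - l y a t\<bar> < e" if "x \<in> S" "y \<in> S" "a \<in> A" "s \<in> {0..T}" "t \<in> {0..T}"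
       "norm (x - y) < d / 2" "\<bar>s - t\<bar> < d / 2" for x y a s t
  proof -
    have "norm (x - y, a - a, s - t) \<le> norm (x - y) + norm (a - a, s - t)" by (rule norm_Pair_le)
    also have "norm (a - a, s - t) \<le> norm (a - a) + norm (s - t)" by (rule norm_Pair_le)
    finally have "dist (x, a, s) (y, a, t) < d" using that by (simp add: dist_norm)
    then show ?thesis using d(2)[of "(y, a, t)" "(x, a, s)"] that by (simp add: dist_real_def)
  qed
  with d(1) that[of "d / 2"] show ?thesis by simp
qed

lemma integrable_in_control:
  fixes g :: "real ^ 'm \<Rightarrow> real"
  assumes "\<alpha> \<in> controls A" "0 \<le> u" "v \<le> T" "continuous_on A g"
  shows "(\<lambda>r. g (\<alpha> r)) integrable_on {u..v}"
proof -
  have "bounded (g ` A)" using A(1) assms(4) by (intro compact_imp_bounded compact_continuous_image)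
  then obtain B where B: "\<And>a. a \<in> A \<Longrightarrow> norm (g a) \<le> B" by (auto simp: bounded_iff)
  have "continuous_on (UNIV \<times> A \<times> {0..T}) (\<lambda>z. g (fst (snd z)))"
    by (intro continuous_on_compose2[OF assms(4)] continuous_intros) auto
  then have "continuous_on (UNIV \<times> A \<times> {0..T}) (\<lambda>(x :: real ^ 'd, a, s). g a)" by (simp add: case_prod_unfold)
  from absolutely_integrable_along[OF assms(1-3) continuous_on_const this B]
  show ?thesis by (auto dest: set_lebesgue_integral_eq_integral(1))
qed

text \<open>
  Only the control varies quickly. On a short interval the state stays within \<open>M k\<close> of \<open>x\<close>, and by
  compactness of \<open>A\<close> the running cost is continuous there uniformly in the control value, so state,
  time and discount factor can be frozen at an error \<open>o(k)\<close> that is the same for all controls.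
\<close>
lemma running_cost_expansion:
  assumes t: "0 \<le> t" "t < T" and e: "e > 0"
  obtains h where "h > 0" "t + h \<le> T"
    "\<And>\<alpha> y k. \<alpha> \<in> controls A \<Longrightarrow> trajectory \<alpha> x t y \<Longrightarrow> 0 \<le> k \<Longrightarrow> k \<le> h \<Longrightarrow>
       \<bar>running_cost \<alpha> y t (t + k) - integral {t..t + k} (\<lambda>r. l x (\<alpha> r) t)\<bar> \<le> e * k"
proof -
  obtain d where d: "d > 0"
    "\<And>z y a s r. z \<in> cball x 1 \<Longrightarrow> y \<in> cball x 1 \<Longrightarrow> a \<in> A \<Longrightarrow> s \<in> {0..T} \<Longrightarrow> r \<in> {0..T} \<Longrightarrow>
       norm (z - y) < d \<Longrightarrow> \<bar>s - r\<bar> < d \<Longrightarrow> \<bar>l z a s - l y a r\<bar> < e / 2"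
    using l_equicontinuous_on_compact[OF compact_cball, of "e / 2" x 1] e by auto
  define h where "h = min (T - t) (min (min d 1 / (2 * (M + 1))) (e / (2 * (lam * K + 1))))"
  have pos: "M + 1 > 0" "lam * K + 1 > 0" using M_nonneg lam K_nonneg by (auto intro: add_nonneg_pos)
  have h0: "h > 0" "t + h \<le> T" using t d(1) e pos by (auto simp: h_def)
  have h1: "(M + 1) * h < min d 1"
  proof -
    have "h \<le> min d 1 / (2 * (M + 1))" by (simp add: h_def)
    then have "(M + 1) * h \<le> min d 1 / 2" using pos by (simp add: field_simps)
    also have "\<dots> < min d 1" using d(1) by linarith
    finally show ?thesis .
  qed
  have "h \<le> e / (2 * (lam * K + 1))" by (simp add: h_def)
  then have h2: "(lam * K + 1) * h \<le> e / 2" using pos by (simp add: field_simps)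
  show ?thesis
  proof (rule that[OF h0])
    fix \<alpha> y k assume a: "\<alpha> \<in> controls A" "trajectory \<alpha> x t y" and k: "0 \<le> k" "k \<le> h"
    let ?f = "\<lambda>r. exp (- lam * (r - t)) * l (y r) (\<alpha> r) r" and ?g = "\<lambda>r. l x (\<alpha> r) t"
    have "continuous_on {t..t + k} y"
      using continuous_on_subset[OF trajectory_continuous[OF a t(1)]] k h0 by auto
    from running_integrable[OF a(1) this t(1)] have f: "?f integrable_on {t..t + k}" using k h0 by auto
    have "continuous_on A (\<lambda>a. (\<lambda>(x, a, t). l x a t) (x, a, t))"
      using t by (intro continuous_on_compose2[OF l_cont] continuous_intros) auto
    then have g: "?g integrable_on {t..t + k}"
      using k h0 t by (intro integrable_in_control[OF a(1)]) auto
    have "running_cost \<alpha> y t (t + k) - integral {t..t + k} ?g = integral {t..t + k} (\<lambda>r. ?f r - ?g r)"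
      unfolding running_cost_def using f g by (simp add: Henstock_Kurzweil_Integration.integral_diff)
    also have "norm \<dots> \<le> integral {t..t + k} (\<lambda>_. e)"
    proof (rule integral_norm_bound_integral)
      show "(\<lambda>r. ?f r - ?g r) integrable_on {t..t + k}" using f g by (rule integrable_diff)
      fix r assume r: "r \<in> {t..t + k}"
      then have rT: "r \<in> {0..T}" "t \<in> {0..T}" "r - t \<le> h" using t k h0 by auto
      have ar: "\<alpha> r \<in> A" using control_values[OF a(1)] rT by auto
      have "norm (y r - y t) \<le> M * (r - t)" using trajectory_Lipschitz[OF a t(1)] r rT by auto
      also have "\<dots> \<le> (M + 1) * h" using r rT M_nonneg by (intro mult_mono) auto
      finally have near: "norm (y r - x) < min d 1" using h1 trajectory_start[OF a(2)] t by simp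
      have "r - t \<le> (M + 1) * h" using rT M_nonneg h0 by (intro order_trans[OF rT(3)]) (simp add: algebra_simps)
      then have "\<bar>r - t\<bar> < d" using r h1 by simp
      then have 1: "\<bar>l (y r) (\<alpha> r) r - l x (\<alpha> r) t\<bar> < e / 2"
        using near ar rT by (intro d(2)) (auto simp: dist_norm norm_minus_commute)
      have "\<bar>?f r - l (y r) (\<alpha> r) r\<bar> \<le> lam * (r - t) * K"
        using lam r l_bound[OF ar rT(1)] by (intro discount_error) auto
      also have "\<dots> \<le> lam * h * K" using lam rT K_nonneg by (intro mult_right_mono mult_left_mono) auto
      also have "\<dots> \<le> e / 2" using h2 h0 by (simp add: algebra_simps)
      finally show "norm (?f r - ?g r) \<le> e" using 1 unfolding real_norm_def by linarith
    qed auto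
    finally show "\<bar>running_cost \<alpha> y t (t + k) - integral {t..t + k} ?g\<bar> \<le> e * k" using k by (simp add: mult.commute)
  qed
qed

text \<open>
  Since \<open>|y(t + k) - x| \<le> M k\<close>, the remainder of the derivative of \<open>\<phi>\<close> at \<open>(x, t)\<close> is \<open>o(k)\<close>
  uniformly over all trajectories, and \<open>y(t + k) - x\<close> is the integral of the velocity, which the
  Lipschitz condition allows to be frozen at \<open>x\<close>.
\<close>
lemma test_function_expansion:
  assumes t: "0 \<le> t" "t < T" and e: "e > 0"
    and der: "((\<lambda>(x, t). \<phi> x t) has_derivative (\<lambda>(h, k). Dx \<bullet> h + Dt * k)) (at (x, t) within UNIV \<times> {0..T})"
  obtains h where "h > 0" "t + h \<le> T"
    "\<And>\<alpha> y k. \<alpha> \<in> controls A \<Longrightarrow> trajectory \<alpha> x t y \<Longrightarrow> 0 \<le> k \<Longrightarrow> k \<le> h \<Longrightarrow>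
       \<bar>\<phi> (y (t + k)) (t + k) - \<phi> x t - integral {t..t + k} (\<lambda>r. F x (\<alpha> r) \<bullet> Dx + Dt)\<bar> \<le> e * k"
proof -
  have M1: "M + 1 > 0" using M_nonneg by simp
  define e' where "e' = e / (2 * (M + 1))"
  have e': "e' > 0" using e M1 by (simp add: e'_def)
  from der[unfolded has_derivative_within_alt, THEN conjunct2, rule_format, OF e']
  obtain d where d: "d > 0" "\<forall>w\<in>UNIV \<times> {0..T}. norm (w - (x, t)) < d \<longrightarrow>
      norm ((\<lambda>(x, t). \<phi> x t) w - (\<lambda>(x, t). \<phi> x t) (x, t) - (\<lambda>(h, k). Dx \<bullet> h + Dt * k) (w - (x, t))) \<le> e' * norm (w - (x, t))"
    by blast
  define c where "c = norm Dx * (L * M)"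
  have c: "c \<ge> 0" using L M_nonneg by (simp add: c_def)
  define h where "h = min (T - t) (min (d / (2 * (M + 1))) (e / (2 * (c + 1))))"
  have c1: "c + 1 > 0" using c by simp
  have h0: "h > 0" "t + h \<le> T" using t d(1) e M1 c1 by (auto simp: h_def)
  have h1: "(M + 1) * h < d"
  proof -
    have "h \<le> d / (2 * (M + 1))" by (simp add: h_def)
    then have "(M + 1) * h \<le> d / 2" using M1 by (simp add: field_simps)
    then show ?thesis using d(1) by simp
  qed
  have "h \<le> e / (2 * (c + 1))" by (simp add: h_def)
  then have h2: "(c + 1) * h \<le> e / 2" using c1 by (simp add: field_simps)
  show ?thesis
  proof (rule that[OF h0])
    fix \<alpha> y k assume a: "\<alpha> \<in> controls A" "trajectory \<alpha> x t y" and k: "0 \<le> k" "k \<le> h"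
    have yt: "y t = x" using trajectory_start[OF a(2)] t by simp
    have lip: "norm (y r - x) \<le> M * (r - t)" if "r \<in> {t..t + k}" for r
      using trajectory_Lipschitz[OF a t(1), of t r] that k h0 by (simp add: yt)
    have i: "((\<lambda>r. F (y r) (\<alpha> r)) has_integral (y (t + k) - x)) {t..t + k}"
      using trajectory_has_integral[OF a(2), of t "t + k"] k h0 by (simp add: yt)
    from has_integral_linear[OF i bounded_linear_inner_left, of Dx]
    have i1: "((\<lambda>r. F (y r) (\<alpha> r) \<bullet> Dx) has_integral (Dx \<bullet> (y (t + k) - x))) {t..t + k}"
      by (simp add: o_def inner_commute)
    have "continuous_on A (\<lambda>a. (\<lambda>(x, a). F x a) (x, a) \<bullet> Dx)"
      by (intro continuous_intros continuous_on_compose2[OF F_cont]) auto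
    then have i2: "(\<lambda>r. F x (\<alpha> r) \<bullet> Dx) integrable_on {t..t + k}"
      using k h0 t by (intro integrable_in_control[OF a(1)]) auto
    have "Dx \<bullet> (y (t + k) - x) - integral {t..t + k} (\<lambda>r. F x (\<alpha> r) \<bullet> Dx)
        = integral {t..t + k} (\<lambda>r. F (y r) (\<alpha> r) \<bullet> Dx - F x (\<alpha> r) \<bullet> Dx)"
      using i1 i2 by (subst Henstock_Kurzweil_Integration.integral_diff) (auto simp: integral_unique)
    also have "norm \<dots> \<le> integral {t..t + k} (\<lambda>_. c * k)"
    proof (rule integral_norm_bound_integral)
      show "(\<lambda>r. F (y r) (\<alpha> r) \<bullet> Dx - F x (\<alpha> r) \<bullet> Dx) integrable_on {t..t + k}"
        using i1 i2 by (intro integrable_diff) auto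
      fix r assume r: "r \<in> {t..t + k}"
      have ar: "\<alpha> r \<in> A" using control_values[OF a(1)] r t by auto
      have "norm (F (y r) (\<alpha> r) - F x (\<alpha> r)) \<le> L * (M * (r - t))"
        using F_Lipschitz[OF ar, of "y r" x] lip[OF r] L by (smt (verit) mult_left_mono)
      also have "\<dots> \<le> L * (M * k)" using r L M_nonneg by (intro mult_left_mono) auto
      finally have "norm (F (y r) (\<alpha> r) - F x (\<alpha> r)) * norm Dx \<le> L * (M * k) * norm Dx" by (intro mult_right_mono) auto
      moreover have "\<bar>(F (y r) (\<alpha> r) - F x (\<alpha> r)) \<bullet> Dx\<bar> \<le> norm (F (y r) (\<alpha> r) - F x (\<alpha> r)) * norm Dx"
        by (rule Cauchy_Schwarz_ineq2)
      ultimately show "norm (F (y r) (\<alpha> r) \<bullet> Dx - F x (\<alpha> r) \<bullet> Dx) \<le> c * k"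
        by (simp add: inner_diff_left c_def mult_ac)
    qed auto
    also have "\<dots> = c * k * k" using k by simp
    also have "\<dots> \<le> e / 2 * k"
    proof (rule mult_right_mono)
      have "c * k \<le> (c + 1) * h" using c k by (intro mult_mono) auto
      then show "c * k \<le> e / 2" using h2 by simp
    qed (fact k)
    finally have 1: "\<bar>Dx \<bullet> (y (t + k) - x) - integral {t..t + k} (\<lambda>r. F x (\<alpha> r) \<bullet> Dx)\<bar> \<le> e / 2 * k" by simp
    let ?w = "(y (t + k), t + k)"
    have "norm (?w - (x, t)) \<le> norm (y (t + k) - x) + norm k" using norm_Pair_le[of "y (t + k) - x" k] by simp
    also have "\<dots> \<le> (M + 1) * k" using lip[of "t + k"] k by (simp add: algebra_simps)
    finally have w: "norm (?w - (x, t)) \<le> (M + 1) * k" .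
    also have "\<dots> \<le> (M + 1) * h" using k M1 by (intro mult_left_mono) auto
    finally have "norm (?w - (x, t)) < d" using h1 by simp
    with bspec[OF d(2), of ?w] k h0 t
    have "\<bar>\<phi> (y (t + k)) (t + k) - \<phi> x t - (Dx \<bullet> (y (t + k) - x) + Dt * k)\<bar> \<le> e' * norm (?w - (x, t))"
      by simp
    also have "\<dots> \<le> e' * ((M + 1) * k)" using w e' by (intro mult_left_mono) auto
    also have "\<dots> = e / 2 * k" using M1 by (simp add: e'_def field_simps)
    finally have 2: "\<bar>\<phi> (y (t + k)) (t + k) - \<phi> x t - (Dx \<bullet> (y (t + k) - x) + Dt * k)\<bar> \<le> e / 2 * k" .
    have "integral {t..t + k} (\<lambda>r. F x (\<alpha> r) \<bullet> Dx + Dt) = integral {t..t + k} (\<lambda>r. F x (\<alpha> r) \<bullet> Dx) + Dt * k"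
      using i2 k by (subst Henstock_Kurzweil_Integration.integral_add) auto
    moreover have "e * k = e / 2 * k + e / 2 * k" by simp
    ultimately show "\<bar>\<phi> (y (t + k)) (t + k) - \<phi> x t - integral {t..t + k} (\<lambda>r. F x (\<alpha> r) \<bullet> Dx + Dt)\<bar> \<le> e * k"
      using 1 2 by linarith
  qed
qed

text \<open>
  The common core of both viscosity inequalities, applied with \<open>c = W(x, t)\<close>: to first order in \<open>k\<close>,
  the excess of the cost over \<open>c\<close> is the integral of an expression in the control value whose negative
  has the differential part of the equation as its supremum over \<open>A\<close>.
\<close>
lemma dynamic_expansion:
  assumes t: "0 \<le> t" "t < T" and e: "e > 0"
    and der: "((\<lambda>(x, t). \<phi> x t) has_derivative (\<lambda>(h, k). Dx \<bullet> h + Dt * k)) (at (x, t) within UNIV \<times> {0..T})"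
  obtains h where "h > 0" "t + h \<le> T"
    "\<And>\<alpha> y k. \<alpha> \<in> controls A \<Longrightarrow> trajectory \<alpha> x t y \<Longrightarrow> 0 \<le> k \<Longrightarrow> k \<le> h \<Longrightarrow>
       \<bar>running_cost \<alpha> y t (t + k) + exp (- lam * k) * (c + (\<phi> (y (t + k)) (t + k) - \<phi> x t)) - c
         - integral {t..t + k} (\<lambda>r. l x (\<alpha> r) t + F x (\<alpha> r) \<bullet> Dx + Dt - lam * c)\<bar> \<le> e * k"
proof -
  have e3: "e / 3 > 0" using e by simp
  from running_cost_expansion[OF t e3, of x] obtain h1 where h1: "h1 > 0" "t + h1 \<le> T"
    "\<And>\<alpha> y k. \<alpha> \<in> controls A \<Longrightarrow> trajectory \<alpha> x t y \<Longrightarrow> 0 \<le> k \<Longrightarrow> k \<le> h1 \<Longrightarrow>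
       \<bar>running_cost \<alpha> y t (t + k) - integral {t..t + k} (\<lambda>r. l x (\<alpha> r) t)\<bar> \<le> e / 3 * k" by metis
  from test_function_expansion[OF t e3 der] obtain h2 where h2: "h2 > 0" "t + h2 \<le> T"
    "\<And>\<alpha> y k. \<alpha> \<in> controls A \<Longrightarrow> trajectory \<alpha> x t y \<Longrightarrow> 0 \<le> k \<Longrightarrow> k \<le> h2 \<Longrightarrow>
       \<bar>\<phi> (y (t + k)) (t + k) - \<phi> x t - integral {t..t + k} (\<lambda>r. F x (\<alpha> r) \<bullet> Dx + Dt)\<bar> \<le> e / 3 * k" by metis
  \<comment> \<open>The increment of \<open>\<phi>\<close> is at most \<open>B * k\<close>, so discounting it costs only a term of order \<open>k\<^sup>2\<close>.\<close>
  define B where "B = M * norm Dx + \<bar>Dt\<bar> + e / 3"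
  define D where "D = lam\<^sup>2 * \<bar>c\<bar> + lam * B"
  have D: "D \<ge> 0" using lam M_nonneg e by (simp add: D_def B_def)
  define h where "h = min (min h1 h2) (e / (3 * (D + 1)))"
  have h: "h > 0" "t + h \<le> T" using h1(1,2) h2(1,2) e D by (auto simp: h_def)
  have "h \<le> e / (3 * (D + 1))" by (simp add: h_def)
  then have hD: "(D + 1) * h \<le> e / 3" using D by (simp add: field_simps)
  show ?thesis
  proof (rule that[OF h])
    fix \<alpha> y k assume a: "\<alpha> \<in> controls A" "trajectory \<alpha> x t y" and k: "0 \<le> k" "k \<le> h"
    define \<Delta> where "\<Delta> = \<phi> (y (t + k)) (t + k) - \<phi> x t"
    have "continuous_on A (\<lambda>a. (\<lambda>(x, a). F x a) (x, a) \<bullet> Dx + Dt)"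
      by (intro continuous_intros continuous_on_compose2[OF F_cont]) auto
    then have i1: "(\<lambda>r. F x (\<alpha> r) \<bullet> Dx + Dt) integrable_on {t..t + k}"
      using k h t by (intro integrable_in_control[OF a(1)]) auto
    have "continuous_on A (\<lambda>a. (\<lambda>(x, a, t). l x a t) (x, a, t))"
      using t by (intro continuous_on_compose2[OF l_cont] continuous_intros) auto
    then have i2: "(\<lambda>r. l x (\<alpha> r) t) integrable_on {t..t + k}"
      using k h t by (intro integrable_in_control[OF a(1)]) auto
    have "norm (integral {t..t + k} (\<lambda>r. F x (\<alpha> r) \<bullet> Dx + Dt)) \<le> integral {t..t + k} (\<lambda>_. M * norm Dx + \<bar>Dt\<bar>)"
    proof (rule integral_norm_bound_integral[OF i1])
      fix r assume r: "r \<in> {t..t + k}"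
      have ar: "\<alpha> r \<in> A" using control_values[OF a(1)] r t by auto
      have "\<bar>F x (\<alpha> r) \<bullet> Dx\<bar> \<le> norm (F x (\<alpha> r)) * norm Dx" by (rule Cauchy_Schwarz_ineq2)
      also have "\<dots> \<le> M * norm Dx" using F_bound[OF ar] by (intro mult_right_mono) auto
      finally show "norm (F x (\<alpha> r) \<bullet> Dx + Dt) \<le> M * norm Dx + \<bar>Dt\<bar>" by simp
    qed auto
    then have "\<bar>integral {t..t + k} (\<lambda>r. F x (\<alpha> r) \<bullet> Dx + Dt)\<bar> \<le> (M * norm Dx + \<bar>Dt\<bar>) * k" using k by (simp add: mult.commute)
    moreover have 2: "\<bar>\<Delta> - integral {t..t + k} (\<lambda>r. F x (\<alpha> r) \<bullet> Dx + Dt)\<bar> \<le> e / 3 * k"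
      unfolding \<Delta>_def using k by (intro h2(3)[OF a]) (auto simp: h_def)
    ultimately have "\<bar>\<Delta>\<bar> \<le> (M * norm Dx + \<bar>Dt\<bar>) * k + e / 3 * k" by linarith
    then have "\<bar>\<Delta>\<bar> \<le> B * k" unfolding B_def distrib_right[of "M * norm Dx + \<bar>Dt\<bar>"] .
    from discount_expansion[OF lam k(1) this, of c]
    have "\<bar>exp (- lam * k) * (c + \<Delta>) - c - \<Delta> + lam * k * c\<bar> \<le> D * k * k" by (simp add: D_def)
    also have "\<dots> \<le> e / 3 * k"
    proof (rule mult_right_mono)
      have "D * k \<le> (D + 1) * h" using D k by (intro mult_mono) auto
      then show "D * k \<le> e / 3" using hD by simp
    qed (fact k)
    finally have 3: "\<bar>exp (- lam * k) * (c + \<Delta>) - c - \<Delta> + lam * k * c\<bar> \<le> e / 3 * k" .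
    have 1: "\<bar>running_cost \<alpha> y t (t + k) - integral {t..t + k} (\<lambda>r. l x (\<alpha> r) t)\<bar> \<le> e / 3 * k"
      using k by (intro h1(3)[OF a]) (auto simp: h_def)
    have "integral {t..t + k} (\<lambda>r. l x (\<alpha> r) t + F x (\<alpha> r) \<bullet> Dx + Dt - lam * c)
       = integral {t..t + k} (\<lambda>r. (l x (\<alpha> r) t + (F x (\<alpha> r) \<bullet> Dx + Dt)) - lam * c)"
      by (simp add: add.assoc)
    also have "\<dots> = integral {t..t + k} (\<lambda>r. l x (\<alpha> r) t) + integral {t..t + k} (\<lambda>r. F x (\<alpha> r) \<bullet> Dx + Dt) - lam * k * c"
      using i1 i2 k
      by (subst Henstock_Kurzweil_Integration.integral_diff integrable_add)+
         (auto simp: Henstock_Kurzweil_Integration.integral_add intro: integrable_add)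
    finally show "\<bar>running_cost \<alpha> y t (t + k) + exp (- lam * k) * (c + (\<phi> (y (t + k)) (t + k) - \<phi> x t)) - c
         - integral {t..t + k} (\<lambda>r. l x (\<alpha> r) t + F x (\<alpha> r) \<bullet> Dx + Dt - lam * c)\<bar> \<le> e * k"
      using 1 2 3 unfolding \<Delta>_def[symmetric] by linarith
  qed
qed

definition hamilton :: "real ^ 'd \<Rightarrow> real \<Rightarrow> real ^ 'd \<Rightarrow> real" where
  "hamilton x t \<xi> = (SUP a \<in> A. - (F x a \<bullet> \<xi>) - l x a t)"

lemma hamilton_upper:
  assumes "a \<in> A" "t \<in> {0..T}"
  shows "- (F x a \<bullet> \<xi>) - l x a t \<le> hamilton x t \<xi>"
proof -
  have "bdd_above ((\<lambda>a. - (F x a \<bullet> \<xi>) - l x a t) ` A)"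
  proof (rule bdd_aboveI2)
    fix a assume a: "a \<in> A"
    have "\<bar>F x a \<bullet> \<xi>\<bar> \<le> norm (F x a) * norm \<xi>" by (rule Cauchy_Schwarz_ineq2)
    also have "\<dots> \<le> M * norm \<xi>" using F_bound[OF a] by (intro mult_right_mono) auto
    finally show "- (F x a \<bullet> \<xi>) - l x a t \<le> M * norm \<xi> + K" using l_bound[OF a assms(2), of x] by linarith
  qed
  then show ?thesis unfolding hamilton_def using assms(1) by (rule cSUP_upper[rotated])
qed

lemma hamilton_least:
  assumes "\<And>a. a \<in> A \<Longrightarrow> - (F x a \<bullet> \<xi>) - l x a t \<le> c"
  shows "hamilton x t \<xi> \<le> c"
  unfolding hamilton_def using A(2) assms by (rule cSUP_least)

text \<open>
  Were the inequality violated, some constant control \<open>a\<close> would make this excess a negative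
  multiple \<open>q\<close> of the elapsed time, to first order. Following \<open>a\<close> for a short time would then cost less than \<open>W(x, t)\<close>, against dynamic
  programming.
\<close>
lemma stopping_value_subsolution:
  assumes t: "t \<in> {0..<T}" and der: "((\<lambda>(x, t). \<phi> x t) has_derivative (\<lambda>(h, k). Dx \<bullet> h + Dt * k)) (at (x, t) within UNIV \<times> {0..T})"
    and lmax: "local_max_at T (\<lambda>x t. stopping_value x t - \<phi> x t) x t"
  shows "max (stopping_value x t - \<psi> x t) (- Dt + lam * stopping_value x t + hamilton x t Dx) \<le> 0"
proof -
  have t': "0 \<le> t" "t < T" using t by auto
  let ?c = "stopping_value x t"
  have "- (F x a \<bullet> Dx) - l x a t \<le> Dt - lam * ?c" if a: "a \<in> A" for a
  proof (rule ccontr)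
    define q where "q = l x a t + F x a \<bullet> Dx + Dt - lam * ?c"
    assume "\<not> ?thesis"
    then have q: "q < 0" by (simp add: q_def)
    then have "- q / 2 > 0" by simp
    then obtain h where h: "h > 0" "t + h \<le> T"
      "\<And>\<alpha> y k. \<alpha> \<in> controls A \<Longrightarrow> trajectory \<alpha> x t y \<Longrightarrow> 0 \<le> k \<Longrightarrow> k \<le> h \<Longrightarrow>
       \<bar>running_cost \<alpha> y t (t + k) + exp (- lam * k) * (?c + (\<phi> (y (t + k)) (t + k) - \<phi> x t)) - ?c
         - integral {t..t + k} (\<lambda>r. l x (\<alpha> r) t + F x (\<alpha> r) \<bullet> Dx + Dt - lam * ?c)\<bar> \<le> - q / 2 * k"
      by (rule dynamic_expansion[OF t' _ der, of _ ?c]) blast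
    from lmax obtain r where r0: "r > 0" and
      rb: "\<forall>(z, s)\<in>ball (x, t) r \<inter> (UNIV \<times> {0..<T}). stopping_value z s - \<phi> z s \<le> ?c - \<phi> x t"
      unfolding local_max_at_def by blast
    have r: "stopping_value z s - \<phi> z s \<le> ?c - \<phi> x t" if "(z, s) \<in> ball (x, t) r" "s \<in> {0..<T}" for z s
      using bspec[OF rb, of "(z, s)"] that by auto
    have M1: "M + 1 > 0" using M_nonneg by simp
    define k where "k = min (h / 2) (r / (4 * (M + 1)))"
    have "k > 0" using h(1) r0 M1 by (simp add: k_def)
    moreover have "k \<le> h / 2" unfolding k_def by (rule min.cobounded1)
    ultimately have k: "k > 0" "k \<le> h" "t + k < T" using h(1,2) by auto
    have "k \<le> r / (4 * (M + 1))" by (simp add: k_def)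
    then have "(M + 1) * k \<le> r / 4" using M1 by (simp add: field_simps)
    then have kr: "(M + 1) * k < r / 2" using r0 by simp
    have ca: "(\<lambda>_. a) \<in> controls A" using a by (rule constant_control)
    obtain y where y: "trajectory (\<lambda>_. a) x t y" by (rule trajectory_exists[OF ca t'(1)]) (use t' in auto)
    have "norm (y (t + k) - x) \<le> M * k"
      using trajectory_Lipschitz[OF ca y t'(1), of t "t + k"] k trajectory_start[OF y] t' by simp
    also have "\<dots> \<le> (M + 1) * k" using k by simp
    finally have 1: "norm (y (t + k) - x) < r / 2" using kr by simp
    have "k \<le> (M + 1) * k" using M_nonneg k by simp
    then have "k < r / 2" using kr by linarith
    then have 2: "\<bar>(t + k) - t\<bar> < r / 2" using k by simp
    have W: "stopping_value (y (t + k)) (t + k) \<le> ?c + (\<phi> (y (t + k)) (t + k) - \<phi> x t)"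
      using r[OF Pair_in_ballI[OF 1 2]] k t' by auto
    have "?c \<le> running_cost (\<lambda>_. a) y t (t + k) + exp (- lam * k) * stopping_value (y (t + k)) (t + k)"
      using stopping_value_le_running_plus_value[OF ca y t'(1), of "t + k"] k by simp
    also have "\<dots> \<le> running_cost (\<lambda>_. a) y t (t + k) + exp (- lam * k) * (?c + (\<phi> (y (t + k)) (t + k) - \<phi> x t))"
      using W by simp
    also have "\<dots> \<le> ?c + q * k + - q / 2 * k"
      using h(3)[OF ca y less_imp_le[OF k(1)] k(2)] k by (simp add: q_def[symmetric] mult.commute)
    finally have "0 \<le> q * k" by (simp add: mult.commute)
    then show False using q k by (simp add: zero_le_mult_iff)
  qed
  from hamilton_least[OF this] have "hamilton x t Dx \<le> Dt - lam * ?c" .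
  then show ?thesis using stopping_value_le_obstacle[of t x] t' by simp
qed

text \<open>
  If the inequality fails by \<open>\<theta>\<close> and \<open>\<psi>\<close> exceeds \<open>W\<close> by \<open>3 \<eta>\<close> at \<open>(x, t)\<close>, a strategy running up to
  \<open>t + h\<close> loses at least \<open>\<theta> h / 2\<close>, and one stopping earlier loses at least \<open>exp (- \<lambda> h) \<eta>\<close>. Neither
  bound depends on the strategy, so the infimum of all costs would exceed \<open>W(x, t)\<close>.
\<close>
lemma stopping_value_supersolution:
  assumes t: "t \<in> {0..<T}" and der: "((\<lambda>(x, t). \<phi> x t) has_derivative (\<lambda>(h, k). Dx \<bullet> h + Dt * k)) (at (x, t) within UNIV \<times> {0..T})"
    and lmin: "local_min_at T (\<lambda>x t. stopping_value x t - \<phi> x t) x t"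
  shows "max (stopping_value x t - \<psi> x t) (- Dt + lam * stopping_value x t + hamilton x t Dx) \<ge> 0"
proof (rule ccontr)
  have t': "0 \<le> t" "t < T" using t by auto
  let ?c = "stopping_value x t"
  define \<theta> where "\<theta> = - (- Dt + lam * ?c + hamilton x t Dx)"
  define \<eta> where "\<eta> = (\<psi> x t - ?c) / 3"
  assume "\<not> ?thesis"
  then have pos: "\<theta> > 0" "\<eta> > 0" by (auto simp: \<theta>_def \<eta>_def)
  have Q: "l x a t + F x a \<bullet> Dx + Dt - lam * ?c \<ge> \<theta>" if "a \<in> A" for a
    using hamilton_upper[OF that, of t x Dx] t' by (simp add: \<theta>_def)
  from pos have "\<theta> / 2 > 0" by simp
  then obtain h0 where h0: "h0 > 0" "t + h0 \<le> T"
    "\<And>\<alpha> y k. \<alpha> \<in> controls A \<Longrightarrow> trajectory \<alpha> x t y \<Longrightarrow> 0 \<le> k \<Longrightarrow> k \<le> h0 \<Longrightarrow>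
     \<bar>running_cost \<alpha> y t (t + k) + exp (- lam * k) * (?c + (\<phi> (y (t + k)) (t + k) - \<phi> x t)) - ?c
       - integral {t..t + k} (\<lambda>r. l x (\<alpha> r) t + F x (\<alpha> r) \<bullet> Dx + Dt - lam * ?c)\<bar> \<le> \<theta> / 2 * k"
    by (rule dynamic_expansion[OF t' _ der, of _ ?c]) blast
  from lmin obtain r where r0: "r > 0" and
    rb: "\<forall>(z, s)\<in>ball (x, t) r \<inter> (UNIV \<times> {0..<T}). ?c - \<phi> x t \<le> stopping_value z s - \<phi> z s"
    unfolding local_min_at_def by blast
  have r: "?c - \<phi> x t \<le> stopping_value z s - \<phi> z s" if "(z, s) \<in> ball (x, t) r" "s \<in> {0..<T}" for z s
    using bspec[OF rb, of "(z, s)"] that by auto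
  from \<psi>_unif_cont[unfolded uniformly_continuous_on_strip_iff, rule_format, OF pos(2)] obtain d1 where d1: "d1 > 0"
    "\<And>x y s t. s \<in> {0..T} \<Longrightarrow> t \<in> {0..T} \<Longrightarrow> norm (x - y) < d1 \<Longrightarrow> \<bar>s - t\<bar> < d1 \<Longrightarrow> \<bar>\<psi> x s - \<psi> y t\<bar> < \<eta>" by auto
  from stopping_value_uniformly_continuous[unfolded uniformly_continuous_on_strip_iff, rule_format, OF pos(2)] obtain d2 where d2: "d2 > 0"
    "\<And>x y s t. s \<in> {0..T} \<Longrightarrow> t \<in> {0..T} \<Longrightarrow> norm (x - y) < d2 \<Longrightarrow> \<bar>s - t\<bar> < d2 \<Longrightarrow> \<bar>stopping_value x s - stopping_value y t\<bar> < \<eta>" by auto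
  have M1: "M + 1 > 0" using M_nonneg by simp
  define \<rho> where "\<rho> = min (r / 2) (min d1 d2)"
  have \<rho>: "\<rho> > 0" using r0 d1(1) d2(1) by (simp add: \<rho>_def)
  define h where "h = min (h0 / 2) (\<rho> / (2 * (M + 1)))"
  have "h > 0" using h0(1) \<rho> M1 by (simp add: h_def)
  moreover have "h \<le> h0 / 2" unfolding h_def by (rule min.cobounded1)
  ultimately have h: "h > 0" "h \<le> h0" "t + h < T" using h0(1,2) by auto
  have "h \<le> \<rho> / (2 * (M + 1))" by (simp add: h_def)
  then have "(M + 1) * h \<le> \<rho> / 2" using M1 by (simp add: field_simps)
  then have h\<rho>: "(M + 1) * h < \<rho>" using \<rho> by simp
  have near: "norm (y (t + k) - x) < \<rho> \<and> \<bar>(t + k) - t\<bar> < \<rho>"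
    if "\<alpha> \<in> controls A" "trajectory \<alpha> x t y" "0 \<le> k" "k \<le> h" for \<alpha> y k
  proof -
    have "norm (y (t + k) - x) \<le> M * k"
      using trajectory_Lipschitz[OF that(1,2) t'(1), of t "t + k"] that h trajectory_start[OF that(2)] t' by simp
    also have "\<dots> \<le> (M + 1) * h" using that M_nonneg by (intro mult_mono) auto
    finally have 1: "norm (y (t + k) - x) < \<rho>" using h\<rho> by simp
    have "k \<le> h" by fact
    also have "\<dots> \<le> (M + 1) * h" using M_nonneg h by simp
    finally show ?thesis using 1 h\<rho> that by simp
  qed
  have grow: "running_cost \<alpha> y t (t + k) + exp (- lam * k) * stopping_value (y (t + k)) (t + k) \<ge> ?c + \<theta> / 2 * k"
    if a: "\<alpha> \<in> controls A" "trajectory \<alpha> x t y" and k: "0 \<le> k" "k \<le> h" for \<alpha> y k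
  proof -
    let ?Q = "\<lambda>r. l x (\<alpha> r) t + F x (\<alpha> r) \<bullet> Dx + Dt - lam * ?c"
    have "continuous_on A (\<lambda>a. (\<lambda>(x, a, t). l x a t) (x, a, t) + (\<lambda>(x, a). F x a) (x, a) \<bullet> Dx + Dt - lam * ?c)"
      using t' by (intro continuous_intros continuous_on_compose2[OF F_cont] continuous_on_compose2[OF l_cont]) auto
    then have i: "?Q integrable_on {t..t + k}"
      using k h t' by (intro integrable_in_control[OF a(1)]) auto
    have "integral {t..t + k} (\<lambda>_. \<theta>) \<le> integral {t..t + k} ?Q"
      using i Q control_values[OF a(1)] t' by (intro integral_le) auto
    then have "\<theta> * k \<le> integral {t..t + k} ?Q" using k by (simp add: mult.commute)
    moreover have "(y (t + k), t + k) \<in> ball (x, t) r"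
      using near[OF a k] by (intro Pair_in_ballI) (auto simp: \<rho>_def)
    from r[OF this] have "?c + (\<phi> (y (t + k)) (t + k) - \<phi> x t) \<le> stopping_value (y (t + k)) (t + k)"
      using k h t' by simp
    then have "exp (- lam * k) * (?c + (\<phi> (y (t + k)) (t + k) - \<phi> x t)) \<le> exp (- lam * k) * stopping_value (y (t + k)) (t + k)"
      by (intro mult_left_mono) auto
    moreover have "k \<le> h0" using k h(2) by simp
    moreover have "\<theta> * k = \<theta> / 2 * k + \<theta> / 2 * k" by simp
    ultimately show ?thesis using h0(3)[OF a k(1)] by linarith
  qed
  define g where "g = min (\<theta> / 2 * h) (exp (- lam * h) * \<eta>)"
  have g: "g > 0" using pos h by (simp add: g_def)
  have "?c + g \<le> ?c"
  proof (rule le_stopping_value)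
    fix \<alpha> y \<tau> assume st: "(\<alpha>, y, \<tau>) \<in> strategies x t"
    then have a: "\<alpha> \<in> controls A" "trajectory \<alpha> x t y" "t \<le> \<tau>" "\<tau> \<le> T" by (auto simp: strategies_def)
    show "?c + g \<le> cost \<alpha> y t \<tau>"
    proof (cases "t + h \<le> \<tau>")
      case True
      have "?c + \<theta> / 2 * h \<le> cost \<alpha> y t \<tau>"
        using running_plus_value_le_cost[OF st t'(1) _ True] grow[OF a(1,2) _ order_refl] h by simp
      then show ?thesis by (simp add: g_def min_le_iff_disj min_def split: if_splits)
    next
      case False
      define k where "k = \<tau> - t"
      have k: "0 \<le> k" "k \<le> h" "\<tau> = t + k" using a False by (auto simp: k_def)
      note n = near[OF a(1,2) k(1,2)]
      have "\<bar>\<psi> (y \<tau>) \<tau> - \<psi> x t\<bar> < \<eta>" "\<bar>stopping_value (y \<tau>) \<tau> - ?c\<bar> < \<eta>"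
        using n a t' by (auto intro!: d1(2) d2(2) simp: k(3)[symmetric] \<rho>_def)
      moreover have "\<psi> x t = ?c + 3 * \<eta>" by (simp add: \<eta>_def field_simps)
      ultimately have "stopping_value (y \<tau>) \<tau> + \<eta> \<le> \<psi> (y \<tau>) \<tau>" by linarith
      then have "exp (- lam * k) * (stopping_value (y \<tau>) \<tau> + \<eta>) \<le> exp (- lam * k) * \<psi> (y \<tau>) \<tau>"
        by (intro mult_left_mono) auto
      moreover have "exp (- lam * h) * \<eta> \<le> exp (- lam * k) * \<eta>"
        using k lam pos by (intro mult_right_mono) (auto intro: mult_left_mono)
      moreover have "\<theta> / 2 * k \<ge> 0" using pos k by simp
      ultimately have "?c + exp (- lam * h) * \<eta> \<le> cost \<alpha> y t \<tau>"
        using grow[OF a(1,2) k(1,2)] unfolding cost_def k(3) by (simp add: algebra_simps)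
      then show ?thesis by (simp add: g_def min_def split: if_splits)
    qed
  qed (use t' in auto)
  with g show False by simp
qed

text \<open>The existence half of the result for a single stopping problem.\<close>
theorem stopping_value_buc_viscosity_solution:
  "buc_viscosity_solution lam T \<psi> hamilton stopping_value"
  unfolding buc_viscosity_solution_def viscosity_solution_def
proof (intro conjI allI impI ballI)
  show "bounded ((\<lambda>(x, t). stopping_value x t) ` (UNIV \<times> {0..T}))"
    unfolding bounded_iff using stopping_value_bound by (intro exI[of _ "K * T + K"]) auto
  show uc: "uniformly_continuous_on (UNIV \<times> {0..T}) (\<lambda>(x, t). stopping_value x t)"
    by (rule stopping_value_uniformly_continuous)
  show "continuous_on (UNIV \<times> {0..T}) (\<lambda>(x, t). stopping_value x t)"
    using uc by (rule uniformly_continuous_imp_continuous)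
  show "stopping_value x T = \<psi> x T" for x by (rule stopping_value_terminal)
next
  fix \<phi> Dt :: "real ^ 'd \<Rightarrow> real \<Rightarrow> real" and Dx x t
  assume "C1_on_strip T \<phi> Dx Dt" and t: "t \<in> {0..<T}"
  then have der: "((\<lambda>(x, t). \<phi> x t) has_derivative (\<lambda>(h, k). Dx x t \<bullet> h + Dt x t * k)) (at (x, t) within UNIV \<times> {0..T})"
    unfolding C1_on_strip_def by auto
  show "max (stopping_value x t - \<psi> x t) (- Dt x t + lam * stopping_value x t + hamilton x t (Dx x t)) \<le> 0"
    if "local_max_at T (\<lambda>x t. stopping_value x t - \<phi> x t) x t"
    using t der that by (rule stopping_value_subsolution)
  show "max (stopping_value x t - \<psi> x t) (- Dt x t + lam * stopping_value x t + hamilton x t (Dx x t)) \<ge> 0"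
    if "local_min_at T (\<lambda>x t. stopping_value x t - \<phi> x t) x t"
    using t der that by (rule stopping_value_supersolution)
qed

end

section \<open>Comparison of solutions by doubling the variables\<close>

text \<open>
  With the other pair of variables fixed, the penalization in the doubling argument has this form
  for both solutions.
\<close>
lemma C1_on_strip_quadratic:
  "C1_on_strip T (\<lambda>x t. k / 2 * ((norm (x - y))\<^sup>2 + (t - s)\<^sup>2) + d * (norm x)\<^sup>2 + c * t)
     (\<lambda>x t. k *\<^sub>R (x - y) + (2 * d) *\<^sub>R x) (\<lambda>x t. k * (t - s) + c)"
  unfolding C1_on_strip_def
proof (intro conjI allI ballI)
  show "continuous_on (UNIV \<times> {0..T}) (\<lambda>(x, t). k *\<^sub>R (x - y) + (2 * d) *\<^sub>R x)"
    "continuous_on (UNIV \<times> {0..T}) (\<lambda>(x, t). k * (t - s) + c)"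
    by (auto simp: case_prod_unfold intro!: continuous_intros)
  fix x t
  show "((\<lambda>(x, t). k / 2 * ((norm (x - y))\<^sup>2 + (t - s)\<^sup>2) + d * (norm x)\<^sup>2 + c * t) has_derivative
          (\<lambda>(h, r). (k *\<^sub>R (x - y) + (2 * d) *\<^sub>R x) \<bullet> h + (k * (t - s) + c) * r)) (at (x, t) within UNIV \<times> {0..T})"
    unfolding case_prod_unfold power2_norm_eq_inner
    by (rule derivative_eq_intros refl | simp)+
       (auto simp: fun_eq_iff inner_simps inner_commute field_simps)
qed

context stopping_problem
begin

text \<open>
  The error \<open>L |x - y| |\<xi>|\<close> is harmless although \<open>\<xi> = \<kappa> (x - y)\<close> is unbounded as \<open>\<kappa>\<close> grows: it is
  \<open>L\<close> times twice the spatial penalization, which tends to zero at the maximum points.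
\<close>
lemma hamilton_difference:
  assumes t: "t \<in> {0..T}" and l: "\<And>a. a \<in> A \<Longrightarrow> \<bar>l x a t - l y a s\<bar> \<le> e"
  shows "hamilton y s \<xi> \<le> hamilton x t (\<xi> + \<zeta>) + (L * norm (x - y) * norm \<xi> + M * norm \<zeta> + e)"
proof (rule hamilton_least)
  fix a assume a: "a \<in> A"
  have "\<bar>(F x a - F y a) \<bullet> \<xi>\<bar> \<le> norm (F x a - F y a) * norm \<xi>" by (rule Cauchy_Schwarz_ineq2)
  also have "\<dots> \<le> L * norm (x - y) * norm \<xi>" using F_Lipschitz[OF a] by (intro mult_right_mono) auto
  finally have 1: "\<bar>(F x a - F y a) \<bullet> \<xi>\<bar> \<le> L * norm (x - y) * norm \<xi>" .
  have "\<bar>F x a \<bullet> \<zeta>\<bar> \<le> norm (F x a) * norm \<zeta>" by (rule Cauchy_Schwarz_ineq2)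
  also have "\<dots> \<le> M * norm \<zeta>" using F_bound[OF a] by (intro mult_right_mono) auto
  finally have 2: "\<bar>F x a \<bullet> \<zeta>\<bar> \<le> M * norm \<zeta>" .
  have "F x a \<bullet> (\<xi> + \<zeta>) = F y a \<bullet> \<xi> + (F x a - F y a) \<bullet> \<xi> + F x a \<bullet> \<zeta>"
    by (simp add: inner_simps)
  then show "- (F y a \<bullet> \<xi>) - l y a s \<le> hamilton x t (\<xi> + \<zeta>) + (L * norm (x - y) * norm \<xi> + M * norm \<zeta> + e)"
    using hamilton_upper[OF a t, of x "\<xi> + \<zeta>"] 1 2 l[OF a] by linarith
qed

text \<open>
  The penalizations make \<open>\<Phi>\<close> negative outside a compact set: far out in \<open>x\<close> because of the term in
  \<open>\<delta>\<close>, and for \<open>|x - y| \<ge> 1\<close> because \<open>\<kappa> / 2\<close> exceeds the oscillation \<open>2 B\<close> of \<open>u - v\<close>. The bound on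
  the maximum point does not involve \<open>\<kappa>\<close>, so the compact set on which the running cost has to be
  uniformly continuous in time can be fixed before \<open>\<kappa>\<close> is chosen.
\<close>
lemma doubling_maximum:
  fixes u v :: "real ^ 'd \<Rightarrow> real \<Rightarrow> real"
  assumes cu: "continuous_on (UNIV \<times> {0..T}) (\<lambda>(x, t). u x t)" and cv: "continuous_on (UNIV \<times> {0..T}) (\<lambda>(x, t). v x t)"
    and bu: "\<forall>x. \<forall>t\<in>{0..T}. \<bar>u x t\<bar> \<le> B" and bv: "\<forall>x. \<forall>t\<in>{0..T}. \<bar>v x t\<bar> \<le> B"
    and pos: "\<kappa> > 4 * B" "\<delta> > 0" "\<eta> \<ge> 0" "B > 0"
    and \<Phi>_def: "\<And>x t y s. \<Phi> x t y s = u x t - v y s - \<kappa> / 2 * ((norm (x - y))\<^sup>2 + (t - s)\<^sup>2) - \<delta> * (norm x)\<^sup>2 - \<eta> * (T - t)"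
    and start: "t0 \<in> {0..T}" "\<Phi> x0 t0 x0 t0 > 0"
  obtains x t y s where "t \<in> {0..T}" "s \<in> {0..T}"
    "\<And>x' t' y' s'. t' \<in> {0..T} \<Longrightarrow> s' \<in> {0..T} \<Longrightarrow> \<Phi> x' t' y' s' \<le> \<Phi> x t y s"
    "norm x \<le> sqrt (2 * B / \<delta>)" "norm y \<le> sqrt (2 * B / \<delta>) + 1"
proof -
  define R where "R = sqrt (2 * B / \<delta>)"
  have R: "R \<ge> 0" "\<delta> * R\<^sup>2 = 2 * B" using pos by (auto simp: R_def)
  define Z where "Z = cball (0 :: real ^ 'd) R \<times> {0..T} \<times> cball (0 :: real ^ 'd) (R + 1) \<times> {0..T}"
  have bounded_above: "\<Phi> x t y s \<le> 2 * B - \<kappa> / 2 * (norm (x - y))\<^sup>2 - \<delta> * (norm x)\<^sup>2" if "t \<in> {0..T}" "s \<in> {0..T}" for x t y s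
  proof -
    have "0 \<le> \<eta> * (T - t)" "0 \<le> \<kappa> / 2 * (t - s)\<^sup>2" using that pos by auto
    moreover have "\<Phi> x t y s = u x t - v y s - \<kappa> / 2 * (norm (x - y))\<^sup>2 - \<kappa> / 2 * (t - s)\<^sup>2 - \<delta> * (norm x)\<^sup>2 - \<eta> * (T - t)"
      unfolding \<Phi>_def by (simp add: distrib_left)
    moreover have "\<bar>u x t\<bar> \<le> B" "\<bar>v y s\<bar> \<le> B" using bu bv that by auto
    ultimately show ?thesis by linarith
  qed
  have outside: "\<Phi> x t y s < 0" if "t \<in> {0..T}" "s \<in> {0..T}" "(x, t, y, s) \<notin> Z" for x t y s
  proof (cases "norm x \<le> R")
    case False
    then have "R\<^sup>2 < (norm x)\<^sup>2" using R by (intro power_strict_mono) auto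
    then have "\<delta> * R\<^sup>2 < \<delta> * (norm x)\<^sup>2" using pos by simp
    moreover have "0 \<le> \<kappa> / 2 * (norm (x - y))\<^sup>2" using pos by auto
    ultimately show ?thesis using bounded_above[OF that(1,2), of x y] R(2) by linarith
  next
    case True
    then have "norm y > R + 1" using that by (auto simp: Z_def)
    then have "1 \<le> norm (x - y)" using True norm_triangle_ineq2[of y x] by (simp add: norm_minus_commute)
    then have "1 \<le> (norm (x - y))\<^sup>2" by simp
    then have "\<kappa> / 2 * 1 \<le> \<kappa> / 2 * (norm (x - y))\<^sup>2" using pos by (intro mult_left_mono) auto
    moreover have "0 \<le> \<delta> * (norm x)\<^sup>2" using pos by simp
    ultimately show ?thesis using bounded_above[OF that(1,2), of x y] pos(1) by linarith
  qed
  have "compact Z" unfolding Z_def by (intro compact_Times compact_cball compact_Icc)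
  moreover have z0: "(x0, t0, x0, t0) \<in> Z" using outside[OF start(1,1), of x0 x0] start by force
  moreover have "continuous_on Z (\<lambda>(x, t, y, s). \<Phi> x t y s)"
  proof -
    have "continuous_on Z (\<lambda>z. (\<lambda>(x, t). u x t) (fst z, fst (snd z)))"
      by (rule continuous_on_compose2[OF cu]) (auto simp: Z_def intro!: continuous_intros)
    moreover have "continuous_on Z (\<lambda>z. (\<lambda>(x, t). v x t) (fst (snd (snd z)), snd (snd (snd z))))"
      by (rule continuous_on_compose2[OF cv]) (auto simp: Z_def intro!: continuous_intros)
    ultimately show ?thesis
      unfolding \<Phi>_def case_prod_unfold fst_conv snd_conv by (intro continuous_intros)
  qed
  ultimately obtain z where z: "z \<in> Z" "\<And>w. w \<in> Z \<Longrightarrow> (\<lambda>(x, t, y, s). \<Phi> x t y s) w \<le> (\<lambda>(x, t, y, s). \<Phi> x t y s) z"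
    using continuous_attains_sup[of Z "\<lambda>(x, t, y, s). \<Phi> x t y s"] by blast
  obtain x t y s where xyz: "z = (x, t, y, s)" by (cases z) auto
  show ?thesis
  proof (rule that)
    show "t \<in> {0..T}" "s \<in> {0..T}" "norm x \<le> sqrt (2 * B / \<delta>)" "norm y \<le> sqrt (2 * B / \<delta>) + 1"
      using z(1) unfolding xyz Z_def R_def by auto
    show "\<Phi> x' t' y' s' \<le> \<Phi> x t y s" if "t' \<in> {0..T}" "s' \<in> {0..T}" for x' t' y' s'
    proof (cases "(x', t', y', s') \<in> Z")
      case True
      from z(2)[OF this] show ?thesis by (simp add: xyz)
    next
      case False
      from z(2)[OF z0] outside[OF that False] start(2) show ?thesis by (simp add: xyz)
    qed
  qed
qed

text \<open>
  Suppose \<open>u - v = \<sigma> > 0\<close> somewhere. The parameters are chosen in the order \<open>\<eta>\<close>, \<open>\<delta>\<close>, \<open>e\<close>, \<open>\<kappa>\<close>, so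
  that the maximum of the doubled function still has \<open>u(x, t) - v(y, s) \<ge> \<sigma> / 2\<close>. Near the diagonal
  this excludes \<open>t = T\<close> and \<open>s = T\<close>, where \<open>u\<close> or \<open>v\<close> equals \<open>\<psi>\<close> and hence the other solution, and it
  excludes \<open>v \<ge> \<psi>\<close>, because \<open>u \<le> \<psi>\<close>. The two remaining inequalities for the Hamiltonian are
  incompatible, as all their errors together are smaller than \<open>\<eta>\<close>.
\<close>
lemma viscosity_comparison:
  assumes u: "buc_viscosity_solution lam T \<psi> hamilton u" and v: "buc_viscosity_solution lam T \<psi> hamilton v"
    and t0: "t0 \<in> {0..T}"
  shows "u x0 t0 \<le> v x0 t0"
proof (rule ccontr)
  assume not_le: "\<not> ?thesis"
  define \<sigma> where "\<sigma> = u x0 t0 - v x0 t0"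
  have \<sigma>: "\<sigma> > 0" using not_le by (simp add: \<sigma>_def)
  have "\<exists>B>0. \<forall>x. \<forall>t\<in>{0..T}. \<bar>w x t\<bar> \<le> B" if "buc_viscosity_solution lam T \<psi> hamilton w" for w
  proof -
    from that have "bounded ((\<lambda>(x, t). w x t) ` (UNIV \<times> {0..T}))" by (simp add: buc_viscosity_solution_def)
    then obtain b where "b > 0" "\<forall>z\<in>(\<lambda>(x, t). w x t) ` (UNIV \<times> {0..T}). norm z \<le> b" unfolding bounded_pos by blast
    then show ?thesis by (intro exI[of _ b]) auto
  qed
  from this[OF u] this[OF v] obtain Bu Bv where
    "Bu > 0" "\<forall>x. \<forall>t\<in>{0..T}. \<bar>u x t\<bar> \<le> Bu" "Bv > 0" "\<forall>x. \<forall>t\<in>{0..T}. \<bar>v x t\<bar> \<le> Bv" by blast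
  moreover define B where "B = max Bu Bv"
  ultimately have B: "B > 0" and bu: "\<forall>x. \<forall>t\<in>{0..T}. \<bar>u x t\<bar> \<le> B" and bv: "\<forall>x. \<forall>t\<in>{0..T}. \<bar>v x t\<bar> \<le> B"
    by (auto simp: le_max_iff_disj)
  have cu: "continuous_on (UNIV \<times> {0..T}) (\<lambda>(x, t). u x t)" and cv: "continuous_on (UNIV \<times> {0..T}) (\<lambda>(x, t). v x t)"
    and terminal: "\<And>x. u x T = \<psi> x T" "\<And>x. v x T = \<psi> x T"
    using u v by (auto simp: buc_viscosity_solution_def viscosity_solution_def)
  define \<eta> where "\<eta> = \<sigma> / (4 * T)"
  have \<eta>: "\<eta> > 0" "\<eta> * T = \<sigma> / 4" using \<sigma> T by (auto simp: \<eta>_def)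
  define \<delta> where "\<delta> = min (\<sigma> / (4 * ((norm x0)\<^sup>2 + 1))) ((\<eta> / (4 * (M + 1)))\<^sup>2 / (8 * B))"
  have M1: "M + 1 > 0" using M_nonneg by simp
  have x01: "(norm x0)\<^sup>2 + 1 > 0" by (simp add: add_nonneg_pos)
  have \<delta>: "\<delta> > 0" using \<sigma> B \<eta>(1) M1 x01 by (simp add: \<delta>_def)
  have \<delta>1: "\<delta> * (norm x0)\<^sup>2 \<le> \<sigma> / 4"
  proof -
    have "\<delta> * (norm x0)\<^sup>2 \<le> \<delta> * ((norm x0)\<^sup>2 + 1)" using \<delta> by simp
    also have "\<dots> \<le> \<sigma> / (4 * ((norm x0)\<^sup>2 + 1)) * ((norm x0)\<^sup>2 + 1)"
      by (rule mult_right_mono) (auto simp: \<delta>_def)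
    also have "\<dots> = \<sigma> / 4" using x01 by (simp add: field_simps)
    finally show ?thesis .
  qed
  \<comment> \<open>At the maximum \<open>\<delta> * |x|\<^sup>2 \<le> 2 * B\<close>, so this bounds the extra gradient \<open>2 * \<delta> * x\<close> by
     \<open>\<eta> / (4 * (M + 1))\<close>.\<close>
  have \<delta>2: "8 * B * \<delta> \<le> (\<eta> / (4 * (M + 1)))\<^sup>2"
  proof -
    have "8 * B * \<delta> \<le> 8 * B * ((\<eta> / (4 * (M + 1)))\<^sup>2 / (8 * B))"
      unfolding \<delta>_def using B by (intro mult_left_mono) auto
    then show ?thesis using B by simp
  qed
  define e where "e = min (\<sigma> / 4) (\<eta> / (8 * (L + 1)))"
  have e: "e > 0" using \<sigma> \<eta>(1) L by (simp add: e_def)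
  have e1: "e \<le> \<sigma> / 4" unfolding e_def by (rule min.cobounded1)
  have "e \<le> \<eta> / (8 * (L + 1))" by (simp add: e_def)
  then have eL: "(L + 1) * e \<le> \<eta> / 8" using L by (simp add: field_simps)
  obtain du where du: "du > 0" "\<And>x y s t. s \<in> {0..T} \<Longrightarrow> t \<in> {0..T} \<Longrightarrow> norm (x - y) < du \<Longrightarrow> \<bar>s - t\<bar> < du \<Longrightarrow> \<bar>u x s - u y t\<bar> < e"
    using u e unfolding buc_viscosity_solution_def uniformly_continuous_on_strip_iff by metis
  obtain dv where dv: "dv > 0" "\<And>x y s t. s \<in> {0..T} \<Longrightarrow> t \<in> {0..T} \<Longrightarrow> norm (x - y) < dv \<Longrightarrow> \<bar>s - t\<bar> < dv \<Longrightarrow> \<bar>v x s - v y t\<bar> < e"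
    using v e unfolding buc_viscosity_solution_def uniformly_continuous_on_strip_iff by metis
  obtain dp where dp: "dp > 0" "\<And>x y s t. s \<in> {0..T} \<Longrightarrow> t \<in> {0..T} \<Longrightarrow> norm (x - y) < dp \<Longrightarrow> \<bar>s - t\<bar> < dp \<Longrightarrow> \<bar>\<psi> x s - \<psi> y t\<bar> < e"
    using \<psi>_unif_cont e unfolding uniformly_continuous_on_strip_iff by metis
  define R where "R = sqrt (2 * B / \<delta>)"
  obtain dl where dl: "dl > 0" "\<And>x y a s t. x \<in> cball 0 (R + 1) \<Longrightarrow> y \<in> cball 0 (R + 1) \<Longrightarrow> a \<in> A \<Longrightarrow> s \<in> {0..T} \<Longrightarrow> t \<in> {0..T} \<Longrightarrow>
       norm (x - y) < dl \<Longrightarrow> \<bar>s - t\<bar> < dl \<Longrightarrow> \<bar>l x a s - l y a t\<bar> < e"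
    by (rule l_equicontinuous_on_compact[OF compact_cball e, of 0 "R + 1"]) blast
  define d where "d = min (min du dv) (min dp dl)"
  have d: "d > 0" using du(1) dv(1) dp(1) dl(1) by (simp add: d_def)
  \<comment> \<open>The last summand forces the maximum point to within \<open>d\<close> of the diagonal, because there the
     penalization is at most \<open>2 * B\<close>.\<close>
  define \<kappa> where "\<kappa> = 4 * B + 1 + 5 * B / d\<^sup>2"
  have \<kappa>: "\<kappa> > 4 * B" "\<kappa> > 0" using B d by (auto simp: \<kappa>_def add_pos_pos add_pos_nonneg)
  have "5 * B / d\<^sup>2 \<le> \<kappa>" using B by (simp add: \<kappa>_def)
  then have "5 * B \<le> \<kappa> * d\<^sup>2" using d by (simp add: field_simps)
  then have \<kappa>d: "4 * B < \<kappa> * d\<^sup>2" using B by simp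
  define \<Phi> where "\<Phi> x t y s = u x t - v y s - \<kappa> / 2 * ((norm (x - y))\<^sup>2 + (t - s)\<^sup>2) - \<delta> * (norm x)\<^sup>2 - \<eta> * (T - t)" for x t y s
  have start: "\<Phi> x0 t0 x0 t0 \<ge> \<sigma> / 2"
  proof -
    have "\<eta> * (T - t0) \<le> \<eta> * T" using \<eta> t0 by (intro mult_left_mono) auto
    then show ?thesis using \<delta>1 \<eta>(2) unfolding \<Phi>_def by (simp add: \<sigma>_def)
  qed
  then have "\<Phi> x0 t0 x0 t0 > 0" using \<sigma> by simp
  then obtain x t y s where ts: "t \<in> {0..T}" "s \<in> {0..T}"
    and max: "\<And>x' t' y' s'. t' \<in> {0..T} \<Longrightarrow> s' \<in> {0..T} \<Longrightarrow> \<Phi> x' t' y' s' \<le> \<Phi> x t y s"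
    and xR: "norm x \<le> R" "norm y \<le> R + 1"
    unfolding R_def by (rule doubling_maximum[OF cu cv bu bv \<kappa>(1) \<delta> less_imp_le[OF \<eta>(1)] B \<Phi>_def t0]) blast
  have \<Phi>pos: "\<Phi> x t y s \<ge> \<sigma> / 2" using max[OF t0 t0, of x0 x0] start by simp
  define P where "P = \<kappa> / 2 * ((norm (x - y))\<^sup>2 + (t - s)\<^sup>2)"
  have P0: "P \<ge> 0" "\<delta> * (norm x)\<^sup>2 \<ge> 0" "\<eta> * (T - t) \<ge> 0" using \<kappa> \<delta> \<eta> ts by (auto simp: P_def)
  have "\<bar>u x t\<bar> \<le> B" "\<bar>v y s\<bar> \<le> B" using bu bv ts by auto
  then have gap: "u x t - v y s \<ge> \<sigma> / 2" "P \<le> 2 * B" "\<delta> * (norm x)\<^sup>2 \<le> 2 * B"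
    using \<Phi>pos P0 \<sigma> unfolding \<Phi>_def P_def[symmetric] by linarith+
  have "\<kappa> * ((norm (x - y))\<^sup>2 + (t - s)\<^sup>2) < \<kappa> * d\<^sup>2" using gap(2) \<kappa>d unfolding P_def by simp
  then have "(norm (x - y))\<^sup>2 + (t - s)\<^sup>2 < d\<^sup>2" using \<kappa>(2) by simp
  then have "(norm (x - y))\<^sup>2 < d\<^sup>2" "\<bar>t - s\<bar>\<^sup>2 < d\<^sup>2"
    using zero_le_power2[of "norm (x - y)"] zero_le_power2[of "t - s"] unfolding power2_abs by linarith+
  then have near: "norm (x - y) < d" "\<bar>t - s\<bar> < d"
    using d power2_less_imp_less[of _ d] by (metis less_imp_le)+
  \<comment> \<open>Comparison with the diagonal point \<open>(x, t, x, t)\<close> improves the crude bound on the penalization.\<close>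
  have Pe: "P \<le> e"
  proof -
    have "\<Phi> x t x t \<le> \<Phi> x t y s" using max ts by simp
    then have "P \<le> v x t - v y s" unfolding \<Phi>_def P_def by simp
    moreover have "\<bar>v x t - v y s\<bar> < e" using near ts by (intro dv(2)) (auto simp: d_def)
    ultimately show ?thesis by linarith
  qed
  have t_less: "t < T"
  proof (rule ccontr)
    assume "\<not> t < T"
    then have "u x t = v x t" using ts terminal by simp
    moreover have "\<bar>v x t - v y s\<bar> < e" using near ts by (intro dv(2)) (auto simp: d_def)
    ultimately show False using gap(1) e1 \<sigma> by linarith
  qed
  have s_less: "s < T"
  proof (rule ccontr)
    assume "\<not> s < T"
    then have "v y s = u y s" using ts terminal by simp
    moreover have "\<bar>u x t - u y s\<bar> < e" using near ts by (intro du(2)) (auto simp: d_def)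
    ultimately show False using gap(1) e1 \<sigma> by linarith
  qed
  define \<xi> where "\<xi> = \<kappa> *\<^sub>R (x - y)"
  define \<zeta> where "\<zeta> = (2 * \<delta>) *\<^sub>R x"
  have sub: "max (u x t - \<psi> x t) (- (\<kappa> * (t - s) - \<eta>) + lam * u x t + hamilton x t (\<xi> + \<zeta>)) \<le> 0"
  proof -
    let ?\<phi> = "\<lambda>x t. \<kappa> / 2 * ((norm (x - y))\<^sup>2 + (t - s)\<^sup>2) + \<delta> * (norm x)\<^sup>2 + (- \<eta>) * t"
    have "local_max_at T (\<lambda>x t. u x t - ?\<phi> x t) x t"
      unfolding local_max_at_def
    proof (intro exI[of _ 1] conjI ballI)
      fix w assume "w \<in> ball (x, t) 1 \<inter> (UNIV \<times> {0..<T})"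
      moreover obtain x' t' where w: "w = (x', t')" by (cases w)
      ultimately have "t' \<in> {0..T}" by auto
      from max[OF this ts(2), of x' y]
      show "case w of (x', t') \<Rightarrow> u x' t' - ?\<phi> x' t' \<le> u x t - ?\<phi> x t"
        unfolding \<Phi>_def w by (simp add: right_diff_distrib)
    qed simp
    moreover have "t \<in> {0..<T}" using ts t_less by simp
    ultimately have "max (u x t - \<psi> x t) (- (\<kappa> * (t - s) + - \<eta>) + lam * u x t + hamilton x t (\<kappa> *\<^sub>R (x - y) + (2 * \<delta>) *\<^sub>R x)) \<le> 0"
      using u C1_on_strip_quadratic[of T \<kappa> y s \<delta> "- \<eta>"]
      unfolding buc_viscosity_solution_def viscosity_solution_def by blast
    then show ?thesis by (simp add: \<xi>_def \<zeta>_def)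
  qed
  have super: "max (v y s - \<psi> y s) (- (\<kappa> * (t - s)) + lam * v y s + hamilton y s \<xi>) \<ge> 0"
  proof -
    let ?\<phi> = "\<lambda>y s. (- \<kappa>) / 2 * ((norm (y - x))\<^sup>2 + (s - t)\<^sup>2) + 0 * (norm y)\<^sup>2 + 0 * s"
    have "local_min_at T (\<lambda>y s. v y s - ?\<phi> y s) y s"
      unfolding local_min_at_def
    proof (intro exI[of _ 1] conjI ballI)
      fix w assume "w \<in> ball (y, s) 1 \<inter> (UNIV \<times> {0..<T})"
      moreover obtain y' s' where w: "w = (y', s')" by (cases w)
      ultimately have "s' \<in> {0..T}" by auto
      from max[OF ts(1) this, of x y']
      show "case w of (y', s') \<Rightarrow> v y s - ?\<phi> y s \<le> v y' s' - ?\<phi> y' s'"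
        unfolding \<Phi>_def w by (simp add: norm_minus_commute[of x] power2_commute[of t])
    qed simp
    moreover have "s \<in> {0..<T}" using ts s_less by simp
    ultimately have "max (v y s - \<psi> y s) (- ((- \<kappa>) * (s - t) + 0) + lam * v y s + hamilton y s ((- \<kappa>) *\<^sub>R (y - x) + (2 * 0) *\<^sub>R y)) \<ge> 0"
      using v C1_on_strip_quadratic[of T "- \<kappa>" x t 0 0]
      unfolding buc_viscosity_solution_def viscosity_solution_def by blast
    moreover have "(- \<kappa>) *\<^sub>R (y - x) + (2 * 0) *\<^sub>R y = \<xi>" by (simp add: \<xi>_def algebra_simps)
    moreover have "(- \<kappa>) * (s - t) + 0 = \<kappa> * (t - s)" by (simp add: algebra_simps)
    ultimately show ?thesis by metis
  qed
  have "\<not> v y s - \<psi> y s \<ge> 0"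
  proof
    assume "v y s - \<psi> y s \<ge> 0"
    moreover have "u x t - \<psi> x t \<le> 0" using sub by simp
    moreover have "\<bar>\<psi> x t - \<psi> y s\<bar> < e" using near ts by (intro dp(2)) (auto simp: d_def)
    ultimately show False using gap(1) e1 \<sigma> by linarith
  qed
  with super have 1: "- (\<kappa> * (t - s)) + lam * v y s + hamilton y s \<xi> \<ge> 0" by simp
  have 2: "- (\<kappa> * (t - s) - \<eta>) + lam * u x t + hamilton x t (\<xi> + \<zeta>) \<le> 0" using sub by simp
  have "hamilton y s \<xi> \<le> hamilton x t (\<xi> + \<zeta>) + (L * norm (x - y) * norm \<xi> + M * norm \<zeta> + e)"
  proof (rule hamilton_difference[OF ts(1)])
    fix a assume "a \<in> A"
    then show "\<bar>l x a t - l y a s\<bar> \<le> e"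
      using near ts xR by (intro less_imp_le dl(2)) (auto simp: d_def)
  qed
  moreover have "L * norm (x - y) * norm \<xi> \<le> 2 * L * e"
  proof -
    have "\<kappa> / 2 * (norm (x - y))\<^sup>2 \<le> P" using \<kappa> by (simp add: P_def distrib_left)
    then have "\<kappa> * (norm (x - y))\<^sup>2 \<le> 2 * e" using Pe by simp
    then have "L * (\<kappa> * (norm (x - y))\<^sup>2) \<le> L * (2 * e)" using L by (intro mult_left_mono) auto
    then show ?thesis using \<kappa> by (simp add: \<xi>_def power2_eq_square mult_ac)
  qed
  moreover have "M * norm \<zeta> \<le> \<eta> / 4"
  proof -
    have "(norm \<zeta>)\<^sup>2 = 4 * \<delta> * (\<delta> * (norm x)\<^sup>2)" using \<delta> by (simp add: \<zeta>_def power2_eq_square)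
    also have "\<dots> \<le> 4 * \<delta> * (2 * B)" using gap(3) \<delta> by (intro mult_left_mono) auto
    also have "\<dots> \<le> (\<eta> / (4 * (M + 1)))\<^sup>2" using \<delta>2 by (simp add: mult_ac)
    finally have "norm \<zeta> \<le> \<eta> / (4 * (M + 1))" by (rule power2_le_imp_le) (use \<eta> M1 in auto)
    then have "(M + 1) * norm \<zeta> \<le> \<eta> / 4" using M1 by (simp add: field_simps)
    moreover have "M * norm \<zeta> \<le> (M + 1) * norm \<zeta>" by (intro mult_right_mono) auto
    ultimately show ?thesis by simp
  qed
  moreover have "lam * v y s \<le> lam * u x t" using gap(1) \<sigma> lam by (intro mult_left_mono) auto
  moreover have "2 * L * e + e \<le> 2 * ((L + 1) * e)" using e by (simp add: algebra_simps)
  ultimately show False using 1 2 eL \<eta>(1) by linarith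
qed

end

section \<open>From optimal stopping to optimal switching\<close>

text \<open>
  Every clause of the notion of solution evaluates the function on the strip only, and only there do
  the switching value and the stopping value agree.
\<close>
lemma buc_viscosity_solution_cong:
  fixes u w :: "real ^ 'd \<Rightarrow> real \<Rightarrow> real"
  assumes eq: "\<And>x t. t \<in> {0..T} \<Longrightarrow> u x t = w x t" and T: "T > 0"
    and w: "buc_viscosity_solution lam T \<psi> H w"
  shows "buc_viscosity_solution lam T \<psi> H u"
proof -
  have img: "(\<lambda>(x, t). u x t) ` (UNIV \<times> {0..T}) = (\<lambda>(x, t). w x t) ` (UNIV \<times> {0..T})"
    using eq by (intro image_cong) auto
  have uc: "uniformly_continuous_on (UNIV \<times> {0..T}) (\<lambda>(x, t). u x t)"
    using w eq unfolding buc_viscosity_solution_def uniformly_continuous_on_strip_iff by simp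
  have lmax: "local_max_at T (\<lambda>x t. u x t - \<phi> x t) x t = local_max_at T (\<lambda>x t. w x t - \<phi> x t) x t"
    and lmin: "local_min_at T (\<lambda>x t. u x t - \<phi> x t) x t = local_min_at T (\<lambda>x t. w x t - \<phi> x t) x t"
    if "t \<in> {0..<T}" for \<phi> :: "real ^ 'd \<Rightarrow> real \<Rightarrow> real" and x t
    unfolding local_max_at_def local_min_at_def using that eq
    by (auto intro!: ex_cong1 conj_cong refl ball_cong)
  show ?thesis
    unfolding buc_viscosity_solution_def viscosity_solution_def
  proof (intro conjI allI impI ballI)
    show "bounded ((\<lambda>(x, t). u x t) ` (UNIV \<times> {0..T}))"
      using w by (simp add: img buc_viscosity_solution_def)
    show "uniformly_continuous_on (UNIV \<times> {0..T}) (\<lambda>(x, t). u x t)" by (rule uc)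
    then show "continuous_on (UNIV \<times> {0..T}) (\<lambda>(x, t). u x t)" by (rule uniformly_continuous_imp_continuous)
    show "u x T = \<psi> x T" for x
      using w eq[of T x] T by (simp add: buc_viscosity_solution_def viscosity_solution_def)
  next
    fix \<phi> Dt :: "real ^ 'd \<Rightarrow> real \<Rightarrow> real" and Dx x t
    assume C1: "C1_on_strip T \<phi> Dx Dt" and t: "t \<in> {0..<T}"
    then have ut: "u x t = w x t" using eq by auto
    have wv: "viscosity_solution lam T \<psi> H w" using w by (simp add: buc_viscosity_solution_def)
    show "max (u x t - \<psi> x t) (- Dt x t + lam * u x t + H x t (Dx x t)) \<le> 0"
      if "local_max_at T (\<lambda>x t. u x t - \<phi> x t) x t"
      using wv C1 t that unfolding lmax[OF t] ut viscosity_solution_def by blast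
    show "max (u x t - \<psi> x t) (- Dt x t + lam * u x t + H x t (Dx x t)) \<ge> 0"
      if "local_min_at T (\<lambda>x t. u x t - \<phi> x t) x t"
      using wv C1 t that unfolding lmin[OF t] ut viscosity_solution_def by blast
  qed
qed

lemma all_ones_in_successors: "p \<noteq> all_ones \<Longrightarrow> all_ones \<in> successors p"
  by (auto simp: successors_def all_ones_def vec_eq_iff)

lemma card_zeros_successor:
  assumes "p' \<in> successors p"
  shows "card {i. \<not> p' $ i} < card {i. \<not> p $ i}"
proof -
  have "{i. \<not> p' $ i} \<subset> {i. \<not> p $ i}" using assms unfolding successors_def by auto
  then show ?thesis by (auto intro: psubset_card_mono)
qed

definition buc_on_strip :: "real \<Rightarrow> (real ^ 'd \<Rightarrow> real \<Rightarrow> real) \<Rightarrow> bool" where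
  "buc_on_strip T u \<longleftrightarrow> bounded ((\<lambda>(x, t). u x t) ` (UNIV \<times> {0..T})) \<and>
     uniformly_continuous_on (UNIV \<times> {0..T}) (\<lambda>(x, t). u x t)"

lemma buc_on_strip_add:
  assumes "buc_on_strip T u" "buc_on_strip T v"
  shows "buc_on_strip T (\<lambda>x t. u x t + v x t)"
  using assms bounded_plus_comp[of "\<lambda>(x, t). u x t" _ "\<lambda>(x, t). v x t"]
    uniformly_continuous_on_add[of _ "\<lambda>(x, t). u x t" "\<lambda>(x, t). v x t"]
  unfolding buc_on_strip_def by (auto simp: case_prod_unfold)

text \<open>A finite infimum admits the smallest of the radii \<open>\<delta>\<close> of its members and the largest of their bounds.\<close>
lemma buc_on_strip_INF:
  fixes u :: "'i \<Rightarrow> real ^ 'd \<Rightarrow> real \<Rightarrow> real"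
  assumes fin: "finite I" and ne: "I \<noteq> {}" and u: "\<And>i. i \<in> I \<Longrightarrow> buc_on_strip T (u i)"
  shows "buc_on_strip T (\<lambda>x t. INF i\<in>I. u i x t)"
proof -
  have lower: "(INF i\<in>I. u i x t) \<le> u j x t" if "j \<in> I" for j x t
    using that fin by (intro cINF_lower bdd_below_finite) auto
  have "\<exists>B. \<forall>x. \<forall>t\<in>{0..T}. \<bar>u i x t\<bar> \<le> B" if "i \<in> I" for i
    using u[OF that] unfolding buc_on_strip_def bounded_iff by auto
  then obtain B where B: "\<And>i x t. i \<in> I \<Longrightarrow> t \<in> {0..T} \<Longrightarrow> \<bar>u i x t\<bar> \<le> B i" by metis
  define b where "b = Max (B ` I)"
  have Bb: "B i \<le> b" if "i \<in> I" for i using that fin by (simp add: b_def)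
  have bd: "\<bar>INF i\<in>I. u i x t\<bar> \<le> b" if t: "t \<in> {0..T}" for x t
  proof -
    obtain j where j: "j \<in> I" using ne by blast
    have "- b \<le> (INF i\<in>I. u i x t)"
    proof (rule cINF_greatest[OF ne])
      fix i assume "i \<in> I"
      then show "- b \<le> u i x t" using B[of i t x] Bb[of i] t by linarith
    qed
    then show ?thesis using lower[OF j, of x t] B[OF j t, of x] Bb[OF j] by linarith
  qed
  have "uniformly_continuous_on (UNIV \<times> {0..T}) (\<lambda>(x, t). INF i\<in>I. u i x t)"
    unfolding uniformly_continuous_on_strip_iff
  proof (intro allI impI)
    fix e :: real assume e: "e > 0"
    have "\<exists>d>0. \<forall>x y. \<forall>s\<in>{0..T}. \<forall>t\<in>{0..T}. norm (x - y) < d \<longrightarrow> \<bar>s - t\<bar> < d \<longrightarrow> \<bar>u i x s - u i y t\<bar> < e / 2" if "i \<in> I" for i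
      using u[OF that] half_gt_zero[OF e] unfolding buc_on_strip_def uniformly_continuous_on_strip_iff by blast
    then obtain d where d: "\<And>i. i \<in> I \<Longrightarrow> d i > 0" "\<And>i x y s t. i \<in> I \<Longrightarrow> s \<in> {0..T} \<Longrightarrow> t \<in> {0..T} \<Longrightarrow>
        norm (x - y) < d i \<Longrightarrow> \<bar>s - t\<bar> < d i \<Longrightarrow> \<bar>u i x s - u i y t\<bar> < e / 2" by metis
    define \<delta> where "\<delta> = Min (d ` I)"
    have \<delta>: "\<delta> > 0" "\<And>i. i \<in> I \<Longrightarrow> \<delta> \<le> d i" using fin ne d(1) by (auto simp: \<delta>_def)
    have half: "(INF i\<in>I. u i x s) - e / 2 \<le> (INF i\<in>I. u i y t)"
      if "s \<in> {0..T}" "t \<in> {0..T}" "norm (x - y) < \<delta>" "\<bar>s - t\<bar> < \<delta>" for x y s t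
    proof (rule cINF_greatest[OF ne])
      fix i assume i: "i \<in> I"
      have "\<bar>u i x s - u i y t\<bar> < e / 2" using that \<delta>(2)[OF i] by (intro d(2)[OF i]) auto
      then show "(INF i\<in>I. u i x s) - e / 2 \<le> u i y t" using lower[OF i, of x s] by linarith
    qed
    show "\<exists>d>0. \<forall>x y. \<forall>s\<in>{0..T}. \<forall>t\<in>{0..T}. norm (x - y) < d \<longrightarrow> \<bar>s - t\<bar> < d \<longrightarrow>
        \<bar>(INF i\<in>I. u i x s) - (INF i\<in>I. u i y t)\<bar> < e"
    proof (intro exI[of _ \<delta>] conjI \<delta>(1) allI ballI impI)
      fix x y :: "real ^ 'd" and s t
      assume a: "s \<in> {0..T}" "t \<in> {0..T}" "norm (x - y) < \<delta>" "\<bar>s - t\<bar> < \<delta>"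
      have "norm (y - x) < \<delta>" "\<bar>t - s\<bar> < \<delta>" using a by (auto simp: norm_minus_commute)
      from half[OF a] half[OF a(2,1) this] e
      show "\<bar>(INF i\<in>I. u i x s) - (INF i\<in>I. u i y t)\<bar> < e" by linarith
    qed
  qed
  with bd show ?thesis unfolding buc_on_strip_def bounded_iff by (auto intro!: exI[of _ b])
qed

text \<open>The data shared by all modes, so that the induction over the modes can quantify over \<open>p\<close>.\<close>
locale switching_system =
  fixes A :: "(real ^ 'm) set"
    and f :: "real ^ 'd \<Rightarrow> real ^ 'm \<Rightarrow> bool ^ 'n \<Rightarrow> real ^ 'd"
    and ell :: "real ^ 'd \<Rightarrow> real ^ 'm \<Rightarrow> bool ^ 'n \<Rightarrow> real \<Rightarrow> real"
    and C :: "real ^ 'd \<Rightarrow> bool ^ 'n \<Rightarrow> bool ^ 'n \<Rightarrow> real"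
    and lam T L :: real
  assumes T: "T > 0" and lam: "lam \<ge> 0"
    and A: "compact A" "A \<noteq> {}"
    and f_cont: "continuous_on (UNIV \<times> A \<times> UNIV) (\<lambda>(x, a, q). f x a q)"
    and f_bounded: "bounded ((\<lambda>(x, a, q). f x a q) ` (UNIV \<times> A \<times> UNIV))"
    and L: "L > 0"
    and f_Lipschitz: "\<And>x y a q. a \<in> A \<Longrightarrow> norm (f x a q - f y a q) \<le> L * norm (x - y)"
    and l_bounded: "bounded ((\<lambda>(x, a, q, t). ell x a q t) ` (UNIV \<times> A \<times> UNIV \<times> {0..T}))"
    and l_cont: "continuous_on (UNIV \<times> A \<times> UNIV \<times> {0..T}) (\<lambda>(x, a, q, t). ell x a q t)"
    and l_unif_cont: "\<forall>\<epsilon>>0. \<exists>\<delta>>0. \<forall>x y. norm (x - y) < \<delta> \<longrightarrow>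
           (\<forall>a\<in>A. \<forall>q. \<forall>t\<in>{0..T}. \<bar>ell x a q t - ell y a q t\<bar> < \<epsilon>)"
    and C_bounded: "bounded ((\<lambda>(x, q, q'). C x q q') ` {(x, q, q'). q' \<in> successors q})"
    and C_unif_cont: "\<forall>\<epsilon>>0. \<exists>\<delta>>0. \<forall>x y. norm (x - y) < \<delta> \<longrightarrow>
           (\<forall>q. \<forall>q'\<in>successors q. \<bar>C x q q' - C y q q'\<bar> < \<epsilon>)"
begin

abbreviation "V \<equiv> value_fun A f ell C lam T"
abbreviation "\<Psi> \<equiv> obstacle A f ell C lam T"

lemma switching_cost_buc:
  assumes "p' \<in> successors p"
  shows "buc_on_strip T (\<lambda>x t. C x p p')"
proof -
  obtain b where b: "\<And>x q q'. q' \<in> successors q \<Longrightarrow> \<bar>C x q q'\<bar> \<le> b"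
    using C_bounded unfolding bounded_iff by auto
  have "uniformly_continuous_on (UNIV \<times> {0..T}) (\<lambda>(x, t). C x p p')"
    unfolding uniformly_continuous_on_strip_iff
  proof (intro allI impI)
    fix e :: real assume "e > 0"
    with C_unif_cont obtain d where "d > 0" "\<And>x y q q'. norm (x - y) < d \<Longrightarrow> q' \<in> successors q \<Longrightarrow> \<bar>C x q q' - C y q q'\<bar> < e"
      by meson
    then show "\<exists>d>0. \<forall>x y. \<forall>s\<in>{0..T}. \<forall>t\<in>{0..T}. norm (x - y) < d \<longrightarrow> \<bar>s - t\<bar> < d \<longrightarrow> \<bar>C x p p' - C y p p'\<bar> < e"
      using assms by (intro exI[of _ d]) auto
  qed
  then show ?thesis using b[OF assms] unfolding buc_on_strip_def bounded_iff by (auto intro!: exI[of _ b])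
qed

lemma stopping_problem_of_mode:
  assumes p: "p \<noteq> all_ones" and V: "\<And>p'. p' \<in> successors p \<Longrightarrow> buc_on_strip T (V p')"
  obtains M K where "stopping_problem A (\<lambda>x a. f x a p) M L T (\<lambda>x a t. ell x a p t) (\<Psi> p) lam K"
proof -
  obtain M where M: "\<And>x a q. a \<in> A \<Longrightarrow> norm (f x a q) \<le> M"
    using f_bounded unfolding bounded_iff by auto
  have "\<exists>K. \<forall>x. \<forall>a\<in>A. \<forall>q. \<forall>t\<in>{0..T}. \<bar>ell x a q t\<bar> \<le> K"
    using l_bounded unfolding bounded_iff by auto
  then obtain K1 where K1: "\<And>x a q t. a \<in> A \<Longrightarrow> t \<in> {0..T} \<Longrightarrow> \<bar>ell x a q t\<bar> \<le> K1" by blast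
  have "buc_on_strip T (\<lambda>x t. INF p'\<in>successors p. C x p p' + V p' x t)"
    using all_ones_in_successors[OF p] switching_cost_buc V
    by (intro buc_on_strip_INF buc_on_strip_add) auto
  then have \<Psi>: "buc_on_strip T (\<Psi> p)" by (simp add: obstacle_def[abs_def])
  then have "\<exists>K. \<forall>x. \<forall>t\<in>{0..T}. \<bar>\<Psi> p x t\<bar> \<le> K"
    unfolding buc_on_strip_def bounded_iff by auto
  then obtain K2 where K2: "\<And>x t. t \<in> {0..T} \<Longrightarrow> \<bar>\<Psi> p x t\<bar> \<le> K2" by blast
  have cf: "continuous_on (UNIV \<times> A) (\<lambda>(x, a). f x a p)"
  proof -
    have "continuous_on (UNIV \<times> A) (\<lambda>z. (\<lambda>(x, a, q). f x a q) (fst z, snd z, p))"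
      by (rule continuous_on_compose2[OF f_cont]) (auto intro!: continuous_intros)
    then show ?thesis by (simp add: case_prod_unfold)
  qed
  have cl: "continuous_on (UNIV \<times> A \<times> {0..T}) (\<lambda>(x, a, t). ell x a p t)"
  proof -
    have "continuous_on (UNIV \<times> A \<times> {0..T}) (\<lambda>z. (\<lambda>(x, a, q, t). ell x a q t) (fst z, fst (snd z), p, snd (snd z)))"
      by (rule continuous_on_compose2[OF l_cont]) (auto intro!: continuous_intros)
    then show ?thesis by (simp add: case_prod_unfold)
  qed
  have "stopping_problem A (\<lambda>x a. f x a p) M L T (\<lambda>x a t. ell x a p t) (\<Psi> p) lam (max K1 K2)"
  proof
    show "\<bar>ell x a p t\<bar> \<le> max K1 K2" if "a \<in> A" "t \<in> {0..T}" for x a t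
      using K1[OF that, of x p] by simp
    show "\<bar>\<Psi> p x t\<bar> \<le> max K1 K2" if "t \<in> {0..T}" for x t
      using K2[OF that, of x] by simp
    show "\<forall>e>0. \<exists>d>0. \<forall>x y. norm (x - y) < d \<longrightarrow> (\<forall>a\<in>A. \<forall>t\<in>{0..T}. \<bar>ell x a p t - ell y a p t\<bar> < e)"
      using l_unif_cont by meson
  qed (use A cf M L f_Lipschitz T lam cl \<Psi> in \<open>auto simp: buc_on_strip_def\<close>)
  then show ?thesis by (rule that)
qed

text \<open>
  The infimum over \<open>(\<alpha>, y, \<tau>, p')\<close> can be taken first over \<open>p'\<close>, with the rest fixed. There are finitely
  many successors, so the inner infimum is attained and yields exactly the stopping cost.
\<close>
lemma value_fun_eq_stopping_value:
  assumes p: "p \<noteq> all_ones" and t: "t \<in> {0..T}"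
    and S: "stopping_problem A (\<lambda>x a. f x a p) M L T (\<lambda>x a t. ell x a p t) (\<Psi> p) lam K"
  shows "V p x t = stopping_problem.stopping_value A (\<lambda>x a. f x a p) T (\<lambda>x a t. ell x a p t) (\<Psi> p) lam x t"
proof -
  interpret S: stopping_problem A "\<lambda>x a. f x a p" M L T "\<lambda>x a t. ell x a p t" "\<Psi> p" lam K by (rule S)
  define J where "J = (\<lambda>\<alpha> y \<tau> p'. (LINT s:{t..\<tau>}|lebesgue. exp (- lam * (s - t)) * ell (y s) (\<alpha> s) p s) +
            exp (- lam * (\<tau> - t)) * (C (y \<tau>) p p' + V p' (y \<tau>) \<tau>))"
  define Z where "Z = {(\<alpha>, y, \<tau>, p'). \<alpha> \<in> controls A \<and> is_trajectory f T p \<alpha> x t y \<and> \<tau> \<in> {t..T} \<and> p' \<in> successors p}"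
  have Veq: "V p x t = (INF (\<alpha>, y, \<tau>, p') \<in> Z. J \<alpha> y \<tau> p')"
    unfolding Z_def J_def by (subst value_fun.simps) (simp add: p)
  have Z: "(\<alpha>, y, \<tau>, p') \<in> Z \<longleftrightarrow> (\<alpha>, y, \<tau>) \<in> S.strategies x t \<and> p' \<in> successors p" for \<alpha> y \<tau> p'
    unfolding Z_def S.strategies_def using S.is_trajectory_iff_trajectory[of f p \<alpha> t x y] t by auto
  have J: "J \<alpha> y \<tau> p' = S.running_cost \<alpha> y t \<tau> + exp (- lam * (\<tau> - t)) * (C (y \<tau>) p p' + V p' (y \<tau>) \<tau>)"
    if "(\<alpha>, y, \<tau>) \<in> S.strategies x t" for \<alpha> y \<tau> p'
  proof -
    have a: "\<alpha> \<in> controls A" "S.trajectory \<alpha> x t y" "t \<le> \<tau>" "\<tau> \<le> T" using that by (auto simp: S.strategies_def)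
    have "continuous_on {t..\<tau>} y"
      using continuous_on_subset[OF S.trajectory_continuous[OF a(1,2)]] a t by auto
    from S.running_absolutely_integrable[OF a(1) this _ a(4), of t] t
    show ?thesis unfolding J_def S.running_cost_def by (simp add: set_lebesgue_integral_eq_integral(2))
  qed
  have obst_le: "\<Psi> p z s \<le> C z p p' + V p' z s" if "p' \<in> successors p" for p' z s
    unfolding obstacle_def using that by (intro cINF_lower bdd_below_finite) auto
  have cost_le: "S.cost \<alpha> y t \<tau> \<le> J \<alpha> y \<tau> p'" if "(\<alpha>, y, \<tau>) \<in> S.strategies x t" "p' \<in> successors p" for \<alpha> y \<tau> p'
    unfolding S.cost_def J[OF that(1)] using obst_le[OF that(2)] by simp
  have attained: "\<exists>p'\<in>successors p. \<Psi> p z s = C z p p' + V p' z s" for z s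
  proof -
    have "\<Psi> p z s \<in> (\<lambda>p'. C z p p' + V p' z s) ` successors p"
      unfolding obstacle_def using all_ones_in_successors[OF p]
      by (subst cInf_eq_Min) (auto intro!: Min_in)
    then show ?thesis by auto
  qed
  have bdd: "bdd_below ((\<lambda>(\<alpha>, y, \<tau>, p'). J \<alpha> y \<tau> p') ` Z)"
  proof (rule bdd_belowI2[of _ "- (K * T + K)"])
    fix z assume z: "z \<in> Z"
    obtain \<alpha> y \<tau> p' where zz: "z = (\<alpha>, y, \<tau>, p')" by (cases z) auto
    with z have st: "(\<alpha>, y, \<tau>) \<in> S.strategies x t" "p' \<in> successors p" using Z by auto
    from S.cost_bound[OF st(1)] cost_le[OF st] t
    show "- (K * T + K) \<le> (case z of (\<alpha>, y, \<tau>, p') \<Rightarrow> J \<alpha> y \<tau> p')" unfolding zz by auto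
  qed
  show ?thesis
  proof (rule antisym)
    show "V p x t \<le> S.stopping_value x t"
    proof (rule S.le_stopping_value)
      fix \<alpha> y \<tau> assume st: "(\<alpha>, y, \<tau>) \<in> S.strategies x t"
      obtain p' where p': "p' \<in> successors p" "\<Psi> p (y \<tau>) \<tau> = C (y \<tau>) p p' + V p' (y \<tau>) \<tau>"
        using attained by blast
      have "(\<alpha>, y, \<tau>, p') \<in> Z" using st p' Z by simp
      from cINF_lower[OF bdd this] have "V p x t \<le> J \<alpha> y \<tau> p'" unfolding Veq by simp
      also have "\<dots> = S.cost \<alpha> y t \<tau>" unfolding J[OF st] S.cost_def p'(2) ..
      finally show "V p x t \<le> S.cost \<alpha> y t \<tau>" .
    qed (use t in auto)
    show "S.stopping_value x t \<le> V p x t"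
      unfolding Veq
    proof (rule cINF_greatest)
      obtain s where "s \<in> S.strategies x t" using S.strategies_nonempty[of t x] t by auto
      then show "Z \<noteq> {}" using Z all_ones_in_successors[OF p] by (cases s) blast
      fix z assume z: "z \<in> Z"
      obtain \<alpha> y \<tau> p' where zz: "z = (\<alpha>, y, \<tau>, p')" by (cases z) auto
      with z have st: "(\<alpha>, y, \<tau>) \<in> S.strategies x t" "p' \<in> successors p" using Z by auto
      from S.stopping_value_le_cost[OF st(1)] cost_le[OF st] t
      show "S.stopping_value x t \<le> (case z of (\<alpha>, y, \<tau>, p') \<Rightarrow> J \<alpha> y \<tau> p')" unfolding zz by simp
    qed
  qed
qed

text \<open>
  One step of the induction: regularity of all successor values makes mode \<open>p\<close> a stopping problem to
  which existence and comparison apply. Comparing in both directions gives uniqueness.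
\<close>
lemma value_fun_viscosity_solution:
  assumes p: "p \<noteq> all_ones" and V: "\<And>p'. p' \<in> successors p \<Longrightarrow> buc_on_strip T (V p')"
  shows "buc_viscosity_solution lam T (\<Psi> p) (hamiltonian A f ell p) (V p)"
    and "buc_viscosity_solution lam T (\<Psi> p) (hamiltonian A f ell p) u \<Longrightarrow> t \<in> {0..T} \<Longrightarrow> u x t = V p x t"
proof -
  from stopping_problem_of_mode[OF assms] obtain M K where
    S: "stopping_problem A (\<lambda>x a. f x a p) M L T (\<lambda>x a t. ell x a p t) (\<Psi> p) lam K" .
  interpret S: stopping_problem A "\<lambda>x a. f x a p" M L T "\<lambda>x a t. ell x a p t" "\<Psi> p" lam K by (rule S)
  have H: "hamiltonian A f ell p = S.hamilton"
    by (simp add: fun_eq_iff hamiltonian_def S.hamilton_def)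
  show 1: "buc_viscosity_solution lam T (\<Psi> p) (hamiltonian A f ell p) (V p)"
    unfolding H
    using value_fun_eq_stopping_value[OF p _ S] T S.stopping_value_buc_viscosity_solution
    by (rule buc_viscosity_solution_cong)
  show "u x t = V p x t" if "buc_viscosity_solution lam T (\<Psi> p) (hamiltonian A f ell p) u" "t \<in> {0..T}"
    using S.viscosity_comparison[of u "V p" t x] S.viscosity_comparison[of "V p" u t x] 1 that
    unfolding H by (auto intro: antisym)
qed

lemma value_fun_buc: "buc_on_strip T (V p)"
proof (induction "card {i. \<not> p $ i}" arbitrary: p rule: less_induct)
  case less
  show ?case
  proof (cases "p = all_ones")
    case True
    have "V p x t = 0" for x t by (subst value_fun.simps) (simp add: True)
    then have "V p = (\<lambda>x t. 0)" by (simp add: fun_eq_iff)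
    then show ?thesis by (auto simp: buc_on_strip_def uniformly_continuous_on_const case_prod_unfold bounded_iff)
  next
    case False
    from value_fun_viscosity_solution(1)[OF False less[OF card_zeros_successor]]
    show ?thesis by (simp add: buc_viscosity_solution_def buc_on_strip_def)
  qed
qed

end

theorem theorem2p4:
  fixes A :: "(real ^ 'm) set"
    and f :: "real ^ 'd \<Rightarrow> real ^ 'm \<Rightarrow> bool ^ 'n \<Rightarrow> real ^ 'd"
    and ell :: "real ^ 'd \<Rightarrow> real ^ 'm \<Rightarrow> bool ^ 'n \<Rightarrow> real \<Rightarrow> real"
    and C :: "real ^ 'd \<Rightarrow> bool ^ 'n \<Rightarrow> bool ^ 'n \<Rightarrow> real"
    and lam T L :: real
    and p :: "bool ^ 'n"
  assumes T: "T > 0" and lam: "lam \<ge> 0"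
    and A: "compact A" "A \<noteq> {}"
    and f_cont: "continuous_on (UNIV \<times> A \<times> UNIV) (\<lambda>(x, a, q). f x a q)"
    and f_bounded: "bounded ((\<lambda>(x, a, q). f x a q) ` (UNIV \<times> A \<times> UNIV))"
    and L: "L > 0"
    and f_Lipschitz: "\<And>x y a q. a \<in> A \<Longrightarrow> norm (f x a q - f y a q) \<le> L * norm (x - y)"
    and l_nonneg: "\<And>x a q t. a \<in> A \<Longrightarrow> t \<in> {0..T} \<Longrightarrow> ell x a q t \<ge> 0"
    and l_bounded: "bounded ((\<lambda>(x, a, q, t). ell x a q t) ` (UNIV \<times> A \<times> UNIV \<times> {0..T}))"
    and l_cont: "continuous_on (UNIV \<times> A \<times> UNIV \<times> {0..T}) (\<lambda>(x, a, q, t). ell x a q t)"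
    and l_unif_cont: "\<forall>\<epsilon>>0. \<exists>\<delta>>0. \<forall>x y. norm (x - y) < \<delta> \<longrightarrow>
           (\<forall>a\<in>A. \<forall>q. \<forall>t\<in>{0..T}. \<bar>ell x a q t - ell y a q t\<bar> < \<epsilon>)"
    and C_nonneg: "\<And>x q q'. C x q q' \<ge> 0"
    and C_bounded: "bounded ((\<lambda>(x, q, q'). C x q q') ` {(x, q, q'). q' \<in> successors q})"
    and C_unif_cont: "\<forall>\<epsilon>>0. \<exists>\<delta>>0. \<forall>x y. norm (x - y) < \<delta> \<longrightarrow>
           (\<forall>q. \<forall>q'\<in>successors q. \<bar>C x q q' - C y q q'\<bar> < \<epsilon>)"
    and p: "p \<noteq> all_ones"
  shows "buc_viscosity_solution lam T (obstacle A f ell C lam T p) (hamiltonian A f ell p)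
           (value_fun A f ell C lam T p)
       \<and> (\<forall>u. buc_viscosity_solution lam T (obstacle A f ell C lam T p) (hamiltonian A f ell p) u \<longrightarrow>
            (\<forall>x. \<forall>t\<in>{0..T}. u x t = value_fun A f ell C lam T p x t))"
proof -
  interpret switching_system A f ell C lam T L
    using assms by unfold_locales auto
  from value_fun_viscosity_solution[OF p value_fun_buc] show ?thesis by blast
qed

end
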